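(* Let $L>0$ and $\mathcal S=\mathbb R\times(0,L)$. For $0<\nu<\infty$, $\lambda>\frac{\pi^5}{2L^2}$ and $0<\mu<M_1\nu$, there exists a minimizer $\tilde\omega\in\tilde K_{\mu,\nu}$ such that $$-E_{2,\lambda}[\tilde\omega]=\inf_{\omega\in\tilde K_{\mu,\nu}}\{-E_{2,\lambda}[\omega]\}.$$ Moreover, $\int_{\mathcal S}x_2\tilde\omega\,dx=\mu$ and $\tilde\omega$ has compact support. In particular, $\tilde\omega$ is also a minimizer of $-E_{2,\lambda}$ over $K_{\mu,\nu}$.
   Context: Points are $x=(x_1,x_2)$. $G$ is the Green's function of $-\Delta$ on $\mathcal S$ with zero Dirichlet boundary condition, $$G(x,y)=\frac1{4\pi}\ln\Big(1+\frac{\sin(\frac{\pi}{L}x_2)\sin(\frac{\pi}{L}y_2)}{\sinh(\frac{\pi}{2L}(x_1-y_1))^2+\sin(\frac{\pi}{2L}(x_2-y_2))^2}\Big).$$ $$E[\omega]=\frac12\int_{\mathcal S}\int_{\mathcal S} G(x,y)\omega(x)\omega(y)\,dx\,dy,\qquad E_{2,\lambda}[\omega]=E[\omega]-\frac1{2\lambda}\|\omega\|_{L^2(\mathcal S)}^2,$$ $$K_{\mu,\nu}=\Big\{\omega\in L^2(\mathcal S):\ \omega\ge0,\ \int_{\mathcal S} x_2\omega\,dx=\mu,\ \int_{\mathcal S}\omega\,dx\le\nu\Big\},$$ $$\tilde K_{\mu,\nu}=\Big\{\omega\in L^2\cap L^1(\mathcal S):\ \omega\ge0,\ \int_{\mathcal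 S} x_2\omega\,dx\le\mu,\ \int_{\mathcal S}\omega\,dx\le\nu\Big\}.$$ $S_{\mu,\nu,\lambda}$ is the set of minimizers of $-E_{2,\lambda}$ over $K_{\mu,\nu}$. Every minimizer $\omega\in S_{\mu,1,\lambda}$ (for $0<\mu<L/2$, $\lambda\ge\pi^5/(2L^2)$) has the form $\omega=\lambda(\psi-Wx_2-\gamma)_+$ with $\psi(x)=\int_{\mathcal S}G(x,y)\omega(y)dy$ and constants $W,\gamma\in\mathbb R$ uniquely determined by $\omega$. $M_1\in(0,L/2]$ denotes a constant (depending on $\lambda,L$) such that for $0<\mu<L/2$ with $\mu\le M_1$ every $\omega\in S_{\mu,1,\lambda}$ satisfies $\int_{\mathcal S}\omega\,dx<1$, $\gamma=0$ and $W>0$. *)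

theory Defs
  imports "HOL-Analysis.Analysis"
begin

text \<open>
  Elements of \<open>L\<^sup>p\<close> of the strip are represented by functions on the whole plane of which only the
  (Borel measurable) restriction to the strip matters; pointwise conditions hold almost everywhere.
\<close>

definition strip :: "real \<Rightarrow> (real \<times> real) set" where
  "strip L = UNIV \<times> {0<..<L}"

text \<open>On the diagonal, a null set, the quotient is \<open>_ / 0 = 0\<close>.\<close>

definition green :: "real \<Rightarrow> real \<times> real \<Rightarrow> real \<times> real \<Rightarrow> real" where
  "green L x y = 1 / (4 * pi) *
     ln (1 + sin (pi / L * snd x) * sin (pi / L * snd y) /
       ((sinh (pi / (2 * L) * (fst x - fst y)))\<^sup>2 + (sin (pi / (2 * L) * (snd x - snd y)))\<^sup>2))"

definition L1_strip :: "real \<Rightarrow> (real \<times> real \<Rightarrow> real) set" where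
  "L1_strip L = {\<omega>. set_integrable lborel (strip L) \<omega>}"

definition L2_strip :: "real \<Rightarrow> (real \<times> real \<Rightarrow> real) set" where
  "L2_strip L = {\<omega>. set_borel_measurable lborel (strip L) \<omega> \<and>
     set_integrable lborel (strip L) (\<lambda>x. (\<omega> x)\<^sup>2)}"

definition mass :: "real \<Rightarrow> (real \<times> real \<Rightarrow> real) \<Rightarrow> real" where
  "mass L \<omega> = (LINT x:strip L|lborel. \<omega> x)"

definition impulse :: "real \<Rightarrow> (real \<times> real \<Rightarrow> real) \<Rightarrow> real" where
  "impulse L \<omega> = (LINT x:strip L|lborel. snd x * \<omega> x)"

definition stream :: "real \<Rightarrow> (real \<times> real \<Rightarrow> real) \<Rightarrow> real \<times> real \<Rightarrow> real" where
  "stream L \<omega> x = (LINT y:strip L|lborel. green L x y * \<omega> y)"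

definition energy :: "real \<Rightarrow> (real \<times> real \<Rightarrow> real) \<Rightarrow> real" where
  "energy L \<omega> = 1 / 2 *
     (LINT x:strip L|lborel. (LINT y:strip L|lborel. green L x y * \<omega> x * \<omega> y))"

definition energy2 :: "real \<Rightarrow> real \<Rightarrow> (real \<times> real \<Rightarrow> real) \<Rightarrow> real" where
  "energy2 L lam \<omega> = energy L \<omega> - 1 / (2 * lam) * (LINT x:strip L|lborel. (\<omega> x)\<^sup>2)"

text \<open>
  Membership in \<open>L1_strip\<close> expresses that the mass of the nonnegative function \<open>\<omega>\<close> is finite: the
  Bochner integral of a non-integrable function is \<open>0\<close>, so \<open>mass L \<omega> \<le> \<nu>\<close> alone would not.
\<close>

definition K_set :: "real \<Rightarrow> real \<Rightarrow> real \<Rightarrow> (real \<times> real \<Rightarrow> real) set" where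
  "K_set L \<mu> \<nu> = {\<omega> \<in> L2_strip L \<inter> L1_strip L.
     (AE x\<in>strip L in lborel. 0 \<le> \<omega> x) \<and> impulse L \<omega> = \<mu> \<and> mass L \<omega> \<le> \<nu>}"

definition K_relaxed :: "real \<Rightarrow> real \<Rightarrow> real \<Rightarrow> (real \<times> real \<Rightarrow> real) set" where
  "K_relaxed L \<mu> \<nu> = {\<omega> \<in> L2_strip L \<inter> L1_strip L.
     (AE x\<in>strip L in lborel. 0 \<le> \<omega> x) \<and> impulse L \<omega> \<le> \<mu> \<and> mass L \<omega> \<le> \<nu>}"

definition S_set :: "real \<Rightarrow> real \<Rightarrow> real \<Rightarrow> real \<Rightarrow> (real \<times> real \<Rightarrow> real) set" where
  "S_set L \<mu> \<nu> lam =
     {\<omega>. is_arg_min (\<lambda>\<omega>. - energy2 L lam \<omega>) (\<lambda>\<omega>. \<omega> \<in> K_set L \<mu> \<nu>) \<omega>}"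

definition has_multipliers :: "real \<Rightarrow> real \<Rightarrow> (real \<times> real \<Rightarrow> real) \<Rightarrow> real \<Rightarrow> real \<Rightarrow> bool" where
  "has_multipliers L lam \<omega> W \<gamma> \<longleftrightarrow>
     (AE x\<in>strip L in lborel. \<omega> x = lam * max 0 (stream L \<omega> x - W * snd x - \<gamma>))"

text \<open>
  The minimizers quantified over below have exactly one pair of multipliers, so quantifying over
  all pairs is the same as speaking about that pair.
\<close>

definition small_impulse_const :: "real \<Rightarrow> real \<Rightarrow> real \<Rightarrow> bool" where
  "small_impulse_const L lam M1 \<longleftrightarrow> 0 < M1 \<and> M1 \<le> L / 2 \<and>
     (\<forall>\<mu> \<omega>. 0 < \<mu> \<longrightarrow> \<mu> < L / 2 \<longrightarrow> \<mu> \<le> M1 \<longrightarrow> \<omega> \<in> S_set L \<mu> 1 lam \<longrightarrow>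
        mass L \<omega> < 1 \<and> (\<forall>W \<gamma>. has_multipliers L lam \<omega> W \<gamma> \<longrightarrow> \<gamma> = 0 \<and> 0 < W))"

end

theory Submission
  imports Defs
begin

text \<open>
  Write \<open>F\<close> for the functional \<open>E\<^bsub>2,\<lambda>\<^esub>\<close>, a quadratic form on nonnegative vorticities. Three operations
  do not decrease \<open>F\<close> and preserve the constraints.

  First, \<open>\<omega> \<mapsto> min \<omega> (\<lambda> \<psi>)\<close>, where \<open>\<psi>\<close> is the stream function of \<open>\<omega>\<close>; this makes competitors with
  \<open>F \<ge> 0\<close> uniformly bounded. Second, cut the strip into slabs of length \<open>d\<close>; where \<open>\<omega>\<close> has little mass
  near a slab, \<open>\<psi> \<le> \<epsilon> x\<^sub>2\<close> holds on that slab, so deleting \<open>\<omega>\<close> there costs at most \<open>\<epsilon>\<close> times the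
  deleted impulse, which is regained by rescaling, because \<open>F\<close> is homogeneous of degree 2. The number of
  remaining slabs is bounded by the mass. Third, these slabs may be moved together, since \<open>G\<close> decreases
  in \<open>\<bar>x\<^sub>1 - y\<^sub>1\<bar>\<close>.

  So only uniformly bounded competitors in one fixed bounded box matter, and there weak-* compactness of
  bounded sequences yields a maximizer of \<open>F\<close>. It has compact support. Its rescaling by \<open>1/\<nu>\<close> belongs to some
  \<open>S\<^bsub>\<mu>',1,\<lambda>\<^esub>\<close> with \<open>\<mu>' < M\<^sub>1\<close>, hence its mass is below \<open>\<nu>\<close>; an impulse below \<open>\<mu>\<close> would then
  allow a further enlargement, which increases \<open>F > 0\<close>.
\<close>

section \<open>Weak-* compactness of bounded functions\<close>

text \<open>The functional is invariant under horizontal translation of an unbounded strip, so a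
  maximizing sequence may spread out or split and lose energy in the weak limit. The surgery
  therefore acts on single competitors, with constants depending only on L, \<lambda>, \<mu>, \<nu>
  and a positive lower bound e for F. The bound on a light slab has to be linear in the height: the
  loss is then measured in impulse, the very quantity that deletion frees. Deleting impulse m also
  frees mass at least m/L, so both constraints leave room for a factor 1/(1 - \<kappa> m), and F
  \<ge> e makes this factor cover a loss of e \<kappa> m. Stating the constraints as inequalities
  keeps deletion and truncation admissible. Rescaling can exceed the uniform bound, so truncation is
  applied once more at the end. On a fixed box the energy is weakly continuous because the Green's
  function is integrable there, and the L^2 term is handled by convexity. The lower bound on
  \<lambda> makes F positive at the indicator of a suitable rectangle.\<close>

lemma product_cluster_point:
  fixes m :: "nat \<Rightarrow> 'b \<Rightarrow> real"
  assumes "\<And>n A. 0 \<le> m n A \<and> m n A \<le> c"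
  obtains H x where "H \<noteq> bot" "H \<le> sequentially" "\<And>A. ((\<lambda>n. m n A) \<longlongrightarrow> x A) H"
proof -
  \<comment> \<open>Tychonoff: the sequence lives in a product of compact intervals, so it has a
    cluster point x. The index type may be uncountable, which is why convergence is along a filter H
    and not along a subsequence.\<close>
  have c: "compact (PiE UNIV (\<lambda>_::'b. {0..c}))"
    using compactin_PiE[of "\<lambda>_::'b. euclidean :: real topology" UNIV "\<lambda>_. {0..c}"]
    by (simp add: euclidean_product_topology)
  have "eventually (\<lambda>u. u \<in> PiE UNIV (\<lambda>_::'b. {0..c})) (filtermap m sequentially)"
    using assms by (auto simp: eventually_filtermap PiE_def)
  moreover have "filtermap m sequentially \<noteq> bot"
    by (simp add: filtermap_bot_iff)
  ultimately obtain x where x: "inf (nhds x) (filtermap m sequentially) \<noteq> bot"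
    using c unfolding compact_filter by blast
  define H where "H = inf (filtercomap m (nhds x)) sequentially"
  have "H \<noteq> bot"
  proof
    assume "H = bot"
    then have "eventually (\<lambda>_. False) H" by simp
    then obtain P Q where "eventually P (filtercomap m (nhds x))" and Q: "eventually Q sequentially"
      and PQ: "\<And>n. \<lbrakk>P n; Q n\<rbrakk> \<Longrightarrow> False"
      unfolding H_def eventually_inf by blast
    then obtain P' where P': "eventually P' (nhds x)" "\<And>n. P' (m n) \<Longrightarrow> P n"
      unfolding eventually_filtercomap by blast
    \<comment> \<open>If H were trivial, the sequence would eventually avoid the neighbourhood
      \<open>P'\<close> of x, contrary to x being a cluster point.\<close>
    have "eventually (\<lambda>u. \<not> P' u) (filtermap m sequentially)"
      unfolding eventually_filtermap using Q by eventually_elim (use P' PQ in blast)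
    then have "eventually (\<lambda>_. False) (inf (nhds x) (filtermap m sequentially))"
      unfolding eventually_inf using P' by blast
    then show False using x by (simp add: eventually_False)
  qed
  moreover have "H \<le> sequentially" by (simp add: H_def)
  moreover have "((\<lambda>n. m n A) \<longlongrightarrow> x A) H" for A
  proof -
    have lim: "filterlim m (nhds x) H"
      unfolding H_def by (rule filterlim_mono[OF filterlim_filtercomap order_refl]) simp
    have cont: "continuous_on UNIV (\<lambda>u :: 'b \<Rightarrow> real. u A)"
      by (rule continuous_on_product_coordinates)
    show ?thesis
      using continuous_on_tendsto_compose[OF cont lim] by simp
  qed
  ultimately show ?thesis by (rule that)
qed

text \<open>An epsilon/3 argument: the errors \<open>e k\<close> are uniform in n, so the limits in
  n and k may be interchanged. It closes the approximation steps of both weak convergence proofs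
  below.\<close>

lemma tendsto_uniform_approx:
  fixes a :: "'i \<Rightarrow> real"
  assumes H: "\<And>k. (b k \<longlongrightarrow> l k) H"
    and e: "e \<longlonglongrightarrow> 0"
    and ab: "\<And>k n. \<bar>a n - b k n\<bar> \<le> e k" and l: "\<And>k. \<bar>l0 - l k\<bar> \<le> e k"
  shows "(a \<longlongrightarrow> l0) H"
proof (rule tendstoI)
  fix r :: real assume "r > 0"
  then have "eventually (\<lambda>k. dist (e k) 0 < r / 3) sequentially"
    using e by (intro tendstoD) auto
  then obtain k where k: "e k < r / 3"
    unfolding eventually_sequentially dist_real_def by (metis abs_less_iff diff_0_right order_refl)
  have "eventually (\<lambda>n. dist (b k n) (l k) < r / 3) H"
    using \<open>r > 0\<close> H by (intro tendstoD) auto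
  then show "eventually (\<lambda>n. dist (a n) l0 < r) H"
  proof eventually_elim
    case (elim n)
    then show ?case using ab[of n k] l[of k] k unfolding dist_real_def by arith
  qed
qed

text \<open>A limit of measures along a filter is a priori only finitely additive. Domination by a
  multiple of a finite measure makes the tails of a disjoint union small, which gives countable
  additivity; Radon-Nikodym then yields f, and the same domination bounds it by B.\<close>

lemma measure_of_dominated_limit:
  assumes "finite_measure M" and B: "0 \<le> B"
    and pos: "\<And>A. A \<in> sets M \<Longrightarrow> 0 \<le> x A" and le: "\<And>A. A \<in> sets M \<Longrightarrow> x A \<le> B * measure M A"
    and add: "\<And>A C. \<lbrakk>A \<in> sets M; C \<in> sets M; A \<inter> C = {}\<rbrakk> \<Longrightarrow> x (A \<union> C) = x A + x C"
  obtains f :: "'a \<Rightarrow> real" where "f \<in> borel_measurable M" "\<And>t. 0 \<le> f t" "\<And>t. f t \<le> B"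
    "\<And>A. A \<in> sets M \<Longrightarrow> x A = (\<integral>t. indicator A t * f t \<partial>M)"
proof -
  interpret finite_measure M by fact
  have x0: "x {} = 0" using add[of "{}" "{}"] by simp
  define N where "N = measure_of (space M) (sets M) (\<lambda>A. ennreal (x A))"
  have sN: "sets N = sets M" "space N = space M" by (auto simp: N_def)
  have fin: "x (\<Union>i<n. F i) = (\<Sum>i<n. x (F i))" if "range F \<subseteq> sets M" "disjoint_family F" for F :: "nat \<Rightarrow> 'a set" and n
  proof (induction n)
    case (Suc n)
    have "F i \<inter> F n = {}" if "i < n" for i
      using that by (intro disjoint_family_onD[OF \<open>disjoint_family F\<close>]) auto
    then have "(\<Union>i<n. F i) \<inter> F n = {}" by blast
    then have "x ((\<Union>i<n. F i) \<union> F n) = x (\<Union>i<n. F i) + x (F n)"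
      using that by (intro add) auto
    then show ?case using Suc by (simp add: lessThan_Suc Un_commute)
  qed (simp add: x0)
  have ca: "countably_additive (sets M) (\<lambda>A. ennreal (x A))"
  proof (rule countably_additiveI)
    fix F :: "nat \<Rightarrow> 'a set" assume F: "range F \<subseteq> sets M" "disjoint_family F" "(\<Union>i. F i) \<in> sets M"
    have "(\<lambda>n. x (\<Union>i<n. F i)) \<longlonglongrightarrow> x (\<Union>i. F i)"
    proof (rule tendsto_sandwich)
      show "eventually (\<lambda>n. x (\<Union>i<n. F i) \<le> x (\<Union>i. F i)) sequentially"
      proof (intro always_eventually allI)
        fix n
        have "x ((\<Union>i<n. F i) \<union> ((\<Union>i. F i) - (\<Union>i<n. F i))) = x (\<Union>i<n. F i) + x ((\<Union>i. F i) - (\<Union>i<n. F i))"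
          using F by (intro add) auto
        moreover have "(\<Union>i<n. F i) \<union> ((\<Union>i. F i) - (\<Union>i<n. F i)) = (\<Union>i. F i)" by auto
        moreover have "0 \<le> x ((\<Union>i. F i) - (\<Union>i<n. F i))" using F by (intro pos) auto
        ultimately show "x (\<Union>i<n. F i) \<le> x (\<Union>i. F i)" by simp
      qed
      show "eventually (\<lambda>n. x (\<Union>i. F i) - B * (measure M (\<Union>i. F i) - measure M (\<Union>i<n. F i)) \<le> x (\<Union>i<n. F i)) sequentially"
      proof (intro always_eventually allI)
        fix n
        have "x ((\<Union>i<n. F i) \<union> ((\<Union>i. F i) - (\<Union>i<n. F i))) = x (\<Union>i<n. F i) + x ((\<Union>i. F i) - (\<Union>i<n. F i))"
          using F by (intro add) auto
        moreover have "(\<Union>i<n. F i) \<union> ((\<Union>i. F i) - (\<Union>i<n. F i)) = (\<Union>i. F i)" by auto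
        moreover have "x ((\<Union>i. F i) - (\<Union>i<n. F i)) \<le> B * measure M ((\<Union>i. F i) - (\<Union>i<n. F i))"
          using F by (intro le) auto
        moreover have "measure M ((\<Union>i. F i) - (\<Union>i<n. F i)) = measure M (\<Union>i. F i) - measure M (\<Union>i<n. F i)"
          using F by (intro finite_measure_Diff) auto
        ultimately show "x (\<Union>i. F i) - B * (measure M (\<Union>i. F i) - measure M (\<Union>i<n. F i)) \<le> x (\<Union>i<n. F i)" by simp
      qed
      have "(\<lambda>n. measure M (\<Union>i<n. F i)) \<longlonglongrightarrow> measure M (\<Union>n. \<Union>i<n. F i)"
        using F by (intro finite_Lim_measure_incseq) (auto simp: incseq_def intro: less_le_trans)
      moreover have "(\<Union>n. \<Union>i<n. F i) = (\<Union>i. F i)" by auto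
      ultimately show "(\<lambda>n. x (\<Union>i. F i) - B * (measure M (\<Union>i. F i) - measure M (\<Union>i<n. F i))) \<longlonglongrightarrow> x (\<Union>i. F i)"
        by (auto intro!: tendsto_eq_intros)
    qed auto
    then have "(\<lambda>i. x (F i)) sums x (\<Union>i. F i)"
      unfolding sums_def using fin F by simp
    then show "(\<Sum>i. ennreal (x (F i))) = ennreal (x (\<Union>i. F i))"
      using pos F by (intro suminf_ennreal_eq) auto
  qed
  have eN: "emeasure N A = ennreal (x A)" if "A \<in> sets M" for A
    using that ca unfolding N_def
    by (intro emeasure_measure_of_sigma sets.sigma_algebra_axioms) (auto simp: positive_def x0)
  interpret N: finite_measure N
    by (rule finite_measureI) (simp add: eN sN)
  have "absolutely_continuous M N"
    unfolding absolutely_continuous_def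
  proof
    fix A assume A: "A \<in> null_sets M"
    then have "measure M A = 0" "A \<in> sets M" by (auto simp: measure_def)
    then show "A \<in> null_sets N" using le[of A] pos[of A] by (auto simp: null_sets_def sN eN)
  qed
  then obtain g where g: "g \<in> borel_measurable M" "density M g = N"
    using Radon_Nikodym_finite_measure[of N] sN N.finite_measure_axioms by auto
  have gN: "(\<integral>\<^sup>+t. g t * indicator A t \<partial>M) = ennreal (x A)" if "A \<in> sets M" for A
    using emeasure_density[OF g(1) that] g(2) eN[OF that] by simp
  \<comment> \<open>On the set where the density is at least B + 1/(k+1), integration contradicts
    the domination unless the set is null.\<close>
  have gB: "AE t in M. g t \<le> ennreal B"
  proof -
    define A where "A k = {t \<in> space M. ennreal (B + 1 / Suc k) \<le> g t}" for k
    have A: "A k \<in> sets M" for k unfolding A_def using g(1) by measurable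
    have "measure M (A k) = 0" for k
    proof -
      have "ennreal ((B + 1 / Suc k) * measure M (A k)) = (\<integral>\<^sup>+t. ennreal (B + 1 / Suc k) * indicator (A k) t \<partial>M)"
        using A B by (simp add: nn_integral_cmult_indicator emeasure_eq_measure ennreal_mult)
      also have "\<dots> \<le> (\<integral>\<^sup>+t. g t * indicator (A k) t \<partial>M)"
        by (intro nn_integral_mono) (auto simp: A_def split: split_indicator)
      also have "\<dots> \<le> ennreal (B * measure M (A k))"
        using gN[OF A] le[OF A] by (simp add: ennreal_leI)
      finally have "(B + 1 / Suc k) * measure M (A k) \<le> B * measure M (A k)"
        using B by (simp add: ennreal_le_iff)
      then have "1 / Suc k * measure M (A k) \<le> 0" by (simp add: algebra_simps)
      then show ?thesis using measure_nonneg[of M "A k"]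
        by (simp add: divide_le_0_iff)
    qed
    then have "A k \<in> null_sets M" for k
      using A by (auto simp: null_sets_def emeasure_eq_measure)
    then have "AE t in M. \<forall>k. t \<notin> A k"
      by (auto simp: AE_all_countable intro: AE_not_in)
    then show ?thesis
    proof (rule AE_mp, intro AE_I2 impI)
      fix t assume t: "t \<in> space M" "\<forall>k. t \<notin> A k"
      show "g t \<le> ennreal B"
      proof (rule LIMSEQ_le_const)
        have "(\<lambda>k. B + 1 / real (Suc k)) \<longlonglongrightarrow> B + 0"
          by (intro tendsto_add tendsto_const LIMSEQ_Suc[OF lim_1_over_n])
        then show "(\<lambda>k. ennreal (B + 1 / real (Suc k))) \<longlonglongrightarrow> ennreal B"
          by (intro tendsto_ennrealI) simp
        show "\<exists>N. \<forall>n\<ge>N. g t \<le> ennreal (B + 1 / real (Suc n))"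
          using t by (auto simp: A_def not_le intro!: exI[of _ 0] less_imp_le)
      qed
    qed
  qed
  \<comment> \<open>Cutting at B changes the density on a null set only and makes the bound hold at
    every point.\<close>
  define f where "f t = min B (enn2real (g t))" for t
  have f: "f \<in> borel_measurable M" unfolding f_def using g(1) by measurable
  have f01: "0 \<le> f t" "f t \<le> B" for t using B by (auto simp: f_def)
  have "x A = (\<integral>t. indicator A t * f t \<partial>M)" if A: "A \<in> sets M" for A
  proof -
    have "ennreal (x A) = (\<integral>\<^sup>+t. g t * indicator A t \<partial>M)" using gN[OF A] by simp
    also have "\<dots> = (\<integral>\<^sup>+t. ennreal (indicator A t * f t) \<partial>M)"
    proof (rule nn_integral_cong_AE, use gB in eventually_elim)
      fix t assume "g t \<le> ennreal B"
      then have "g t \<noteq> top" and "enn2real (g t) \<le> B"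
        using B by (auto simp: enn2real_leI top_unique)
      then have "ennreal (f t) = g t" by (simp add: f_def min_absorb2 less_top)
      then show "g t * indicator A t = ennreal (indicator A t * f t)" by (auto split: split_indicator)
    qed
    also have "\<dots> = ennreal (\<integral>t. indicator A t * f t \<partial>M)"
    proof (rule nn_integral_eq_integral)
      show "integrable M (\<lambda>t. indicator A t * f t)"
        by (rule integrable_const_bound[of _ B]) (use f f01 A B in \<open>auto split: split_indicator\<close>)
      show "AE t in M. 0 \<le> indicator A t * f t" using f01 by auto
    qed
    finally show ?thesis
      using pos[OF A] f01 by (subst (asm) ennreal_inj) (auto intro!: integral_nonneg_AE)
  qed
  with f f01 show ?thesis by (rule that)
qed

lemma integrable_mult_bounded_nonneg:
  fixes \<phi> u :: "'a \<Rightarrow> real"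
  assumes "integrable M \<phi>" "u \<in> borel_measurable M" "\<And>t. 0 \<le> u t" "\<And>t. u t \<le> B"
  shows "integrable M (\<lambda>t. \<phi> t * u t)"
proof (rule Bochner_Integration.integrable_bound)
  show "integrable M (\<lambda>t. B * \<phi> t)" using assms by auto
  show "(\<lambda>t. \<phi> t * u t) \<in> borel_measurable M" using assms by auto
  have "\<bar>\<phi> t\<bar> * u t \<le> \<bar>\<phi> t\<bar> * \<bar>B\<bar>" for t
    using assms(3,4)[of t] by (intro mult_left_mono) auto
  then show "AE t in M. norm (\<phi> t * u t) \<le> norm (B * \<phi> t)"
    using assms(3) by (auto simp: abs_mult mult.commute)
qed

text \<open>Linearity and density extend the convergence from indicators to integrable test
  functions: replacing a test function costs at most B times an L^1 distance, uniformly in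
  n.\<close>

lemma weak_convergence_from_sets:
  fixes u :: "nat \<Rightarrow> 'a \<Rightarrow> real" and v :: "'a \<Rightarrow> real"
  assumes meas: "\<And>n. u n \<in> borel_measurable M" "v \<in> borel_measurable M"
    and u: "\<And>n t. 0 \<le> u n t" "\<And>n t. u n t \<le> B" and v: "\<And>t. 0 \<le> v t" "\<And>t. v t \<le> B"
    and sets: "\<And>A. A \<in> sets M \<Longrightarrow>
      ((\<lambda>n. \<integral>t. indicator A t * u n t \<partial>M) \<longlongrightarrow> (\<integral>t. indicator A t * v t \<partial>M)) H"
    and "integrable M \<phi>"
  shows "((\<lambda>n. \<integral>t. \<phi> t * u n t \<partial>M) \<longlongrightarrow> (\<integral>t. \<phi> t * v t \<partial>M)) H"
  using \<open>integrable M \<phi>\<close>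
proof (induction rule: integrable_induct)
  case (base A c)
  have "((\<lambda>n. c * (\<integral>t. indicator A t * u n t \<partial>M)) \<longlongrightarrow> c * (\<integral>t. indicator A t * v t \<partial>M)) H"
    using sets[OF base(1)] by (intro tendsto_mult_left)
  then show ?case
    by (simp add: mult_ac flip: integral_mult_right_zero)
next
  case (add \<phi> \<phi>')
  have "integrable M (\<lambda>t. \<phi> t * u n t)" "integrable M (\<lambda>t. \<phi>' t * u n t)" for n
    using add meas u by (auto intro!: integrable_mult_bounded_nonneg[where B = B])
  moreover have "integrable M (\<lambda>t. \<phi> t * v t)" "integrable M (\<lambda>t. \<phi>' t * v t)"
    using add meas v by (auto intro!: integrable_mult_bounded_nonneg[where B = B])
  ultimately show ?case
    using tendsto_add[OF add(3,4)] by (simp add: distrib_right)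
next
  case (lim \<phi> s)
  have conv: "(\<lambda>k. \<integral>t. \<bar>\<phi> t - s k t\<bar> \<partial>M) \<longlonglongrightarrow> (\<integral>t. 0 \<partial>M)"
  proof (rule integral_dominated_convergence)
    \<comment> \<open>The approximating functions satisfy |s_k| \<le> 2 |\<phi>|, hence the factor
      3.\<close>
    show "integrable M (\<lambda>t. 3 * \<bar>\<phi> t\<bar>)" using lim by auto
    show "AE t in M. (\<lambda>k. \<bar>\<phi> t - s k t\<bar>) \<longlonglongrightarrow> 0"
    proof (intro AE_I2)
      fix t assume "t \<in> space M"
      then have "(\<lambda>k. \<bar>\<phi> t - s k t\<bar>) \<longlonglongrightarrow> \<bar>\<phi> t - \<phi> t\<bar>"
        using lim by (intro tendsto_intros) auto
      then show "(\<lambda>k. \<bar>\<phi> t - s k t\<bar>) \<longlonglongrightarrow> 0" by simp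
    qed
    show "AE t in M. norm \<bar>\<phi> t - s k t\<bar> \<le> 3 * \<bar>\<phi> t\<bar>" for k
    proof (intro AE_I2)
      fix t assume "t \<in> space M"
      from lim(3)[OF this, of k] show "norm \<bar>\<phi> t - s k t\<bar> \<le> 3 * \<bar>\<phi> t\<bar>" by auto
    qed
  qed (use lim in \<open>auto intro!: borel_measurable_integrable\<close>)
  have est: "\<bar>(\<integral>t. \<phi> t * g t \<partial>M) - (\<integral>t. s k t * g t \<partial>M)\<bar> \<le> B * (\<integral>t. \<bar>\<phi> t - s k t\<bar> \<partial>M)"
    if g: "g \<in> borel_measurable M" "\<And>t. 0 \<le> g t" "\<And>t. g t \<le> B" for g k
  proof -
    have i: "integrable M (\<lambda>t. \<phi> t * g t)" "integrable M (\<lambda>t. s k t * g t)"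
      using lim g by (auto intro!: integrable_mult_bounded_nonneg[where B = B])
    then have "(\<integral>t. \<phi> t * g t \<partial>M) - (\<integral>t. s k t * g t \<partial>M) = (\<integral>t. (\<phi> t - s k t) * g t \<partial>M)"
      by (simp add: left_diff_distrib)
    also have "\<bar>\<dots>\<bar> \<le> (\<integral>t. \<bar>(\<phi> t - s k t) * g t\<bar> \<partial>M)" by (rule integral_abs_bound)
    also have "\<dots> \<le> (\<integral>t. B * \<bar>\<phi> t - s k t\<bar> \<partial>M)"
    proof (rule integral_mono)
      show "integrable M (\<lambda>t. \<bar>(\<phi> t - s k t) * g t\<bar>)"
        using i by (auto simp: left_diff_distrib)
      show "integrable M (\<lambda>t. B * \<bar>\<phi> t - s k t\<bar>)" using lim by auto
      show "\<bar>(\<phi> t - s k t) * g t\<bar> \<le> B * \<bar>\<phi> t - s k t\<bar>" for t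
        using g(2,3)[of t] by (auto simp: abs_mult mult.commute[of B] intro!: mult_left_mono)
    qed
    finally show ?thesis by simp
  qed
  show ?case
  proof (rule tendsto_uniform_approx)
    show "((\<lambda>n. \<integral>t. s k t * u n t \<partial>M) \<longlongrightarrow> (\<integral>t. s k t * v t \<partial>M)) H" for k by (rule lim)
    show "(\<lambda>k. B * (\<integral>t. \<bar>\<phi> t - s k t\<bar> \<partial>M)) \<longlonglongrightarrow> 0"
      using tendsto_mult_left[OF conv, of B] by simp
  qed (use est meas u v in auto)
qed

text \<open>The set functions sending A to the integral of w_n over A have a cluster point, which is
  dominated by B times the measure and so has a density. One filter H serves all test functions at
  once.\<close>

lemma weak_star_cluster_point:
  fixes w :: "nat \<Rightarrow> 'a \<Rightarrow> real"
  assumes "finite_measure M" and meas: "\<And>n. w n \<in> borel_measurable M"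
    and w: "\<And>n t. 0 \<le> w n t" "\<And>n t. w n t \<le> B"
  shows "\<exists>H f. H \<noteq> bot \<and> H \<le> sequentially \<and> f \<in> borel_measurable M \<and> (\<forall>t. 0 \<le> f t \<and> f t \<le> B) \<and>
    (\<forall>\<phi>. integrable M \<phi> \<longrightarrow> ((\<lambda>n. \<integral>t. \<phi> t * w n t \<partial>M) \<longlongrightarrow> (\<integral>t. \<phi> t * f t \<partial>M)) H)"
proof -
  interpret finite_measure M by fact
  have B: "0 \<le> B" using w[of 0 undefined] by linarith
  \<comment> \<open>The value 0 at non-measurable sets lets the index of the product range over all
    sets.\<close>
  define m where "m n A = (if A \<in> sets M then \<integral>t. indicator A t * w n t \<partial>M else 0)" for n A
  have i: "integrable M (\<lambda>t. indicator A t * w n t)" if "A \<in> sets M" for n A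
    using that meas w
    by (intro integrable_mult_bounded_nonneg[where B = B] integrable_real_indicator)
      (auto simp: less_top[symmetric])
  have m: "0 \<le> m n A" "m n A \<le> B * measure M A" if "A \<in> sets M" for n A
  proof -
    show "0 \<le> m n A" using w by (auto simp: m_def intro!: integral_nonneg_AE)
    have "(\<integral>t. indicator A t * w n t \<partial>M) \<le> (\<integral>t. B * indicator A t \<partial>M)"
    proof (rule integral_mono)
      show "integrable M (\<lambda>t. B * indicator A t)"
        using that by (intro integrable_mult_right integrable_real_indicator) (auto simp: less_top[symmetric])
    qed (use that w i in \<open>auto split: split_indicator\<close>)
    then have "m n A \<le> (\<integral>t. B * indicator A t \<partial>M)" using that by (simp add: m_def)
    then show "m n A \<le> B * measure M A" using that by simp
  qed
  have "0 \<le> m n A \<and> m n A \<le> B * measure M (space M)" for n A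
  proof (cases "A \<in> sets M")
    case True
    then show ?thesis using m[OF True, of n] B bounded_measure[of A]
      by (meson mult_left_mono order_trans)
  qed (use B in \<open>auto simp: m_def\<close>)
  then obtain H x where H: "H \<noteq> bot" "H \<le> sequentially" and x: "\<And>A. ((\<lambda>n. m n A) \<longlongrightarrow> x A) H"
    using product_cluster_point[of m "B * measure M (space M)"] by metis
  obtain f where f: "f \<in> borel_measurable M" "\<And>t. 0 \<le> f t" "\<And>t. f t \<le> B"
    and xf: "\<And>A. A \<in> sets M \<Longrightarrow> x A = (\<integral>t. indicator A t * f t \<partial>M)"
  proof (rule measure_of_dominated_limit[of M B x])
    show "0 \<le> x A" if "A \<in> sets M" for A
      using m[OF that] by (intro tendsto_lowerbound[OF x _ H(1)]) auto
    show "x A \<le> B * measure M A" if "A \<in> sets M" for A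
      using m[OF that] by (intro tendsto_upperbound[OF x _ H(1)]) auto
    show "x (A \<union> C) = x A + x C" if "A \<in> sets M" "C \<in> sets M" "A \<inter> C = {}" for A C
    proof (rule tendsto_unique[OF H(1) x])
      have "m n (A \<union> C) = m n A + m n C" for n
      proof -
        have "indicator (A \<union> C) t * w n t = indicator A t * w n t + indicator C t * w n t" for t
          using that by (auto split: split_indicator)
        then show ?thesis using that i by (simp add: m_def)
      qed
      then show "((\<lambda>n. m n (A \<union> C)) \<longlongrightarrow> x A + x C) H"
        using tendsto_add[OF x x] by simp
    qed
  qed (use B finite_measure_axioms in auto)
  have "((\<lambda>n. \<integral>t. \<phi> t * w n t \<partial>M) \<longlongrightarrow> (\<integral>t. \<phi> t * f t \<partial>M)) H" if "integrable M \<phi>" for \<phi>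
  proof (rule weak_convergence_from_sets[OF meas f(1) w f(2,3) _ that])
    fix A assume "A \<in> sets M"
    then show "((\<lambda>n. \<integral>t. indicator A t * w n t \<partial>M) \<longlongrightarrow> (\<integral>t. indicator A t * f t \<partial>M)) H"
      using x[of A] xf[of A] by (simp add: m_def)
  qed
  with H f show ?thesis by blast
qed

text \<open>Products of weakly convergent sequences need not converge, but here the factors depend
  on different variables: over a rectangle the integral splits into two convergent integrals.
  Rectangles form an intersection-stable generator, so Dynkin's lemma reaches all measurable sets.
  Applied to the Green's function, this gives weak continuity of the quadratic energy.\<close>

lemma weak_convergence_tensor:
  fixes w :: "nat \<Rightarrow> 'a \<Rightarrow> real"
  assumes "finite_measure M" and meas: "\<And>n. w n \<in> borel_measurable M" "f \<in> borel_measurable M"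
    and w: "\<And>n t. 0 \<le> w n t" "\<And>n t. w n t \<le> B" and f: "\<And>t. 0 \<le> f t" "\<And>t. f t \<le> B"
    and conv: "\<And>\<phi>. integrable M \<phi> \<Longrightarrow>
      ((\<lambda>n. \<integral>t. \<phi> t * w n t \<partial>M) \<longlongrightarrow> (\<integral>t. \<phi> t * f t \<partial>M)) H"
    and K: "integrable (M \<Otimes>\<^sub>M M) K"
  shows "((\<lambda>n. \<integral>z. K z * (w n (fst z) * w n (snd z)) \<partial>(M \<Otimes>\<^sub>M M)) \<longlongrightarrow>
    (\<integral>z. K z * (f (fst z) * f (snd z)) \<partial>(M \<Otimes>\<^sub>M M))) H"
proof -
  interpret finite_measure M by fact
  interpret P: pair_sigma_finite M M by standard
  interpret PP: finite_measure "M \<Otimes>\<^sub>M M"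
    by (rule finite_measure_pair_measure) fact+
  have BB: "0 \<le> g (fst z) * g (snd z)" "g (fst z) * g (snd z) \<le> B * B"
    if "\<And>t. 0 \<le> g t" "\<And>t. g t \<le> B" for g :: "'a \<Rightarrow> real" and z
    using that by (auto intro!: mult_mono order_trans[OF that])
  have mm: "(\<lambda>z. g (fst z) * g (snd z)) \<in> borel_measurable (M \<Otimes>\<^sub>M M)"
    if [measurable]: "g \<in> borel_measurable M" for g :: "'a \<Rightarrow> real"
    by measurable
  have int: "integrable (M \<Otimes>\<^sub>M M) (\<lambda>z. indicator A z * (g (fst z) * g (snd z)))"
    if "g \<in> borel_measurable M" "\<And>t. 0 \<le> g t" "\<And>t. g t \<le> B" "A \<in> sets (M \<Otimes>\<^sub>M M)" for g A
    using that BB[of g]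
    by (intro integrable_mult_bounded_nonneg[where B = "B * B"] mm integrable_real_indicator)
      (auto simp: less_top[symmetric])
  define \<Omega> where "\<Omega> = space M \<times> space M"
  define G where "G = {a \<times> b | a b. a \<in> sets M \<and> b \<in> sets M}"
  have sP: "sets (M \<Otimes>\<^sub>M M) = sigma_sets \<Omega> G"
    unfolding \<Omega>_def G_def by (rule sets_pair_measure)
  define I where "I A g = (\<integral>z. indicator A z * (g (fst z) * g (snd z)) \<partial>(M \<Otimes>\<^sub>M M))" for A and g :: "'a \<Rightarrow> real"
  have rect: "I (a \<times> b) g = (\<integral>t. indicator a t * g t \<partial>M) * (\<integral>t. indicator b t * g t \<partial>M)"
    if "g \<in> borel_measurable M" "\<And>t. 0 \<le> g t" "\<And>t. g t \<le> B" "a \<in> sets M" "b \<in> sets M" for a b g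
  proof -
    have "integrable (M \<Otimes>\<^sub>M M) (\<lambda>z. indicator (a \<times> b) z * (g (fst z) * g (snd z)))"
      using that by (intro int) auto
    then have "integrable (M \<Otimes>\<^sub>M M) (\<lambda>(s, t). (indicator a s * g s) * (indicator b t * g t))"
      by (simp add: case_prod_unfold indicator_times mult_ac)
    from P.integral_fst'[OF this]
    have "(\<integral>s. (\<integral>t. (indicator a s * g s) * (indicator b t * g t) \<partial>M) \<partial>M) = I (a \<times> b) g"
      by (simp add: I_def case_prod_unfold indicator_times mult_ac)
    then show ?thesis by simp
  qed
  have "((\<lambda>n. I A (w n)) \<longlongrightarrow> I A f) H" if "A \<in> sets (M \<Otimes>\<^sub>M M)" for A
  proof -
    have rect_lim: "((\<lambda>n. I (a \<times> b) (w n)) \<longlongrightarrow> I (a \<times> b) f) H" if "a \<in> sets M" "b \<in> sets M" for a b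
    proof -
      have "integrable M (indicator a :: 'a \<Rightarrow> real)" "integrable M (indicator b :: 'a \<Rightarrow> real)"
        using that by (auto intro!: integrable_real_indicator simp: less_top[symmetric])
      then show ?thesis
        using tendsto_mult[OF conv conv, of "indicator a" "indicator b"] that meas w f by (simp add: rect)
    qed
    have "Int_stable G" unfolding G_def by (rule Int_stable_pair_measure_generator)
    moreover have "G \<subseteq> Pow \<Omega>" unfolding G_def \<Omega>_def using sets.sets_into_space by fastforce
    ultimately show ?thesis
      using that[unfolded sP]
    proof (induction rule: sigma_sets_induct_disjoint)
      case (basic A)
      then show ?case using rect_lim unfolding G_def by auto
    next
      case empty
      then show ?case by (simp add: I_def)
    next
      case (compl A)
      have A: "A \<in> sets (M \<Otimes>\<^sub>M M)" using compl sP by simp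
      have *: "I (\<Omega> - A) g = I \<Omega> g - I A g"
        if g: "g \<in> borel_measurable M" "\<And>t. 0 \<le> g t" "\<And>t. g t \<le> B" for g
      proof -
        have "I (\<Omega> - A) g = (\<integral>z. indicator \<Omega> z * (g (fst z) * g (snd z)) - indicator A z * (g (fst z) * g (snd z)) \<partial>(M \<Otimes>\<^sub>M M))"
          unfolding I_def using sets.sets_into_space[OF A]
          by (intro Bochner_Integration.integral_cong) (auto simp: \<Omega>_def space_pair_measure split: split_indicator)
        also have "\<dots> = I \<Omega> g - I A g"
          unfolding I_def using int[OF g] A by (intro Bochner_Integration.integral_diff) (auto simp: \<Omega>_def)
        finally show ?thesis .
      qed
      show ?case using * meas w f compl rect_lim[of "space M" "space M"]
        by (auto simp: \<Omega>_def intro!: tendsto_diff)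
    next
      case (union F)
      have F: "F i \<in> sets (M \<Otimes>\<^sub>M M)" for i using union sP by auto
      \<comment> \<open>The tail of the union has small measure and B * B bounds the integrand, so
        one error bound serves every n and the limit.\<close>
      define e where "e k = B * B * (measure (M \<Otimes>\<^sub>M M) (\<Union>i. F i) - measure (M \<Otimes>\<^sub>M M) (\<Union>i<k. F i))" for k
      have est: "\<bar>I (\<Union>i. F i) g - (\<Sum>i<k. I (F i) g)\<bar> \<le> e k"
        if g: "g \<in> borel_measurable M" "\<And>t. 0 \<le> g t" "\<And>t. g t \<le> B" for g k
      proof -
        have UF: "(\<Union>i. F i) \<in> sets (M \<Otimes>\<^sub>M M)" "(\<Union>i<k. F i) \<in> sets (M \<Otimes>\<^sub>M M)" using F by auto
        have "(\<Sum>i<k. indicator (F i) z) = (indicator (\<Union>i<k. F i) z :: real)" for z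
          using union by (intro indicator_UN_disjoint[symmetric]) (auto simp: disjoint_family_on_def)
        then have "I (\<Union>i<k. F i) g = (\<integral>z. (\<Sum>i<k. indicator (F i) z * (g (fst z) * g (snd z))) \<partial>(M \<Otimes>\<^sub>M M))"
          unfolding I_def by (simp only: flip: sum_distrib_right)
        also have "\<dots> = (\<Sum>i<k. I (F i) g)"
          unfolding I_def using int[OF g] F by (intro Bochner_Integration.integral_sum) auto
        finally have "(\<Sum>i<k. I (F i) g) = I (\<Union>i<k. F i) g" by simp
        then have "I (\<Union>i. F i) g - (\<Sum>i<k. I (F i) g) = (\<integral>z. indicator (\<Union>i. F i) z * (g (fst z) * g (snd z))
            - indicator (\<Union>i<k. F i) z * (g (fst z) * g (snd z)) \<partial>(M \<Otimes>\<^sub>M M))"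
          unfolding I_def using int[OF g] UF by simp
        also have "\<dots> = (\<integral>z. indicator ((\<Union>i. F i) - (\<Union>i<k. F i)) z * (g (fst z) * g (snd z)) \<partial>(M \<Otimes>\<^sub>M M))"
          by (intro Bochner_Integration.integral_cong) (auto split: split_indicator)
        finally have eq: "I (\<Union>i. F i) g - (\<Sum>i<k. I (F i) g) = I ((\<Union>i. F i) - (\<Union>i<k. F i)) g" by (simp add: I_def)
        have "I ((\<Union>i. F i) - (\<Union>i<k. F i)) g \<le> (\<integral>z. B * B * indicator ((\<Union>i. F i) - (\<Union>i<k. F i)) z \<partial>(M \<Otimes>\<^sub>M M))"
          unfolding I_def
        proof (rule integral_mono)
          show "integrable (M \<Otimes>\<^sub>M M) (\<lambda>z. B * B * indicator ((\<Union>i. F i) - (\<Union>i<k. F i)) z)"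
            using UF by (intro integrable_mult_right integrable_real_indicator) (auto simp: less_top[symmetric])
        qed (use BB[OF g(2,3)] int[OF g] UF in \<open>auto split: split_indicator\<close>)
        also have "\<dots> = B * B * measure (M \<Otimes>\<^sub>M M) ((\<Union>i. F i) - (\<Union>i<k. F i))"
          using UF by auto
        also have "\<dots> = e k"
          unfolding e_def using UF by (subst PP.finite_measure_Diff) auto
        finally have "I ((\<Union>i. F i) - (\<Union>i<k. F i)) g \<le> e k" .
        moreover have "0 \<le> I ((\<Union>i. F i) - (\<Union>i<k. F i)) g"
          unfolding I_def by (intro integral_nonneg_AE AE_I2 mult_nonneg_nonneg g(2)) simp_all
        ultimately show ?thesis using eq by simp
      qed
      show ?case
      proof (rule tendsto_uniform_approx)
        show "((\<lambda>n. \<Sum>i<k. I (F i) (w n)) \<longlongrightarrow> (\<Sum>i<k. I (F i) f)) H" for k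
          using union by (intro tendsto_sum) auto
        have "(\<lambda>n. measure (M \<Otimes>\<^sub>M M) (\<Union>i<n. F i)) \<longlonglongrightarrow> measure (M \<Otimes>\<^sub>M M) (\<Union>n. \<Union>i<n. F i)"
          using F by (intro PP.finite_Lim_measure_incseq) (auto simp: incseq_def intro: less_le_trans)
        moreover have "(\<Union>n. \<Union>i<n. F i) = (\<Union>i. F i)" by auto
        ultimately show "e \<longlonglongrightarrow> 0"
          unfolding e_def by (auto intro!: tendsto_eq_intros)
      qed (use est meas w f in auto)
    qed
  qed
  then have sets: "((\<lambda>n. \<integral>z. indicator A z * (w n (fst z) * w n (snd z)) \<partial>(M \<Otimes>\<^sub>M M)) \<longlongrightarrow>
      (\<integral>z. indicator A z * (f (fst z) * f (snd z)) \<partial>(M \<Otimes>\<^sub>M M))) H"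
    if "A \<in> sets (M \<Otimes>\<^sub>M M)" for A
    using that unfolding I_def by blast
  show ?thesis
    by (rule weak_convergence_from_sets[OF mm[OF meas(1)] mm[OF meas(2)] BB[OF w] BB[OF f] sets K])
qed

section \<open>Elementary bounds and integrable majorants\<close>

lemma half_le_sinh: "x / 2 \<le> sinh x" if "0 \<le> x" for x :: real
proof -
  have "exp (- x) \<le> 1" using that by simp
  moreover have "1 + x \<le> exp x" by (rule exp_ge_add_one_self)
  ultimately have "x \<le> exp x - exp (- x)" by linarith
  then show ?thesis by (simp add: sinh_field_def)
qed

lemma half_le_sin: "x / 2 \<le> sin x" if "0 \<le> x" "x \<le> pi / 2" for x :: real
proof -
  have "\<bar>sin x - (\<Sum>m<3. sin_coeff m * x ^ m)\<bar> \<le> inverse (fact 3) * \<bar>x\<bar> ^ 3"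
    by (rule Maclaurin_sin_bound)
  then have "\<bar>sin x - x\<bar> \<le> x * (x\<^sup>2 / 6)"
    using that by (simp add: eval_nat_numeral sin_coeff_def fact_numeral)
  \<comment> \<open>Since \<pi>/2 < 1.6 and 2.56/6 < 1/2, the cubic error is at most x/2.\<close>
  moreover have "x\<^sup>2 \<le> 1.6\<^sup>2"
    using that pi_approx by (intro power_mono) auto
  then have "x * (x\<^sup>2 / 6) \<le> x * (1 / 2)"
    using that by (intro mult_left_mono) (auto simp: power2_eq_square)
  ultimately show ?thesis by linarith
qed

lemma integrable_on_interval_from_has_integral:
  fixes f :: "real \<Rightarrow> real"
  assumes "f \<in> borel_measurable borel" "\<And>x. 0 \<le> f x" "(f has_integral I) A" "A \<in> sets borel"
  shows "integrable lborel (\<lambda>x. indicator A x * f x)"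
proof (rule integrableI_nonneg)
  have "((\<lambda>x. indicator A x * f x) has_integral I) UNIV"
    using assms(3) unfolding has_integral_restrict_UNIV[symmetric, of f]
    by (rule has_integral_eq[rotated]) auto
  then have "(\<integral>\<^sup>+x. ennreal (indicator A x * f x) \<partial>lborel) = ennreal I"
    using assms by (intro nn_integral_has_integral_lborel) auto
  then show "(\<integral>\<^sup>+x. ennreal (indicator A x * f x) \<partial>lborel) < \<infinity>" by simp
qed (use assms in auto)

lemma integrable_even:
  fixes f :: "real \<Rightarrow> real"
  assumes "f \<in> borel_measurable borel" "\<And>x. 0 \<le> f x" "\<And>x. f (- x) = f x"
    and "integrable lborel (\<lambda>x. indicator {0..} x * f x)"
  shows "integrable lborel f"
proof (rule Bochner_Integration.integrable_bound)
  show "integrable lborel (\<lambda>x. indicator {0..} x * f x + indicator {0..} (- x) * f (- x))"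
    using assms(4) lborel_integrable_real_affine[OF assms(4), of "-1" 0] by auto
  show "AE x in lborel. norm (f x) \<le> norm (indicator {0..} x * f x + indicator {0..} (- x) * f (- x))"
    using assms(2,3) by (auto split: split_indicator)
qed (use assms(1) in auto)

lemma integrable_powr_near_0:
  fixes \<alpha> c :: real
  assumes "0 < \<alpha>" "\<alpha> < 1" "0 \<le> c"
  shows "integrable lborel (\<lambda>x. indicator {- c..c} x * \<bar>x\<bar> powr - \<alpha>)"
proof (rule integrable_even)
  have "integrable lborel (\<lambda>x. indicator {0..c} x * x powr - \<alpha>)"
    by (rule integrable_on_interval_from_has_integral[OF _ _ has_integral_powr_from_0]) (use assms in auto)
  then show "integrable lborel (\<lambda>x. indicator {0..} x * (indicator {- c..c} x * \<bar>x\<bar> powr - \<alpha>))"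
    by (rule Bochner_Integration.integrable_cong[THEN iffD1, rotated -1]) (auto split: split_indicator)
qed (auto split: split_indicator)

lemma borel_measurable_sinh [measurable]: "sinh \<in> borel_measurable (borel :: real measure)"
  by (intro borel_measurable_continuous_onI continuous_intros)

text \<open>Near 0 the hyperbolic sine dominates a linear function, so the singularity is at most a
  multiple of |x|^(-\<alpha>) with \<alpha> < 1; beyond 1 it dominates an exponential. Supplies the
  horizontal factor of the kernel majorants.\<close>

lemma integrable_sinh_powr:
  fixes a \<alpha> :: real
  assumes "0 < a" "0 < \<alpha>" "\<alpha> < 1"
  shows "integrable lborel (\<lambda>x. \<bar>sinh (a * x)\<bar> powr - \<alpha>)"
proof (rule integrable_even)
  \<comment> \<open>For x \<ge> 1 one has exp(-a x) \<le> exp(-2 a) exp(a x), hence sinh(a x) \<ge>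
    c exp(a x).\<close>
  define c where "c = (1 - exp (- 2 * a)) / 2"
  have "0 < c" using assms by (simp add: c_def)
  have i1: "integrable lborel (\<lambda>x. (a / 2) powr - \<alpha> * (indicator {-1..1} x * \<bar>x\<bar> powr - \<alpha>))"
    using assms by (intro integrable_mult_right integrable_powr_near_0) auto
  have "integrable lborel (\<lambda>x. indicator {0..} x * exp (- (\<alpha> * a) * x))"
    by (rule integrable_on_interval_from_has_integral[OF _ _ has_integral_exp_minus_to_infinity]) (use assms in auto)
  then have i2: "integrable lborel (\<lambda>x. c powr - \<alpha> * (indicator {0..} x * exp (- (\<alpha> * a) * x)))"
    by (intro integrable_mult_right)
  show "integrable lborel (\<lambda>x. indicator {0..} x * \<bar>sinh (a * x)\<bar> powr - \<alpha>)"
  proof (rule Bochner_Integration.integrable_bound[OF Bochner_Integration.integrable_add[OF i1 i2]], measurable, intro AE_I2)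
    fix x :: real
    have "\<bar>sinh (a * x)\<bar> powr - \<alpha> \<le> (a / 2) powr - \<alpha> * (indicator {-1..1} x * \<bar>x\<bar> powr - \<alpha>)
        + c powr - \<alpha> * (indicator {0..} x * exp (- (\<alpha> * a) * x))" if "0 \<le> x"
    proof (cases "x \<le> 1")
      case True
      show ?thesis
      proof (cases "x = 0")
        case False
        have "a / 2 * x \<le> sinh (a * x)" using half_le_sinh[of "a * x"] assms that by simp
        then have "\<bar>sinh (a * x)\<bar> powr - \<alpha> \<le> (a / 2 * x) powr - \<alpha>"
          using assms that False by (intro powr_mono2') auto
        also have "\<dots> = (a / 2) powr - \<alpha> * x powr - \<alpha>" using assms that by (intro powr_mult)
        finally show ?thesis using True that by (simp add: add_increasing2)
      qed auto
    next
      case False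
      have "c * exp (a * x) \<le> sinh (a * x)"
      proof -
        have "exp (- (a * x)) \<le> exp (- 2 * a + a * x)" using False assms by simp
        also have "\<dots> = exp (- 2 * a) * exp (a * x)" by (rule exp_add)
        finally show ?thesis unfolding c_def sinh_field_def by (simp add: field_simps)
      qed
      then have "\<bar>sinh (a * x)\<bar> powr - \<alpha> \<le> (c * exp (a * x)) powr - \<alpha>"
        using assms \<open>0 < c\<close> by (intro powr_mono2') auto
      also have "\<dots> = c powr - \<alpha> * exp (a * x) powr - \<alpha>" using \<open>0 < c\<close> by (intro powr_mult)
      also have "exp (a * x) powr - \<alpha> = exp (- (\<alpha> * a) * x)" by (simp add: powr_def)
      finally show ?thesis using False by simp
    qed
    then show "norm (indicator {0..} x * \<bar>sinh (a * x)\<bar> powr - \<alpha>) \<le> norm ((a / 2) powr - \<alpha> * (indicator {-1..1} x * \<bar>x\<bar> powr - \<alpha>)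
        + c powr - \<alpha> * (indicator {0..} x * exp (- (\<alpha> * a) * x)))"
      by (auto split: split_indicator)
  qed
qed auto

lemma integral_tensor:
  fixes p q :: "real \<Rightarrow> real"
  assumes p: "integrable lborel p" and q: "integrable lborel q"
  shows "integrable lborel (\<lambda>y. p (fst y) * q (snd y))"
    and "(\<integral>y. p (fst y) * q (snd y) \<partial>lborel) = (\<integral>s. p s \<partial>lborel) * (\<integral>t. q t \<partial>lborel)"
proof -
  have [measurable]: "p \<in> borel_measurable borel" "q \<in> borel_measurable borel" using p q by auto
  have i: "integrable (lborel \<Otimes>\<^sub>M lborel) (\<lambda>(s, t). p s * q t)"
    using p q by (intro lborel_pair.Fubini_integrable) (auto simp: abs_mult)
  show "integrable lborel (\<lambda>y. p (fst y) * q (snd y))"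
    using i by (simp add: lborel_prod case_prod_unfold)
  show "(\<integral>y. p (fst y) * q (snd y) \<partial>lborel) = (\<integral>s. p s \<partial>lborel) * (\<integral>t. q t \<partial>lborel)"
    using lborel_pair.integral_fst'[OF i] by (simp add: lborel_prod case_prod_unfold)
qed

lemma AE_lborel_fst: "AE y in (lborel :: (real \<times> real) measure). P (fst y)" if ae: "AE s in lborel. P s"
proof -
  obtain N where N: "{s. \<not> P s} \<subseteq> N" "N \<in> null_sets lborel"
    using ae unfolding eventually_ae_filter by auto
  have "emeasure (lborel \<Otimes>\<^sub>M lborel) (N \<times> (UNIV :: real set)) = 0"
    using N by (subst lborel.emeasure_pair_measure_Times) auto
  then have "N \<times> (UNIV :: real set) \<in> null_sets lborel"
    using N by (auto simp: null_sets_def lborel_prod intro!: borel_Times)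
  then show ?thesis by (rule AE_I') (use N in auto)
qed

lemma AE_lborel_snd: "AE y in (lborel :: (real \<times> real) measure). P (snd y)" if ae: "AE s in lborel. P s"
proof -
  obtain N where N: "{s. \<not> P s} \<subseteq> N" "N \<in> null_sets lborel"
    using ae unfolding eventually_ae_filter by auto
  have "emeasure (lborel \<Otimes>\<^sub>M lborel) ((UNIV :: real set) \<times> N) = 0"
    using N by (subst lborel.emeasure_pair_measure_Times) auto
  then have "(UNIV :: real set) \<times> N \<in> null_sets lborel"
    using N by (auto simp: null_sets_def lborel_prod intro!: borel_Times)
  then show ?thesis by (rule AE_I') (use N in auto)
qed

text \<open>For u = |S|^(-1/4) the argument of the logarithm is 1 + 1/S^2; the logarithmic
  singularity is traded for the power |S|^(-1/4), whose square is still integrable.\<close>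

lemma ln_one_plus_power8_le: "ln (1 + u ^ 8) \<le> 8 * u" if "0 \<le> u" for u :: real
proof -
  have "u ^ 8 \<le> (1 + u) ^ 8 - 1"
    using that by (simp add: eval_nat_numeral algebra_simps)
  then have "ln (1 + u ^ 8) \<le> ln ((1 + u) ^ 8)"
    using that by (subst ln_le_cancel_iff) (auto intro: add_pos_nonneg)
  also have "\<dots> = 8 * ln (1 + u)" using that by (simp add: ln_realpow)
  also have "\<dots> \<le> 8 * u" using that ln_add_one_self_le_self[of u] by simp
  finally show ?thesis .
qed

section \<open>The Green's function of the strip\<close>

lemma integrable_lborel_reflect_shift:
  fixes h :: "real \<Rightarrow> real"
  assumes "integrable lborel h"
  shows "integrable lborel (\<lambda>s. h (c - s))" "(\<integral>s. h (c - s) \<partial>lborel) = (\<integral>s. h s \<partial>lborel)"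
  using lborel_integrable_real_affine[OF assms, of "-1" c] lborel_integral_real_affine[of "-1" h c] by simp_all

locale strip_domain =
  fixes L :: real
  assumes L_pos: "0 < L"
begin

lemma strip_iff: "x \<in> strip L \<longleftrightarrow> 0 < snd x \<and> snd x < L"
  by (cases x) (auto simp: strip_def)

text \<open>Extended by 0 off the strip, so that all integrals can run over the whole plane.\<close>

definition gk :: "real \<times> real \<Rightarrow> real \<times> real \<Rightarrow> real" where
  "gk x y = (if x \<in> strip L \<and> y \<in> strip L then green L x y else 0)"

definition Sh :: "real \<Rightarrow> real" where "Sh s = sinh (pi / (2 * L) * s)"
definition Sn :: "real \<Rightarrow> real" where "Sn s = sin (pi / (2 * L) * s)"

lemma green_eq:
  "green L x y = 1 / (4 * pi) * ln (1 + sin (pi / L * snd x) * sin (pi / L * snd y) /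
    ((Sh (fst x - fst y))\<^sup>2 + (Sn (snd x - snd y))\<^sup>2))"
  by (simp add: green_def Sh_def Sn_def)

lemma sin_strip: "0 < sin (pi / L * snd x)" if "x \<in> strip L"
  using that L_pos by (intro sin_gt_zero) (auto simp: strip_iff field_simps)

lemma Sh_eq_0_iff: "Sh s = 0 \<longleftrightarrow> s = 0"
  using L_pos by (simp add: Sh_def)

lemma denom_pos: "0 < (Sh s)\<^sup>2 + (Sn t)\<^sup>2" if "s \<noteq> 0"
  using that by (intro add_pos_nonneg) (auto simp: Sh_eq_0_iff)

lemma gk_nonneg: "0 \<le> gk x y"
  using sin_strip[of x] sin_strip[of y] by (auto simp: gk_def green_eq intro!: ln_ge_zero)

lemma gk_sym: "gk x y = gk y x"
proof -
  have "(Sh s)\<^sup>2 = (Sh (- s))\<^sup>2" "(Sn s)\<^sup>2 = (Sn (- s))\<^sup>2" for s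
    by (simp_all add: Sh_def Sn_def)
  from this(1)[of "fst x - fst y"] this(2)[of "snd x - snd y"] show ?thesis
    by (simp add: gk_def green_eq mult.commute)
qed

lemma borel_measurable_Sh [measurable]: "Sh \<in> borel_measurable borel"
  unfolding Sh_def[abs_def] by measurable

lemma borel_measurable_Sn [measurable]: "Sn \<in> borel_measurable borel"
  unfolding Sn_def[abs_def] by measurable

lemma gk_measurable [measurable (raw)]:
  assumes [measurable]: "f \<in> borel_measurable M" "g \<in> borel_measurable M"
  shows "(\<lambda>t. gk (f t) (g t)) \<in> borel_measurable M"
proof -
  have cf: "fst \<in> borel_measurable (borel :: (real \<times> real) measure)"
    and cs: "snd \<in> borel_measurable (borel :: (real \<times> real) measure)"
    by (intro borel_measurable_continuous_onI continuous_on_fst continuous_on_snd continuous_on_id)+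
  note [measurable] = measurable_compose[OF assms(1) cf] measurable_compose[OF assms(2) cf]
    measurable_compose[OF assms(1) cs] measurable_compose[OF assms(2) cs]
  show ?thesis unfolding gk_def green_eq strip_iff by measurable
qed

text \<open>
  Translating two points horizontally towards each other, without making their abscissae coincide,
  increases the kernel; at coinciding points \<open>green\<close> has the junk value \<open>0\<close>.
\<close>

lemma gk_mono:
  assumes "snd x' = snd x" "snd y' = snd y" "\<bar>fst x' - fst y'\<bar> \<le> \<bar>fst x - fst y\<bar>"
    and "fst x' = fst y' \<Longrightarrow> fst x = fst y"
  shows "gk x y \<le> gk x' y'"
proof (cases "x \<in> strip L \<and> y \<in> strip L")
  case True
  then have xy: "x \<in> strip L" "y \<in> strip L" by auto
  have s: "x' \<in> strip L" "y' \<in> strip L" using True assms by (auto simp: strip_iff)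
  define D where "D = (Sh (fst x - fst y))\<^sup>2 + (Sn (snd x - snd y))\<^sup>2"
  define D' where "D' = (Sh (fst x' - fst y'))\<^sup>2 + (Sn (snd x - snd y))\<^sup>2"
  define N where "N = sin (pi / L * snd x) * sin (pi / L * snd y)"
  have "0 < N" unfolding N_def by (intro mult_pos_pos sin_strip xy)
  have "D' \<le> D"
  proof -
    have "\<bar>Sh (fst x' - fst y')\<bar> = sinh (pi / (2 * L) * \<bar>fst x' - fst y'\<bar>)"
      using L_pos by (simp add: Sh_def abs_mult flip: sinh_real_abs)
    also have "\<dots> \<le> sinh (pi / (2 * L) * \<bar>fst x - fst y\<bar>)"
      using L_pos assms(3) by (subst sinh_real_le_iff, intro mult_left_mono) auto
    also have "\<dots> = \<bar>Sh (fst x - fst y)\<bar>"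
      using L_pos by (simp add: Sh_def abs_mult flip: sinh_real_abs)
    finally show ?thesis unfolding D_def D'_def by (simp add: abs_le_square_iff)
  qed
  have "N / D \<le> N / D'"
  proof (cases "fst x' = fst y'")
    case True
    then have "fst x = fst y" by (rule assms(4))
    with True show ?thesis by (simp add: D_def D'_def)
  next
    case False
    then have "0 < D'" unfolding D'_def by (intro denom_pos) auto
    with \<open>D' \<le> D\<close> \<open>0 < N\<close> show ?thesis by (intro divide_left_mono) auto
  qed
  moreover have "0 \<le> N / D" using \<open>0 < N\<close> by (auto simp: D_def)
  ultimately have "ln (1 + N / D) \<le> ln (1 + N / D')" by (subst ln_le_cancel_iff) auto
  then have "1 / (4 * pi) * ln (1 + N / D) \<le> 1 / (4 * pi) * ln (1 + N / D')"
    by (intro mult_left_mono) auto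
  then show ?thesis
    using xy s assms by (simp add: gk_def green_eq D_def D'_def N_def)
next
  case False
  then have "gk x y = 0" by (auto simp: gk_def)
  then show ?thesis using gk_nonneg by simp
qed

text \<open>The numerator is at most 1 and the sine in the denominator is dropped, so the bound
  depends on the horizontal distance alone. It makes the rows of the kernel square
  integrable.\<close>

lemma gk_le_sinh:
  assumes "fst x \<noteq> fst y"
  shows "gk x y \<le> 2 / pi * \<bar>Sh (fst x - fst y)\<bar> powr - (1/4)"
proof (cases "x \<in> strip L \<and> y \<in> strip L")
  case True
  define S where "S = Sh (fst x - fst y)"
  define D where "D = S\<^sup>2 + (Sn (snd x - snd y))\<^sup>2"
  define N where "N = sin (pi / L * snd x) * sin (pi / L * snd y)"
  define u where "u = \<bar>S\<bar> powr - (1/4)"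
  have "S \<noteq> 0" using assms by (simp add: S_def Sh_eq_0_iff)
  have "0 < N" unfolding N_def using True by (intro mult_pos_pos sin_strip) auto
  have "N \<le> 1 * 1" unfolding N_def using True sin_strip[of y] by (intro mult_mono) auto
  have "u ^ 8 = \<bar>S\<bar> powr (- (1/4) * real 8)" unfolding u_def using \<open>S \<noteq> 0\<close> by (subst powr_power) simp_all
  also have "\<dots> = 1 / S\<^sup>2" using \<open>S \<noteq> 0\<close> by (simp add: powr_minus_divide powr_realpow[of "\<bar>S\<bar>" 2, simplified])
  finally have u8: "u ^ 8 = 1 / S\<^sup>2" .
  have "N / D \<le> 1 / S\<^sup>2"
    using \<open>N \<le> 1 * 1\<close> \<open>0 < N\<close> \<open>S \<noteq> 0\<close> unfolding D_def by (intro frac_le) auto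
  moreover have "0 \<le> N / D" using \<open>0 < N\<close> by (auto simp: D_def)
  ultimately have "ln (1 + N / D) \<le> ln (1 + u ^ 8)"
    unfolding u8 by (subst ln_le_cancel_iff) auto
  also have "\<dots> \<le> 8 * u" by (rule ln_one_plus_power8_le) (simp add: u_def)
  finally have "1 / (4 * pi) * ln (1 + N / D) \<le> 1 / (4 * pi) * (8 * u)"
    by (intro mult_left_mono) auto
  then show ?thesis
    using True by (simp add: gk_def green_eq D_def N_def S_def u_def)
next
  case False
  then have "gk x y = 0" by (auto simp: gk_def)
  then show ?thesis by simp
qed

text \<open>Bounds the squared L^2 norm of \<open>gk x\<close> uniformly in x: the majorant is a
  function of the horizontal distance times the indicator of (0, L), and the integral of the first
  factor does not depend on the position of x.\<close>

definition gk_bound :: real where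
  "gk_bound = (2 / pi)\<^sup>2 * (\<integral>s. \<bar>Sh s\<bar> powr - (1/2) \<partial>lborel) * L"

lemma gk_square_integrable:
  "integrable lborel (\<lambda>y. (gk x y)\<^sup>2)" "(\<integral>y. (gk x y)\<^sup>2 \<partial>lborel) \<le> gk_bound"
proof -
  have h: "integrable lborel (\<lambda>s. \<bar>Sh s\<bar> powr - (1/2))"
    unfolding Sh_def using L_pos by (intro integrable_sinh_powr) auto
  define p where "p s = (2 / pi)\<^sup>2 * \<bar>Sh (fst x - s)\<bar> powr - (1/2)" for s
  define q where "q t = (indicator {0<..<L} t :: real)" for t
  have p: "integrable lborel p" "(\<integral>s. p s \<partial>lborel) = (2 / pi)\<^sup>2 * (\<integral>s. \<bar>Sh s\<bar> powr - (1/2) \<partial>lborel)"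
    unfolding p_def using integrable_lborel_reflect_shift[OF h, of "fst x"] by simp_all
  have q: "integrable lborel q" "(\<integral>t. q t \<partial>lborel) = L"
    unfolding q_def using L_pos by (auto intro!: integrable_real_indicator)
  have le: "AE y in lborel. (gk x y)\<^sup>2 \<le> p (fst y) * q (snd y)"
  proof -
    have "AE s in lborel. s \<noteq> fst x" by (rule AE_lborel_singleton)
    from AE_lborel_fst[OF this] show ?thesis
    proof eventually_elim
      case (elim y)
      show ?case
      proof (cases "y \<in> strip L")
        case True
        have "(gk x y)\<^sup>2 \<le> (2 / pi * \<bar>Sh (fst x - fst y)\<bar> powr - (1/4))\<^sup>2"
          using gk_le_sinh[of x y] elim gk_nonneg by (intro power_mono) auto
        also have "\<dots> = p (fst y)"
          unfolding p_def power_mult_distrib using elim by (subst powr_power) (simp_all add: Sh_eq_0_iff)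
        finally show ?thesis using True by (simp add: q_def strip_iff)
      qed (simp add: gk_def p_def q_def)
    qed
  qed
  show "integrable lborel (\<lambda>y. (gk x y)\<^sup>2)"
    by (rule Bochner_Integration.integrable_bound[OF integral_tensor(1)[OF p(1) q(1)]])
      (use le in \<open>auto elim!: eventually_mono\<close>)
  then have "(\<integral>y. (gk x y)\<^sup>2 \<partial>lborel) \<le> (\<integral>y. p (fst y) * q (snd y) \<partial>lborel)"
    using le by (intro integral_mono_AE integral_tensor(1)[OF p(1) q(1)])
  also have "\<dots> = gk_bound"
    unfolding integral_tensor(2)[OF p(1) q(1)] p q gk_bound_def ..
  finally show "(\<integral>y. (gk x y)\<^sup>2 \<partial>lborel) \<le> gk_bound" .
qed

lemma gk_bound_nonneg: "0 \<le> gk_bound"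
  unfolding gk_bound_def using L_pos by (auto intro!: integral_nonneg_AE)

text \<open>
  The numerator is at most \<open>s (s + 2 \<sigma>)\<close> for \<open>s = sin (\<pi> x\<^sub>2 / L)\<close> and \<open>\<sigma>\<close> the sine in the
  denominator; each of the two summands contributes a multiple of \<open>s / \<surd>D\<close>.
\<close>

lemma gk_le_height:
  assumes "fst x \<noteq> fst y" and x: "x \<in> strip L"
  shows "gk x y \<le> snd x / L * (1 / sqrt ((Sh (fst x - fst y))\<^sup>2 + (Sn (snd x - snd y))\<^sup>2))"
proof (cases "y \<in> strip L")
  case True
  define D where "D = (Sh (fst x - fst y))\<^sup>2 + (Sn (snd x - snd y))\<^sup>2"
  define \<sigma> where "\<sigma> = \<bar>Sn (snd x - snd y)\<bar>"
  define s where "s = sin (pi / L * snd x)"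
  define t where "t = sin (pi / L * snd y)"
  define r where "r = s / sqrt D"
  have "0 < D" unfolding D_def using assms by (intro denom_pos) auto
  have "0 < s" "0 < t" unfolding s_def t_def by (intro sin_strip x True)+
  then have "0 < r" unfolding r_def using \<open>0 < D\<close> by auto
  have "\<sigma> \<le> sqrt D"
    unfolding \<sigma>_def D_def by (intro real_le_rsqrt) auto
  have "\<bar>t - s\<bar> \<le> 2 * \<sigma>"
  proof -
    have "t - s = 2 * sin ((pi / L * snd y - pi / L * snd x) / 2) * cos ((pi / L * snd y + pi / L * snd x) / 2)"
      unfolding s_def t_def by (rule sin_diff_sin)
    also have "(pi / L * snd y - pi / L * snd x) / 2 = - (pi / (2 * L) * (snd x - snd y))"
      using L_pos by (simp add: field_simps)
    finally have "\<bar>t - s\<bar> = 2 * (\<sigma> * \<bar>cos ((pi / L * snd y + pi / L * snd x) / 2)\<bar>)"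
      by (simp add: \<sigma>_def Sn_def abs_mult)
    moreover have "\<sigma> * \<bar>cos ((pi / L * snd y + pi / L * snd x) / 2)\<bar> \<le> \<sigma> * 1"
      by (intro mult_left_mono) (auto simp: \<sigma>_def)
    ultimately show ?thesis by simp
  qed
  then have "s * t \<le> s * (s + 2 * \<sigma>)" using \<open>0 < s\<close> by (intro mult_left_mono) auto
  also have "\<dots> \<le> s\<^sup>2 + 2 * s * sqrt D"
    using \<open>\<sigma> \<le> sqrt D\<close> \<open>0 < s\<close> by (simp add: algebra_simps power2_eq_square)
  finally have "s * t / D \<le> (s\<^sup>2 + 2 * s * sqrt D) / D"
    using \<open>0 < D\<close> by (intro divide_right_mono) auto
  also have "\<dots> = r\<^sup>2 + 2 * r"
  proof -
    have "r\<^sup>2 = s\<^sup>2 / D" using \<open>0 < D\<close> by (simp add: r_def power_divide)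
    moreover have "s * (sqrt D / D) = r"
      using \<open>0 < D\<close> by (subst sqrt_divide_self_eq) (auto simp: r_def divide_inverse)
    ultimately show ?thesis by (simp add: add_divide_distrib)
  qed
  finally have "1 + s * t / D \<le> (1 + r)\<^sup>2" by (simp add: power2_eq_square algebra_simps)
  moreover have "0 < s * t / D" using \<open>0 < s\<close> \<open>0 < t\<close> \<open>0 < D\<close> by simp
  ultimately have "ln (1 + s * t / D) \<le> ln ((1 + r)\<^sup>2)"
    using \<open>0 < r\<close> by (subst ln_le_cancel_iff) auto
  also have "\<dots> = 2 * ln (1 + r)" using \<open>0 < r\<close> by (simp add: ln_realpow)
  also have "\<dots> \<le> 2 * r" using ln_add_one_self_le_self[of r] \<open>0 < r\<close> by simp
  finally have "1 / (4 * pi) * ln (1 + s * t / D) \<le> 1 / (4 * pi) * (2 * r)"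
    by (intro mult_left_mono) auto
  then have "gk x y \<le> 1 / (4 * pi) * (2 * r)"
    using x True by (simp add: gk_def green_eq s_def t_def D_def)
  also have "\<dots> \<le> 1 / pi * r" using \<open>0 < r\<close> by (simp add: field_simps)
  also have "\<dots> \<le> 1 / pi * (pi / L * snd x / sqrt D)"
  proof -
    have "s \<le> pi / L * snd x" unfolding s_def using x L_pos by (intro sin_x_le_x) (auto simp: strip_iff)
    then show ?thesis unfolding r_def using \<open>0 < D\<close> by (intro mult_left_mono divide_right_mono) auto
  qed
  also have "\<dots> = snd x / L * (1 / sqrt D)" by simp
  finally show ?thesis unfolding D_def .
next
  case False
  then have "gk x y = 0" by (simp add: gk_def)
  then show ?thesis using x L_pos by (simp add: strip_iff)
qed

end

section \<open>Vorticities, stream functions and the energy\<close>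

context strip_domain
begin

definition pot :: "(real \<times> real \<Rightarrow> real) \<Rightarrow> real \<times> real \<Rightarrow> real" where
  "pot u x = (\<integral>y. gk x y * u y \<partial>lborel)"

text \<open>The bilinear form whose diagonal is twice the energy.\<close>

definition form :: "(real \<times> real \<Rightarrow> real) \<Rightarrow> (real \<times> real \<Rightarrow> real) \<Rightarrow> real" where
  "form u v = (\<integral>x. pot u x * v x \<partial>lborel)"

text \<open>Normalized representatives: sign and support conditions hold at every point, which
  avoids almost-everywhere arguments in the surgery. The passage from classes on the strip is made
  once, in \<open>vort_of_AE_nonneg\<close>.\<close>

definition vort :: "(real \<times> real \<Rightarrow> real) \<Rightarrow> bool" where
  "vort u \<longleftrightarrow> integrable lborel u \<and> integrable lborel (\<lambda>x. (u x)\<^sup>2) \<and>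
     (\<forall>x. 0 \<le> u x) \<and> (\<forall>x. x \<notin> strip L \<longrightarrow> u x = 0)"

definition sq :: "(real \<times> real \<Rightarrow> real) \<Rightarrow> real" where "sq u = (\<integral>x. (u x)\<^sup>2 \<partial>lborel)"
definition ms :: "(real \<times> real \<Rightarrow> real) \<Rightarrow> real" where "ms u = (\<integral>x. u x \<partial>lborel)"
definition imp :: "(real \<times> real \<Rightarrow> real) \<Rightarrow> real" where "imp u = (\<integral>x. snd x * u x \<partial>lborel)"

definition fnl :: "real \<Rightarrow> (real \<times> real \<Rightarrow> real) \<Rightarrow> real" where
  "fnl lam u = 1 / 2 * form u u - 1 / (2 * lam) * sq u"

lemma vortD:
  assumes "vort u"
  shows "integrable lborel u" "integrable lborel (\<lambda>x. (u x)\<^sup>2)" "0 \<le> u x" "x \<notin> strip L \<Longrightarrow> u x = 0"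
    and vort_measurable: "u \<in> borel_measurable borel"
proof -
  show "integrable lborel u" "integrable lborel (\<lambda>x. (u x)\<^sup>2)" "0 \<le> u x" "x \<notin> strip L \<Longrightarrow> u x = 0"
    using assms by (simp_all add: vort_def del: split_paired_All)
  then show "u \<in> borel_measurable borel" by simp
qed

lemma borel_measurable_snd_plane [measurable]: "snd \<in> borel_measurable (borel :: (real \<times> real) measure)"
  by (intro borel_measurable_continuous_onI continuous_on_snd continuous_on_id)

lemma borel_measurable_fst_plane [measurable]: "fst \<in> borel_measurable (borel :: (real \<times> real) measure)"
  by (intro borel_measurable_continuous_onI continuous_on_fst continuous_on_id)

lemma vort_dominated:
  assumes "vort u" and [measurable]: "v \<in> borel_measurable borel" and v: "\<And>x. 0 \<le> v x" "\<And>x. v x \<le> u x"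
  shows "vort v"
  unfolding vort_def
proof (intro conjI allI impI)
  have "(v x)\<^sup>2 \<le> (u x)\<^sup>2" for x using v by (intro power_mono)
  then show "integrable lborel (\<lambda>x. (v x)\<^sup>2)"
    by (intro Bochner_Integration.integrable_bound[OF vortD(2)[OF assms(1)]]) auto
  show "integrable lborel v"
    using v vortD(3)[OF assms(1)]
    by (intro Bochner_Integration.integrable_bound[OF vortD(1)[OF assms(1)]]) auto
  show "v x = 0" if "x \<notin> strip L" for x
    using v[of x] vortD(4)[OF assms(1) that] by auto
qed (use v in auto)

lemma vort_indicator:
  assumes "vort u" "A \<in> sets borel"
  shows "vort (\<lambda>x. indicator A x * u x)"
  using vort_measurable[OF assms(1)] vortD(3)[OF assms(1)] assms(2)
  by (intro vort_dominated[OF assms(1)]) (auto split: split_indicator)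

lemma mult_integrable:
  assumes [measurable]: "u \<in> borel_measurable M" "v \<in> borel_measurable M"
    and "integrable M (\<lambda>x. (u x)\<^sup>2)" "integrable M (\<lambda>x. (v x)\<^sup>2)"
  shows "integrable M (\<lambda>x. u x * v x :: real)"
proof (rule Bochner_Integration.integrable_bound)
  show "integrable M (\<lambda>x. (u x)\<^sup>2 + (v x)\<^sup>2)" using assms by auto
  have "\<bar>u x * v x\<bar> \<le> (u x)\<^sup>2 + (v x)\<^sup>2" for x
    using sum_squares_bound[of "\<bar>u x\<bar>" "\<bar>v x\<bar>"] abs_ge_zero[of "u x * v x"] unfolding power2_abs abs_mult by linarith
  then show "AE x in M. norm (u x * v x) \<le> norm ((u x)\<^sup>2 + (v x)\<^sup>2)" by auto
qed measurable

lemma vort_mult_integrable: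
  assumes "vort u" "vort v" shows "integrable lborel (\<lambda>x. u x * v x)"
  using vortD[OF assms(1)] vortD[OF assms(2)] vort_measurable[OF assms(1)] vort_measurable[OF assms(2)] by (intro mult_integrable) auto

lemma vort_add:
  assumes "vort u" "vort v" shows "vort (\<lambda>x. u x + v x)"
proof -
  have "(u x + v x)\<^sup>2 = (u x)\<^sup>2 + (v x)\<^sup>2 + 2 * (u x * v x)" for x by (simp add: power2_sum)
  then show ?thesis
    using vortD[OF assms(1)] vortD[OF assms(2)] vort_mult_integrable[OF assms] by (simp add: vort_def)
qed

lemma vort_zero: "vort (\<lambda>_. 0)" by (simp add: vort_def)

lemma vort_sum:
  assumes "finite J" "\<And>j. j \<in> J \<Longrightarrow> vort (u j)" shows "vort (\<lambda>x. \<Sum>j\<in>J. u j x)"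
  using assms by (induction J rule: finite_induct) (auto intro: vort_add vort_zero)

lemma vort_cmult:
  assumes "vort u" "0 \<le> c" shows "vort (\<lambda>x. c * u x)"
  using assms by (auto simp: vort_def power_mult_distrib)

lemma gk_mult_integrable:
  assumes "vort u" shows "integrable lborel (\<lambda>y. gk x y * u y)"
proof (rule mult_integrable)
  show "gk x \<in> borel_measurable lborel" by measurable
qed (use vortD[OF assms] vort_measurable[OF assms] gk_square_integrable in auto)

lemma pot_nonneg: "0 \<le> pot u x" if "vort u"
  unfolding pot_def using gk_nonneg vortD[OF that] by (auto intro!: integral_nonneg_AE)

text \<open>Young's inequality with a free weight s. The choice s = \<lambda> \<nu> in
  \<open>pot_le_uniform\<close> lets the L^2 term be absorbed.\<close>

lemma pot_le:
  assumes "vort u" "0 < s"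
  shows "pot u x \<le> (s * gk_bound + sq u / s) / 2"
proof -
  have "pot u x \<le> (\<integral>y. s / 2 * (gk x y)\<^sup>2 + 1 / (2 * s) * (u y)\<^sup>2 \<partial>lborel)"
    unfolding pot_def
  proof (rule integral_mono)
    fix y
    have "0 \<le> (s * gk x y - u y)\<^sup>2" by simp
    then have "2 * s * (gk x y * u y) \<le> s\<^sup>2 * (gk x y)\<^sup>2 + (u y)\<^sup>2"
      by (simp add: power2_eq_square algebra_simps)
    then show "gk x y * u y \<le> s / 2 * (gk x y)\<^sup>2 + 1 / (2 * s) * (u y)\<^sup>2"
      using \<open>0 < s\<close> by (simp add: field_simps power2_eq_square)
  qed (use gk_mult_integrable[OF assms(1)] vortD[OF assms(1)] gk_square_integrable in auto)
  also have "\<dots> = s / 2 * (\<integral>y. (gk x y)\<^sup>2 \<partial>lborel) + 1 / (2 * s) * sq u"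
    unfolding sq_def using vortD[OF assms(1)] gk_square_integrable by simp
  also have "\<dots> \<le> s / 2 * gk_bound + 1 / (2 * s) * sq u"
    using gk_square_integrable(2) \<open>0 < s\<close> by (intro add_right_mono mult_left_mono) auto
  finally show ?thesis by (simp add: field_simps)
qed

lemma borel_measurable_pot [measurable]:
  assumes [measurable]: "u \<in> borel_measurable borel" shows "pot u \<in> borel_measurable borel"
  unfolding pot_def[abs_def] by (rule lborel.borel_measurable_lebesgue_integral[of _ borel, simplified]) measurable

lemma form_integrable:
  assumes "vort u" "vort v" shows "integrable lborel (\<lambda>x. pot u x * v x)"
  using integrable_mult_bounded_nonneg[OF vortD(1)[OF assms(2)], of "pot u" "(1 * gk_bound + sq u / 1) / 2"]
    pot_nonneg[OF assms(1)] pot_le[OF assms(1), of 1] vort_measurable[OF assms(1)]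
  by (simp add: mult.commute)

lemma form_nonneg: "0 \<le> form u v" if "vort u" "vort v"
  unfolding form_def using pot_nonneg vortD that by (auto intro!: integral_nonneg_AE)

lemma pot_add: "pot (\<lambda>x. u x + v x) x = pot u x + pot v x" if "vort u" "vort v"
  unfolding pot_def using that gk_mult_integrable by (simp add: distrib_left)

lemma pot_cmult: "pot (\<lambda>x. c * u x) x = c * pot u x"
  unfolding pot_def by (simp add: mult.left_commute)

lemma form_add_left: "form (\<lambda>x. u x + v x) w = form u w + form v w" if "vort u" "vort v" "vort w"
  unfolding form_def using that form_integrable by (simp add: pot_add distrib_right)

lemma form_add_right: "form w (\<lambda>x. u x + v x) = form w u + form w v" if "vort u" "vort v" "vort w"
  unfolding form_def using that form_integrable by (simp add: distrib_left)

lemma form_cmult: "form (\<lambda>x. c * u x) (\<lambda>x. c * v x) = c\<^sup>2 * form u v"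
proof -
  have "pot (\<lambda>x. c * u x) x * (c * v x) = c\<^sup>2 * (pot u x * v x)" for x
    by (simp add: pot_cmult power2_eq_square)
  then show ?thesis by (simp only: form_def integral_mult_right_zero)
qed

lemma form_sum:
  assumes "finite J" "\<And>j. j \<in> J \<Longrightarrow> vort (u j)"
  shows "form (\<lambda>x. \<Sum>j\<in>J. u j x) (\<lambda>x. \<Sum>j\<in>J. u j x) = (\<Sum>i\<in>J. \<Sum>j\<in>J. form (u i) (u j))"
proof -
  have zl: "form (\<lambda>_. 0) w = 0" and zr: "form w (\<lambda>_. 0) = 0" for w by (simp_all add: form_def pot_def)
  have r: "form w (\<lambda>x. \<Sum>j\<in>J. u j x) = (\<Sum>j\<in>J. form w (u j))" if "vort w" for w
    using assms by (induction J rule: finite_induct) (auto simp: zr form_add_right vort_sum that)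
  have "form (\<lambda>x. \<Sum>j\<in>I. u j x) w = (\<Sum>j\<in>I. form (u j) w)" if "vort w" "I \<subseteq> J" for w I
    using finite_subset[OF that(2) assms(1)] that(2)
  proof (induction I rule: finite_induct)
    case (insert i I)
    then have "vort (u i)" "vort (\<lambda>x. \<Sum>j\<in>I. u j x)" using assms by (auto intro!: vort_sum)
    with insert that(1) show ?case by (simp add: form_add_left)
  qed (simp add: zl)
  then show ?thesis using r assms by (simp add: vort_sum)
qed

lemma form_sym:
  assumes "vort u" "vort v" shows "form u v = form v u"
proof -
  have [measurable]: "u \<in> borel_measurable borel" "v \<in> borel_measurable borel"
    using assms vort_measurable by auto
  have i: "integrable (lborel \<Otimes>\<^sub>M lborel) (\<lambda>(x, y). gk x y * u y * v x)"
  proof (rule lborel_pair.Fubini_integrable)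
    show "integrable lborel (\<lambda>x. \<integral>y. norm (case (x, y) of (x, y) \<Rightarrow> gk x y * u y * v x) \<partial>lborel)"
      using form_integrable[OF assms] gk_nonneg vortD(3)[OF assms(1)] vortD(3)[OF assms(2)]
      by (simp add: pot_def abs_mult)
    show "AE x in lborel. integrable lborel (\<lambda>y. case (x, y) of (x, y) \<Rightarrow> gk x y * u y * v x)"
      using gk_mult_integrable[OF assms(1)] by simp
  qed measurable
  have "form u v = (\<integral>x. \<integral>y. gk x y * u y * v x \<partial>lborel \<partial>lborel)"
    by (simp add: form_def pot_def)
  also have "\<dots> = (\<integral>y. \<integral>x. gk x y * u y * v x \<partial>lborel \<partial>lborel)"
    using lborel_pair.Fubini_integral[OF i] by simp
  also have "\<dots> = (\<integral>y. \<integral>x. (gk y x * v x) * u y \<partial>lborel \<partial>lborel)"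
    by (simp add: gk_sym mult_ac)
  also have "\<dots> = form v u"
    by (simp add: form_def pot_def)
  finally show ?thesis .
qed

section \<open>Mass, impulse, L^2 norm and the functional under sums and scaling\<close>

lemma imp_integrable: "integrable lborel (\<lambda>x. snd x * u x)" if "vort u"
proof (rule Bochner_Integration.integrable_bound)
  show "integrable lborel (\<lambda>x. L * u x)" using vortD[OF that] by simp
  have "\<bar>snd x\<bar> * u x \<le> L * u x" for x
    using vortD(3,4)[OF that, of x] by (cases "x \<in> strip L") (auto simp: strip_iff intro!: mult_right_mono)
  then show "AE x in lborel. norm (snd x * u x) \<le> norm (L * u x)"
    using vortD(3)[OF that] L_pos by (auto simp: abs_mult)
qed (use vort_measurable[OF that] in measurable)

lemma imp_nonneg: "0 \<le> imp u" if "vort u"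
proof -
  have "0 \<le> snd x * u x" for x
    using vortD(3,4)[OF that, of x] by (cases "x \<in> strip L") (auto simp: strip_iff)
  then show ?thesis unfolding imp_def by (auto intro!: integral_nonneg_AE)
qed

lemma sq_nonneg: "0 \<le> sq u"
  unfolding sq_def by (auto intro!: integral_nonneg_AE)

lemma imp_le_ms: "imp u \<le> L * ms u" if "vort u"
proof -
  have "snd x * u x \<le> L * u x" for x
    using vortD(3,4)[OF that, of x] by (cases "x \<in> strip L") (auto simp: strip_iff intro!: mult_right_mono)
  then have "imp u \<le> (\<integral>x. L * u x \<partial>lborel)"
    unfolding imp_def using imp_integrable[OF that] vortD[OF that] by (intro integral_mono) auto
  then show ?thesis by (simp add: ms_def)
qed

lemma ms_add: "ms (\<lambda>x. u x + v x) = ms u + ms v" if "vort u" "vort v"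
  unfolding ms_def using vortD that by simp

lemma imp_add: "imp (\<lambda>x. u x + v x) = imp u + imp v" if "vort u" "vort v"
  unfolding imp_def using imp_integrable that by (simp add: distrib_left)

lemma sq_add: "sq (\<lambda>x. u x + v x) = sq u + 2 * (\<integral>x. u x * v x \<partial>lborel) + sq v" if "vort u" "vort v"
proof -
  have "(u x + v x)\<^sup>2 = (u x)\<^sup>2 + 2 * (u x * v x) + (v x)\<^sup>2" for x by (simp add: power2_sum)
  then show ?thesis
    unfolding sq_def using vortD that vort_mult_integrable by simp
qed

lemma ms_cmult: "ms (\<lambda>x. c * u x) = c * ms u" and imp_cmult: "imp (\<lambda>x. c * u x) = c * imp u"
  and sq_cmult: "sq (\<lambda>x. c * u x) = c\<^sup>2 * sq u" and fnl_cmult: "fnl lam (\<lambda>x. c * u x) = c\<^sup>2 * fnl lam u"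
proof -
  show s: "sq (\<lambda>x. c * u x) = c\<^sup>2 * sq u" by (simp add: sq_def power_mult_distrib)
  show "ms (\<lambda>x. c * u x) = c * ms u" by (simp add: ms_def)
  show "imp (\<lambda>x. c * u x) = c * imp u" by (simp add: imp_def mult.left_commute)
  show "fnl lam (\<lambda>x. c * u x) = c\<^sup>2 * fnl lam u"
    unfolding fnl_def s form_cmult by (simp add: algebra_simps)
qed

text \<open>The linear term is written with the potential of the sum, because both truncation and
  deletion start from control of the potential of the unmodified vorticity.\<close>

lemma fnl_add:
  assumes "vort u" "vort v"
  shows "fnl lam (\<lambda>x. u x + v x) = fnl lam u + form (\<lambda>x. u x + v x) v - 1 / 2 * form v v
    - 1 / lam * (\<integral>x. u x * v x \<partial>lborel) - 1 / (2 * lam) * sq v"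
proof -
  have "form (\<lambda>x. u x + v x) (\<lambda>x. u x + v x) = form u u + 2 * form u v + form v v"
    using assms form_sym[OF assms] by (simp add: form_add_left form_add_right vort_add)
  moreover have "form (\<lambda>x. u x + v x) v = form u v + form v v"
    using assms by (simp add: form_add_left)
  ultimately show ?thesis
    unfolding fnl_def sq_add[OF assms] by (simp add: algebra_simps add_divide_distrib)
qed

text \<open>Write u = v + w with v the truncation. Where w is nonzero, v = \<lambda> \<psi> with
  \<psi> the potential of u, so the terms linear in w in \<open>fnl_add\<close> cancel and only
  nonpositive terms quadratic in w remain.\<close>

lemma fnl_truncate:
  assumes "vort u" "0 < lam"
  shows "vort (\<lambda>x. min (u x) (lam * pot u x))" "fnl lam u \<le> fnl lam (\<lambda>x. min (u x) (lam * pot u x))"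
proof -
  define v where "v x = min (u x) (lam * pot u x)" for x
  define w where "w x = u x - v x" for x
  have um: "u \<in> borel_measurable borel" using vort_measurable assms by auto
  note [measurable] = um borel_measurable_pot[OF um]
  have v: "vort v"
    using vortD(3)[OF assms(1)] pot_nonneg[OF assms(1)] assms(2)
    by (intro vort_dominated[OF assms(1)]) (auto simp: v_def[abs_def])
  have w: "vort w"
    using vortD(3)[OF assms(1)] pot_nonneg[OF assms(1)] assms(2)
    by (intro vort_dominated[OF assms(1)]) (auto simp: v_def[abs_def] w_def[abs_def])
  have u: "u = (\<lambda>x. v x + w x)" by (simp add: w_def fun_eq_iff)
  have "v x * w x = lam * (pot u x * w x)" for x
    by (auto simp: v_def w_def min_def)
  then have "(\<integral>x. v x * w x \<partial>lborel) = lam * form u w"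
    by (simp only: form_def integral_mult_right_zero)
  then have "fnl lam u = fnl lam v - 1 / 2 * form w w - 1 / (2 * lam) * sq w"
    using fnl_add[OF v w, of lam] assms(2) unfolding u[symmetric] by simp
  also have "\<dots> \<le> fnl lam v"
  proof -
    have "0 \<le> 1 / (2 * lam) * sq w" using sq_nonneg[of w] assms(2) by simp
    then show ?thesis using form_nonneg[OF w w] by linarith
  qed
  finally show "fnl lam u \<le> fnl lam (\<lambda>x. min (u x) (lam * pot u x))" by (simp add: v_def[abs_def])
  show "vort (\<lambda>x. min (u x) (lam * pot u x))" using v by (simp add: v_def[abs_def])
qed

text \<open>A self-improving estimate. For s = \<lambda> \<nu> the bound P of \<open>pot_le\<close>
  contains sq u / s, and F \<ge> 0 gives sq u \<le> \<lambda> P \<nu> = s P. So half of P is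
  absorbed, leaving P \<le> s \<open>gk_bound\<close>.\<close>

lemma pot_le_uniform:
  assumes "vort u" "0 < lam" "0 < \<nu>" "ms u \<le> \<nu>" "0 \<le> fnl lam u"
  shows "pot u x \<le> lam * \<nu> * gk_bound"
proof -
  define s where "s = lam * \<nu>"
  define P where "P = (s * gk_bound + sq u / s) / 2"
  have "0 < s" using assms by (simp add: s_def)
  have P: "pot u x \<le> P" for x unfolding P_def by (rule pot_le) (use assms \<open>0 < s\<close> in auto)
  have "0 \<le> P" using order_trans[OF pot_nonneg P] assms(1) by blast
  have "form u u \<le> (\<integral>x. P * u x \<partial>lborel)"
    unfolding form_def using P vortD[OF assms(1)] form_integrable[OF assms(1,1)]
    by (intro integral_mono) (auto intro!: mult_right_mono)
  also have "\<dots> = P * ms u" by (simp add: ms_def)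
  also have "\<dots> \<le> P * \<nu>" using \<open>0 \<le> P\<close> assms by (intro mult_left_mono)
  finally have "form u u \<le> P * \<nu>" .
  moreover have "sq u / lam \<le> form u u" using assms(5) by (simp add: fnl_def)
  ultimately have "sq u / lam \<le> P * \<nu>" by simp
  then have "sq u / s \<le> P" using assms by (simp add: s_def field_simps)
  moreover have "(a + b) / 2 \<le> a" if "b \<le> (a + b) / 2" for a b :: real using that by simp
  ultimately have "P \<le> s * gk_bound" unfolding P_def by blast
  with P[of x] show ?thesis by (simp add: s_def)
qed

section \<open>Control of the stream function by a small multiple of the height\<close>

lemma Sn_lower: "pi / (4 * L) * \<bar>t\<bar> \<le> \<bar>Sn t\<bar>" if "\<bar>t\<bar> \<le> L"
proof -
  define z where "z = pi / (2 * L) * \<bar>t\<bar>"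
  have "z \<le> pi / (2 * L) * L" unfolding z_def using that L_pos by (intro mult_left_mono) auto
  then have "z / 2 \<le> sin z" using L_pos by (intro half_le_sin) (auto simp: z_def)
  moreover have "\<bar>sin z\<bar> = \<bar>Sn t\<bar>" unfolding z_def Sn_def by (cases "0 \<le> t") auto
  ultimately show ?thesis by (simp add: z_def)
qed

lemma Sh_lower: "pi / (4 * L) * \<bar>s\<bar> \<le> \<bar>Sh s\<bar>"
proof -
  have "pi / (2 * L) * \<bar>s\<bar> / 2 \<le> sinh (pi / (2 * L) * \<bar>s\<bar>)"
    using L_pos by (intro half_le_sinh) auto
  also have "\<dots> = \<bar>Sh s\<bar>" using L_pos by (simp add: Sh_def abs_mult flip: sinh_real_abs)
  finally show ?thesis by simp
qed

text \<open>Where 1/sqrt D exceeds T, sqrt T is at most D^(-1/4), so 1/sqrt D \<le> D^(-3/4) / sqrt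
  T, and D \<ge> S \<sigma> separates the variables. The exponent 3/4 exceeds 1/2, which yields the
  gain 1/sqrt T, and stays below 1, which keeps both factors locally integrable.\<close>

lemma inverse_sqrt_split:
  assumes "0 < D" "0 < T" "S * \<sigma> \<le> D" "0 < S" "0 < \<sigma>"
  shows "1 / sqrt D \<le> T + S powr - (3/4) * \<sigma> powr - (3/4) / sqrt T"
proof (cases "1 / sqrt D \<le> T")
  case True
  then show ?thesis using assms by (simp add: add_increasing2)
next
  case False
  have "1 / sqrt D * sqrt T \<le> 1 / sqrt D * sqrt (1 / sqrt D)"
    using False assms by (intro mult_left_mono) auto
  also have "\<dots> = D powr - (3/4)"
  proof -
    have "1 / sqrt D = D powr - (1/2)" using assms by (simp add: powr_half_sqrt powr_minus_divide)
    moreover have "sqrt (D powr - (1/2)) = D powr - (1/4)"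
      using assms by (simp add: powr_half_sqrt[symmetric] powr_powr)
    ultimately show ?thesis by (simp flip: powr_add)
  qed
  also have "\<dots> \<le> (S * \<sigma>) powr - (3/4)" using assms by (intro powr_mono2') auto
  also have "\<dots> = S powr - (3/4) * \<sigma> powr - (3/4)" using assms by (simp add: powr_mult)
  finally have "1 / sqrt D \<le> S powr - (3/4) * \<sigma> powr - (3/4) / sqrt T"
    using assms by (simp add: field_simps)
  then show ?thesis using assms by linarith
qed

text \<open>Starting from \<open>gk_le_height\<close>, the factor 1/sqrt D is split three ways. At
  horizontal distance at least d it is small and multiplies the total mass. Nearby, the part up to
  the threshold T is paid for by the small local mass, and the part above T by the bound B on u and
  an integrable majorant divided by sqrt T.\<close>

lemma pot_le_height:
  assumes "0 < \<epsilon>" "0 \<le> B" "0 < \<nu>"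
  shows "\<exists>d>0. \<exists>\<delta>>0. \<forall>u x. vort u \<longrightarrow> (\<forall>y. u y \<le> B) \<longrightarrow> ms u \<le> \<nu> \<longrightarrow> x \<in> strip L \<longrightarrow>
    (\<integral>y. indicator {y. \<bar>fst x - fst y\<bar> < d} y * u y \<partial>lborel) < \<delta> \<longrightarrow> pot u x \<le> \<epsilon> * snd x"
proof -
  define c where "c = pi / (4 * L)"
  have "0 < c" using L_pos by (simp add: c_def)
  define q2 where "q2 t = indicator {-L..L} t * (c * \<bar>t\<bar>) powr - (3/4)" for t
  have h1: "integrable lborel (\<lambda>s. \<bar>Sh s\<bar> powr - (3/4))"
    unfolding Sh_def using L_pos by (intro integrable_sinh_powr) auto
  have "integrable lborel (\<lambda>t. c powr - (3/4) * (indicator {-L..L} t * \<bar>t\<bar> powr - (3/4)))"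
    using L_pos by (intro integrable_mult_right integrable_powr_near_0) auto
  also have "(\<lambda>t. c powr - (3/4) * (indicator {-L..L} t * \<bar>t\<bar> powr - (3/4))) = q2"
    using \<open>0 < c\<close> by (auto simp: q2_def fun_eq_iff powr_mult)
  finally have h2: "integrable lborel q2" .
  define Q where "Q = (\<integral>s. \<bar>Sh s\<bar> powr - (3/4) \<partial>lborel) * (\<integral>t. q2 t \<partial>lborel)"
  have "0 \<le> Q" unfolding Q_def by (auto intro!: mult_nonneg_nonneg integral_nonneg_AE simp: q2_def)
  \<comment> \<open>Each of d, T and \<delta> makes one of the three contributions at most
    \<epsilon> L / 3. The summand 1 in T keeps T positive when Q or B is 0.\<close>
  define d where "d = 3 * \<nu> / (c * \<epsilon> * L)"
  define T where "T = (3 * Q * B / (\<epsilon> * L) + 1)\<^sup>2"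
  define \<delta> where "\<delta> = \<epsilon> * L / (3 * T)"
  have "0 < 3 * Q * B / (\<epsilon> * L) + 1" using assms \<open>0 \<le> Q\<close> L_pos by (intro add_nonneg_pos) auto
  then have "0 < T" and sT: "sqrt T = 3 * Q * B / (\<epsilon> * L) + 1" by (auto simp: T_def)
  have "0 < d" "0 < \<delta>" using assms \<open>0 < c\<close> \<open>0 < T\<close> L_pos by (auto simp: d_def \<delta>_def)
  moreover have "\<forall>u x. vort u \<longrightarrow> (\<forall>y. u y \<le> B) \<longrightarrow> ms u \<le> \<nu> \<longrightarrow> x \<in> strip L \<longrightarrow>
    (\<integral>y. indicator {y. \<bar>fst x - fst y\<bar> < d} y * u y \<partial>lborel) < \<delta> \<longrightarrow> pot u x \<le> \<epsilon> * snd x"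
  proof (intro allI impI)
    fix u x
    assume u: "vort u" and bound: "\<forall>y. u y \<le> B" and mu: "ms u \<le> \<nu>" and x: "x \<in> strip L"
      and near: "(\<integral>y. indicator {y. \<bar>fst x - fst y\<bar> < d} y * u y \<partial>lborel) < \<delta>"
    have uB: "u y \<le> B" for y using bound by blast
    define p where "p s = \<bar>Sh (fst x - s)\<bar> powr - (3/4)" for s
    define q where "q t = q2 (snd x - t)" for t
    have p: "integrable lborel p" "(\<integral>s. p s \<partial>lborel) = (\<integral>s. \<bar>Sh s\<bar> powr - (3/4) \<partial>lborel)"
      unfolding p_def using integrable_lborel_reflect_shift[OF h1, of "fst x"] by simp_all
    have q: "integrable lborel q" "(\<integral>t. q t \<partial>lborel) = (\<integral>t. q2 t \<partial>lborel)"
      unfolding q_def using integrable_lborel_reflect_shift[OF h2, of "snd x"] by simp_all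
    note pq = integral_tensor[OF p(1) q(1)]
    define nr where "nr y = indicator {y. \<bar>fst x - fst y\<bar> < d} y * u y" for y
    have nr_i: "integrable lborel nr"
      unfolding nr_def by (intro vortD(1) vort_indicator u) measurable
    define rhs where "rhs y = snd x / L * (T * nr y + (B / sqrt T * (p (fst y) * q (snd y)) + 1 / (c * d) * u y))" for y
    have rhs_i: "integrable lborel rhs"
      unfolding rhs_def using nr_i pq(1) vortD(1)[OF u] by (intro integrable_mult_right Bochner_Integration.integrable_add)
    have xL: "0 < snd x / L" using x L_pos by (auto simp: strip_iff)
    \<comment> \<open>Both lines through x are removed: the kernel bound needs distinct abscissae,
      and the splitting needs \<sigma> > 0, that is, distinct ordinates.\<close>
    have "AE y in (lborel :: (real \<times> real) measure). fst y \<noteq> fst x" by (rule AE_lborel_fst[OF AE_lborel_singleton])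
    moreover have "AE y in (lborel :: (real \<times> real) measure). snd y \<noteq> snd x" by (rule AE_lborel_snd[OF AE_lborel_singleton])
    ultimately have le: "AE y in lborel. gk x y * u y \<le> rhs y"
    proof eventually_elim
      case (elim y)
      show ?case
      proof (cases "y \<in> strip L")
        case True
        define S where "S = \<bar>Sh (fst x - fst y)\<bar>"
        define \<sigma> where "\<sigma> = c * \<bar>snd x - snd y\<bar>"
        define D where "D = (Sh (fst x - fst y))\<^sup>2 + (Sn (snd x - snd y))\<^sup>2"
        have dL: "\<bar>snd x - snd y\<bar> \<le> L" using x True by (auto simp: strip_iff)
        have S: "0 < S" using elim by (simp add: S_def Sh_eq_0_iff)
        have \<sigma>: "0 < \<sigma>" using elim \<open>0 < c\<close> by (simp add: \<sigma>_def)
        have D: "0 < D" unfolding D_def using elim by (intro denom_pos) auto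
        have uy: "0 \<le> u y" by (rule vortD(3)[OF u])
        have g: "gk x y \<le> snd x / L * (1 / sqrt D)"
          unfolding D_def by (rule gk_le_height) (use elim x in auto)
        have "1 / sqrt D * u y \<le> T * nr y + (B / sqrt T * (p (fst y) * q (snd y)) + 1 / (c * d) * u y)"
        proof (cases "\<bar>fst x - fst y\<bar> < d")
          case True
          have "\<sigma> \<le> \<bar>Sn (snd x - snd y)\<bar>" unfolding \<sigma>_def c_def by (rule Sn_lower[OF dL])
          then have "S * \<sigma> \<le> S * \<bar>Sn (snd x - snd y)\<bar>" using S by (intro mult_left_mono) auto
          also have "\<dots> \<le> D"
          proof -
            have "2 * (S * \<bar>Sn (snd x - snd y)\<bar>) \<le> S\<^sup>2 + \<bar>Sn (snd x - snd y)\<bar>\<^sup>2"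
              using sum_squares_bound[of S "\<bar>Sn (snd x - snd y)\<bar>"] by (simp add: mult.assoc)
            also have "\<dots> = D" by (simp add: D_def S_def)
            finally have "2 * (S * \<bar>Sn (snd x - snd y)\<bar>) \<le> D" .
            moreover have "0 \<le> S * \<bar>Sn (snd x - snd y)\<bar>" using S by simp
            ultimately show ?thesis by linarith
          qed
          finally have "1 / sqrt D \<le> T + S powr - (3/4) * \<sigma> powr - (3/4) / sqrt T"
            by (intro inverse_sqrt_split D \<open>0 < T\<close> S \<sigma>)
          also have "S powr - (3/4) * \<sigma> powr - (3/4) = p (fst y) * q (snd y)"
            using dL by (simp add: p_def q_def q2_def S_def \<sigma>_def abs_le_iff)
          finally have "1 / sqrt D * u y \<le> (T + p (fst y) * q (snd y) / sqrt T) * u y"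
            using uy by (intro mult_right_mono)
          also have "\<dots> = T * nr y + p (fst y) * q (snd y) / sqrt T * u y"
            using True by (simp add: nr_def algebra_simps)
          also have "\<dots> \<le> T * nr y + p (fst y) * q (snd y) / sqrt T * B"
            using uB \<open>0 < T\<close> by (intro add_left_mono mult_left_mono) (auto simp: p_def q_def q2_def)
          also have "\<dots> \<le> T * nr y + (B / sqrt T * (p (fst y) * q (snd y)) + 1 / (c * d) * u y)"
            using uy \<open>0 < c\<close> \<open>0 < d\<close> by (simp add: mult.commute)
          finally show ?thesis .
        next
          case False
          have "c * d \<le> c * \<bar>fst x - fst y\<bar>" using False \<open>0 < c\<close> by (intro mult_left_mono) auto
          also have "\<dots> \<le> S" unfolding c_def S_def by (rule Sh_lower)
          also have "S \<le> sqrt D" unfolding S_def D_def by (intro real_le_rsqrt) auto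
          finally have "1 / sqrt D \<le> 1 / (c * d)"
            using \<open>0 < c\<close> \<open>0 < d\<close> D by (intro divide_left_mono) auto
          then have "1 / sqrt D * u y \<le> 1 / (c * d) * u y" using uy by (intro mult_right_mono)
          also have "\<dots> \<le> T * nr y + (B / sqrt T * (p (fst y) * q (snd y)) + 1 / (c * d) * u y)"
            using uy \<open>0 < T\<close> assms by (simp add: nr_def p_def q_def q2_def)
          finally show ?thesis .
        qed
        then have "snd x / L * (1 / sqrt D * u y) \<le> rhs y"
          unfolding rhs_def using xL by (intro mult_left_mono) auto
        moreover have "gk x y * u y \<le> snd x / L * (1 / sqrt D) * u y"
          using g uy by (intro mult_right_mono)
        ultimately show ?thesis by (simp only: mult.assoc)
      next
        case False
        then have uy: "u y = 0" by (rule vortD(4)[OF u])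
        have "0 \<le> p (fst y)" "0 \<le> q (snd y)" by (simp_all add: p_def q_def q2_def)
        then have "0 \<le> snd x / L * (B / sqrt T * (p (fst y) * q (snd y)))"
          using xL \<open>0 < T\<close> assms by (intro mult_nonneg_nonneg[OF less_imp_le[OF xL]] mult_nonneg_nonneg) auto
        then show ?thesis by (simp add: uy rhs_def nr_def)
      qed
    qed
    have "pot u x \<le> (\<integral>y. rhs y \<partial>lborel)"
      unfolding pot_def by (rule integral_mono_AE[OF gk_mult_integrable[OF u] rhs_i le])
    also have "\<dots> = snd x / L * (T * (\<integral>y. nr y \<partial>lborel) + (B / sqrt T * Q + 1 / (c * d) * ms u))"
      unfolding rhs_def ms_def using nr_i pq vortD(1)[OF u] p q by (simp add: Q_def)
    also have "\<dots> \<le> snd x / L * (\<epsilon> * L / 3 + (\<epsilon> * L / 3 + \<epsilon> * L / 3))"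
    proof (intro mult_left_mono add_mono)
      have "T * (\<integral>y. nr y \<partial>lborel) \<le> T * \<delta>"
        using near \<open>0 < T\<close> unfolding nr_def by (intro mult_left_mono) auto
      then show "T * (\<integral>y. nr y \<partial>lborel) \<le> \<epsilon> * L / 3" using \<open>0 < T\<close> by (simp add: \<delta>_def)
      have "B * Q \<le> \<epsilon> * L / 3 * sqrt T"
        unfolding sT using assms L_pos by (simp add: field_simps)
      then show "B / sqrt T * Q \<le> \<epsilon> * L / 3" using \<open>0 < T\<close> by (simp add: field_simps)
      have "1 / (c * d) * ms u \<le> 1 / (c * d) * \<nu>"
        using mu \<open>0 < c\<close> \<open>0 < d\<close> by (intro mult_left_mono) auto
      also have "\<dots> = \<epsilon> * L / 3" using assms \<open>0 < c\<close> L_pos by (simp add: d_def field_simps)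
      finally show "1 / (c * d) * ms u \<le> \<epsilon> * L / 3" .
    qed (use xL in auto)
    also have "\<dots> = \<epsilon> * snd x" using L_pos by simp
    finally show "pot u x \<le> \<epsilon> * snd x" .
  qed
  ultimately show ?thesis by blast
qed

end

section \<open>Localization by slabs\<close>

lemma sum_power2_orthogonal:
  fixes f :: "'i \<Rightarrow> 'a :: comm_ring_1"
  assumes "finite J" "\<And>i j. \<lbrakk>i \<in> J; j \<in> J; i \<noteq> j\<rbrakk> \<Longrightarrow> f i * f j = 0"
  shows "(\<Sum>j\<in>J. f j)\<^sup>2 = (\<Sum>j\<in>J. (f j)\<^sup>2)"
  using assms
proof (induction J rule: finite_induct)
  case (insert a J)
  have "f a * (\<Sum>j\<in>J. f j) = 0"
    unfolding sum_distrib_left using insert.prems insert.hyps by (intro sum.neutral) auto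
  then have "2 * f a * (\<Sum>j\<in>J. f j) = 0" by (simp add: mult.assoc)
  then show ?case using insert by (simp add: power2_sum)
qed simp

lemma
  fixes f :: "'a::euclidean_space \<Rightarrow> real"
  assumes [measurable]: "f \<in> borel_measurable borel"
  shows lborel_integral_translate: "(\<integral>x. f (x + c) \<partial>lborel) = (\<integral>x. f x \<partial>lborel)"
    and lborel_integrable_translate: "integrable lborel (\<lambda>x. f (x + c)) \<longleftrightarrow> integrable lborel f"
proof -
  have "(\<integral>x. f x \<partial>distr lborel borel ((+) c)) = (\<integral>x. f (c + x) \<partial>lborel)"
    by (rule integral_distr) auto
  then show "(\<integral>x. f (x + c) \<partial>lborel) = (\<integral>x. f x \<partial>lborel)"
    by (simp add: lborel_distr_plus add.commute)
  have "integrable (distr lborel borel ((+) c)) f \<longleftrightarrow> integrable lborel (\<lambda>x. f (c + x))"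
    by (rule integrable_distr_eq) auto
  then show "integrable lborel (\<lambda>x. f (x + c)) \<longleftrightarrow> integrable lborel f"
    by (simp add: lborel_distr_plus add.commute)
qed

context strip_domain
begin

text \<open>A slab of width d is a fibre of the floor of x_1/d, so a set J of integers encodes a
  union of slabs.\<close>

lemma measurable_slab [measurable]: "{x :: real \<times> real. \<lfloor>fst x / d\<rfloor> \<in> J} \<in> sets borel"
proof -
  have "{x :: real \<times> real. \<lfloor>fst x / d\<rfloor> \<in> J} = (\<lambda>x. \<lfloor>fst x / d\<rfloor>) -` J \<inter> space borel" by auto
  moreover have "(\<lambda>x :: real \<times> real. \<lfloor>fst x / d\<rfloor>) \<in> measurable borel (count_space UNIV)" by measurable
  ultimately show ?thesis by (metis measurable_sets UNIV_I Pow_UNIV sets_count_space)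
qed

text \<open>With w the part kept, m the impulse deleted and \<theta> = \<kappa> m, the cost is at
  most \<epsilon> m = e \<theta>, and dividing w by 1 - \<theta> regains it. Both d and N depend
  only on the constants, not on u. The rescaled function may exceed B.\<close>

lemma keep_heavy_slabs:
  assumes "0 < lam" "0 < \<nu>" "0 < \<mu>" "0 \<le> B" "0 < e"
  shows "\<exists>d>0. \<exists>N. \<forall>u. vort u \<longrightarrow> (\<forall>y. u y \<le> B) \<longrightarrow> ms u \<le> \<nu> \<longrightarrow> imp u \<le> \<mu> \<longrightarrow> e \<le> fnl lam u \<longrightarrow>
      (\<exists>v J. vort v \<and> ms v \<le> \<nu> \<and> imp v \<le> \<mu> \<and> fnl lam u \<le> fnl lam v \<and> finite J \<and> card J \<le> N \<and>
        (\<forall>x. v x \<noteq> 0 \<longrightarrow> \<lfloor>fst x / d\<rfloor> \<in> J))"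
proof -
  \<comment> \<open>The bound 1/(2 \<mu>) gives \<theta> \<le> 1/2; the bound 1/(2 L \<nu>) gives
    \<nu> \<theta> \<le> m/L, which is at most the deleted mass.\<close>
  define \<kappa> where "\<kappa> = min (1 / \<mu>) (1 / (L * \<nu>)) / 2"
  have "0 < \<kappa>" using assms L_pos by (simp add: \<kappa>_def)
  have \<kappa>\<mu>: "\<kappa> * \<mu> \<le> 1 / 2"
  proof -
    have "\<kappa> * \<mu> \<le> (1 / \<mu> / 2) * \<mu>" unfolding \<kappa>_def using assms by (intro mult_right_mono divide_right_mono) auto
    then show ?thesis using assms by simp
  qed
  have \<kappa>\<nu>: "\<kappa> * \<nu> \<le> 1 / L / 2"
  proof -
    have "\<kappa> * \<nu> \<le> (1 / (L * \<nu>) / 2) * \<nu>" unfolding \<kappa>_def using assms by (intro mult_right_mono divide_right_mono) auto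
    then show ?thesis using assms by simp
  qed
  define \<epsilon> where "\<epsilon> = e * \<kappa>"
  have "0 < \<epsilon>" using assms \<open>0 < \<kappa>\<close> by (simp add: \<epsilon>_def)
  obtain d \<delta> where "0 < d" "0 < \<delta>" and low: "\<forall>u x. vort u \<longrightarrow> (\<forall>y. u y \<le> B) \<longrightarrow> ms u \<le> \<nu> \<longrightarrow> x \<in> strip L \<longrightarrow>
    (\<integral>y. indicator {y. \<bar>fst x - fst y\<bar> < d} y * u y \<partial>lborel) < \<delta> \<longrightarrow> pot u x \<le> \<epsilon> * snd x"
    using pot_le_height[OF \<open>0 < \<epsilon>\<close> \<open>0 \<le> B\<close> \<open>0 < \<nu>\<close>] by blast
  define N where "N = nat \<lceil>3 * \<nu> / \<delta>\<rceil>"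
  have "\<exists>v J. vort v \<and> ms v \<le> \<nu> \<and> imp v \<le> \<mu> \<and> fnl lam u \<le> fnl lam v \<and> finite J \<and> card J \<le> N \<and>
        (\<forall>x. v x \<noteq> 0 \<longrightarrow> \<lfloor>fst x / d\<rfloor> \<in> J)"
    if u: "vort u" and uB: "\<And>y. u y \<le> B" and mu: "ms u \<le> \<nu>" and iu: "imp u \<le> \<mu>" and eu: "e \<le> fnl lam u" for u
  proof -
    have [measurable]: "u \<in> borel_measurable borel" by (rule vort_measurable[OF u])
    define nr where "nr j y = indicator {y. \<lfloor>fst y / d\<rfloor> \<in> {j - 1, j, j + 1}} y * u y" for j and y :: "real \<times> real"
    have nr: "integrable lborel (nr j)" "0 \<le> nr j y" for j and y :: "real \<times> real"
    proof -
      have "vort (nr j)" unfolding nr_def[abs_def] by (intro vort_indicator u measurable_slab)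
      from vortD(1)[OF this] vortD(3)[OF this] show "integrable lborel (nr j)" "0 \<le> nr j y" by simp_all
    qed
    \<comment> \<open>Three neighbouring slabs are weighed together, because points at horizontal
      distance below d from slab j lie in slabs j - 1, j, j + 1. This is the neighbourhood on which
      \<open>low\<close> requires little mass.\<close>
    define J where "J = {j. \<delta> \<le> (\<integral>y. nr j y \<partial>lborel)}"
    have J: "finite J \<and> card J \<le> N"
    proof (rule finite_if_finite_subsets_card_bdd)
      fix G assume G: "G \<subseteq> J" "finite G"
      have "real (card G) * \<delta> = (\<Sum>j\<in>G. \<delta>)" by simp
      also have "\<dots> \<le> (\<Sum>j\<in>G. \<integral>y. nr j y \<partial>lborel)" using G by (intro sum_mono) (auto simp: J_def)
      also have "\<dots> = (\<integral>y. (\<Sum>j\<in>G. nr j y) \<partial>lborel)"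
        using nr by (intro Bochner_Integration.integral_sum[symmetric])
      also have "\<dots> \<le> (\<integral>y. 3 * u y \<partial>lborel)"
      proof (rule integral_mono)
        \<comment> \<open>Double counting: each point contributes to at most three of the weighed
          triples, so at most 3 \<nu> / \<delta> of them can be heavy.\<close>
        fix y :: "real \<times> real"
        define k where "k = \<lfloor>fst y / d\<rfloor>"
        have "(\<Sum>j\<in>G. nr j y) = (\<Sum>j\<in>G. if j \<in> {k - 1, k, k + 1} then u y else 0)"
          unfolding nr_def k_def by (intro sum.cong) auto
        also have "\<dots> = real (card (G \<inter> {k - 1, k, k + 1})) * u y"
          using G by (subst sum.inter_restrict[symmetric]) simp_all
        also have "\<dots> \<le> 3 * u y"
        proof (intro mult_right_mono)
          have "card (G \<inter> {k - 1, k, k + 1}) \<le> card {k - 1, k, k + 1}" by (intro card_mono) auto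
          then show "real (card (G \<inter> {k - 1, k, k + 1})) \<le> 3" by simp
        qed (rule vortD(3)[OF u])
        finally show "(\<Sum>j\<in>G. nr j y) \<le> 3 * u y" .
      qed (use nr vortD(1)[OF u] in auto)
      also have "\<dots> \<le> 3 * \<nu>" using mu by (simp add: ms_def)
      finally have "real (card G) \<le> 3 * \<nu> / \<delta>" using \<open>0 < \<delta>\<close> by (simp add: field_simps)
      then show "card G \<le> N" unfolding N_def by linarith
    qed
    define Z where "Z = {x :: real \<times> real. \<lfloor>fst x / d\<rfloor> \<notin> J}"
    have Zm: "Z \<in> sets borel" using measurable_slab[of d "- J"] by (simp add: Z_def)
    define \<eta> where "\<eta> x = indicator Z x * u x" for x
    define w where "w x = indicator (- Z) x * u x" for x
    have \<eta>: "vort \<eta>" and w: "vort w"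
      unfolding \<eta>_def[abs_def] w_def[abs_def] using Zm by (auto intro!: vort_indicator[OF u])
    have uw: "u = (\<lambda>x. w x + \<eta> x)"
      by (auto simp: \<eta>_def w_def split: split_indicator)
    have orth: "(\<integral>x. w x * \<eta> x \<partial>lborel) = 0"
    proof -
      have "w x * \<eta> x = 0" for x by (auto simp: \<eta>_def w_def split: split_indicator)
      then show ?thesis by (simp only: Bochner_Integration.integral_zero)
    qed
    define m where "m = imp \<eta>"
    have "0 \<le> m" unfolding m_def by (rule imp_nonneg[OF \<eta>])
    have iw: "imp u = imp w + m" and mw: "ms u = ms w + ms \<eta>"
      using imp_add[OF w \<eta>] ms_add[OF w \<eta>] unfolding uw[symmetric] m_def by auto
    have "m \<le> \<mu>" using iw iu imp_nonneg[OF w] by linarith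
    have "m / L \<le> ms \<eta>" using imp_le_ms[OF \<eta>] L_pos by (simp add: m_def field_simps)
    have "form u \<eta> \<le> (\<integral>x. \<epsilon> * (snd x * \<eta> x) \<partial>lborel)"
      unfolding form_def
    proof (rule integral_mono)
      fix x
      show "pot u x * \<eta> x \<le> \<epsilon> * (snd x * \<eta> x)"
      proof (cases "x \<in> Z \<and> x \<in> strip L")
        case True
        define j where "j = \<lfloor>fst x / d\<rfloor>"
        have "(\<integral>y. indicator {y. \<bar>fst x - fst y\<bar> < d} y * u y \<partial>lborel) \<le> (\<integral>y. nr j y \<partial>lborel)"
        proof (rule integral_mono)
          show "integrable lborel (\<lambda>y. indicator {y. \<bar>fst x - fst y\<bar> < d} y * u y)"
            by (intro vortD(1) vort_indicator u) measurable
          fix y :: "real \<times> real"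
          have "\<lfloor>fst y / d\<rfloor> \<in> {j - 1, j, j + 1}" if "\<bar>fst x - fst y\<bar> < d"
          proof -
            have "\<bar>fst x / d - fst y / d\<bar> < 1"
              using that \<open>0 < d\<close> by (simp add: field_simps flip: diff_divide_distrib)
            then show ?thesis unfolding j_def by (auto simp: floor_eq_iff; linarith)
          qed
          then show "indicator {y. \<bar>fst x - fst y\<bar> < d} y * u y \<le> nr j y"
            using nr(2)[of j y] by (auto simp: nr_def split: split_indicator)
        qed (rule nr)
        also have "\<dots> < \<delta>" using True by (auto simp: Z_def J_def j_def)
        finally have "pot u x \<le> \<epsilon> * snd x" using low True u uB mu by blast
        then show ?thesis using vortD(3)[OF \<eta>, of x] by (simp add: mult_right_mono flip: mult.assoc)
      next
        case False
        then have "\<eta> x = 0" using vortD(4)[OF u, of x] by (auto simp: \<eta>_def)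
        then show ?thesis by simp
      qed
    qed (use form_integrable[OF u \<eta>] imp_integrable[OF \<eta>] in auto)
    then have fu: "form u \<eta> \<le> \<epsilon> * m" by (simp add: m_def imp_def)
    have fw: "fnl lam u - \<epsilon> * m \<le> fnl lam w"
    proof -
      have "0 \<le> 1 / (2 * lam) * sq \<eta>" using sq_nonneg[of \<eta>] assms(1) by simp
      then show ?thesis
        using fnl_add[OF w \<eta>, of lam] form_nonneg[OF \<eta> \<eta>] fu unfolding uw[symmetric] orth by linarith
    qed
    define \<theta> where "\<theta> = \<kappa> * m"
    have "0 \<le> \<theta>" using \<open>0 < \<kappa>\<close> \<open>0 \<le> m\<close> by (simp add: \<theta>_def)
    have "\<theta> \<le> \<kappa> * \<mu>" using \<open>0 < \<kappa>\<close> \<open>m \<le> \<mu>\<close> by (simp add: \<theta>_def)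
    then have "\<theta> \<le> 1 / 2" using \<kappa>\<mu> by linarith
    define v where "v x = 1 / (1 - \<theta>) * w x" for x
    have v: "vort v" unfolding v_def[abs_def] using \<open>\<theta> \<le> 1 / 2\<close> by (intro vort_cmult w) auto
    have "m * (\<kappa> * \<nu>) \<le> m * (1 / L / 2)" using \<kappa>\<nu> \<open>0 \<le> m\<close> by (intro mult_left_mono)
    also have "\<dots> \<le> m / L" using \<open>0 \<le> m\<close> L_pos by (simp add: field_simps)
    also have "\<dots> \<le> ms \<eta>" by fact
    finally have "ms w \<le> \<nu> * (1 - \<theta>)" using mu mw by (simp add: \<theta>_def algebra_simps)
    then have "ms v \<le> \<nu>"
      using \<open>\<theta> \<le> 1 / 2\<close> unfolding v_def[abs_def] ms_cmult by (simp add: field_simps)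
    have "m * (\<kappa> * \<mu>) \<le> m * (1 / 2)" using \<kappa>\<mu> \<open>0 \<le> m\<close> by (intro mult_left_mono)
    then have "imp w \<le> \<mu> * (1 - \<theta>)" using iu iw \<open>0 \<le> m\<close> by (simp add: \<theta>_def algebra_simps)
    then have "imp v \<le> \<mu>"
      using \<open>\<theta> \<le> 1 / 2\<close> unfolding v_def[abs_def] imp_cmult by (simp add: field_simps)
    \<comment> \<open>The chain is F(u) (1 - \<theta>)^2 \<le> F(u) (1 - \<theta>) \<le> F(u) - e
      \<theta> \<le> F(w); the middle step is where F(u) \<ge> e pays for the deletion.\<close>
    have "fnl lam u * (1 - \<theta>)\<^sup>2 \<le> fnl lam w"
    proof -
      have "(1 - \<theta>)\<^sup>2 \<le> 1 - \<theta>" using \<open>0 \<le> \<theta>\<close> \<open>\<theta> \<le> 1 / 2\<close> by (simp add: power2_eq_square mult_left_le)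
      then have "fnl lam u * (1 - \<theta>)\<^sup>2 \<le> fnl lam u * (1 - \<theta>)" using eu assms by (intro mult_left_mono) auto
      moreover have "e * \<theta> \<le> fnl lam u * \<theta>" using eu \<open>0 \<le> \<theta>\<close> by (intro mult_right_mono)
      moreover have "e * \<theta> = \<epsilon> * m" by (simp add: \<epsilon>_def \<theta>_def)
      ultimately show ?thesis using fw by (simp add: algebra_simps)
    qed
    then have "fnl lam u \<le> fnl lam v"
      using \<open>\<theta> \<le> 1 / 2\<close> unfolding v_def[abs_def] fnl_cmult by (simp add: field_simps)
    moreover have "\<lfloor>fst x / d\<rfloor> \<in> J" if "v x \<noteq> 0" for x
      using that by (auto simp: v_def w_def Z_def split: split_indicator_asm)
    ultimately show ?thesis
      using v \<open>ms v \<le> \<nu>\<close> \<open>imp v \<le> \<mu>\<close> J by blast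
  qed
  with \<open>0 < d\<close> show ?thesis by blast
qed

section \<open>Horizontal translations and the closing of gaps between slabs\<close>

lemma vort_translate:
  assumes "vort u" "snd c = 0"
  shows "vort (\<lambda>x. u (x + c))" "ms (\<lambda>x. u (x + c)) = ms u" "imp (\<lambda>x. u (x + c)) = imp u"
    "sq (\<lambda>x. u (x + c)) = sq u"
proof -
  have [measurable]: "u \<in> borel_measurable borel" by (rule vort_measurable[OF assms(1)])
  show "vort (\<lambda>x. u (x + c))"
    unfolding vort_def
  proof (intro conjI allI impI)
    show "integrable lborel (\<lambda>x. u (x + c))"
      using vortD(1)[OF assms(1)] by (subst lborel_integrable_translate) auto
    show "integrable lborel (\<lambda>x. (u (x + c))\<^sup>2)"
      using vortD(2)[OF assms(1)] by (subst lborel_integrable_translate[of "\<lambda>x. (u x)\<^sup>2"]) auto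
    show "u (x + c) = 0" if "x \<notin> strip L" for x
      using that assms(2) by (intro vortD(4)[OF assms(1)]) (simp add: strip_iff)
  qed (rule vortD(3)[OF assms(1)])
  show "ms (\<lambda>x. u (x + c)) = ms u" unfolding ms_def by (rule lborel_integral_translate) measurable
  show "sq (\<lambda>x. u (x + c)) = sq u" unfolding sq_def by (rule lborel_integral_translate) measurable
  have "(\<integral>x. snd (x + c) * u (x + c) \<partial>lborel) = (\<integral>x. snd x * u x \<partial>lborel)"
    by (rule lborel_integral_translate[of "\<lambda>x. snd x * u x"]) measurable
  then show "imp (\<lambda>x. u (x + c)) = imp u" using assms(2) by (simp add: imp_def)
qed

text \<open>A change of variables moves the translations from the functions to the kernel, so a
  comparison of kernels on the supports suffices.\<close>

lemma form_translate_mono: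
  assumes u: "vort u" "snd a = 0" and v: "vort v" "snd b = 0"
    and le: "\<And>x y. \<lbrakk>v x \<noteq> 0; u y \<noteq> 0\<rbrakk> \<Longrightarrow> gk x y \<le> gk (x - b) (y - a)"
  shows "form u v \<le> form (\<lambda>x. u (x + a)) (\<lambda>x. v (x + b))"
proof -
  have [measurable]: "u \<in> borel_measurable borel" "v \<in> borel_measurable borel"
    using vort_measurable u v by auto
  note ta = vort_translate(1)[OF u] and tb = vort_translate(1)[OF v]
  define p where "p = pot (\<lambda>x. u (x + a))"
  have pm [measurable]: "p \<in> borel_measurable borel"
    unfolding p_def by (rule borel_measurable_pot) measurable
  have p: "p (x - b) = (\<integral>y. gk (x - b) (y - a) * u y \<partial>lborel)" for x
    unfolding p_def pot_def
    using lborel_integral_translate[of "\<lambda>y. gk (x - b) (y - a) * u y" a] by simp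
  have pint: "integrable lborel (\<lambda>y. gk (x - b) (y - a) * u y)" for x
    using gk_mult_integrable[OF ta, of "x - b"]
      lborel_integrable_translate[of "\<lambda>y. gk (x - b) (y - a) * u y" a] by simp
  have eq: "form (\<lambda>x. u (x + a)) (\<lambda>x. v (x + b)) = (\<integral>x. p (x - b) * v x \<partial>lborel)"
    unfolding form_def p_def[symmetric]
    using lborel_integral_translate[of "\<lambda>x. p (x - b) * v x" b] by simp
  have i: "integrable lborel (\<lambda>x. p (x - b) * v x)"
    using form_integrable[OF ta tb] lborel_integrable_translate[of "\<lambda>x. p (x - b) * v x" b]
    unfolding p_def[symmetric] by simp
  show ?thesis
    unfolding eq unfolding form_def
  proof (rule integral_mono[OF form_integrable[OF u(1) v(1)] i])
    fix x
    show "pot u x * v x \<le> p (x - b) * v x"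
    proof (cases "v x = 0")
      case False
      have "pot u x \<le> p (x - b)"
        unfolding p pot_def
      proof (rule integral_mono[OF gk_mult_integrable[OF u(1)] pint])
        fix y :: "real \<times> real"
        show "gk x y * u y \<le> gk (x - b) (y - a) * u y"
          using le[OF False, of y] vortD(3)[OF u(1), of y]
          by (cases "u y = 0") (auto intro!: mult_right_mono)
      qed
      then show ?thesis using vortD(3)[OF v(1)] by (intro mult_right_mono)
    qed simp
  qed
qed

text \<open>The slab j is moved to the position given by its rank in J. Ranks are distinct, so the
  moved pieces stay disjoint and mass, impulse and L^2 norm are unchanged, while no pair of pieces
  moves apart.\<close>

lemma compress_slabs:
  assumes u: "vort u" and J: "finite J" and "0 < d" and supp: "\<And>x. u x \<noteq> 0 \<Longrightarrow> \<lfloor>fst x / d\<rfloor> \<in> J"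
  shows "\<exists>v. vort v \<and> ms v = ms u \<and> imp v = imp u \<and> sq v = sq u \<and> form u u \<le> form v v \<and>
    (\<forall>x. v x \<noteq> 0 \<longrightarrow> 0 \<le> \<lfloor>fst x / d\<rfloor> \<and> \<lfloor>fst x / d\<rfloor> < int (card J))"
proof -
  define \<phi> where "\<phi> j = int (card {i \<in> J. i < j})" for j
  \<comment> \<open>The shift enters as u(x + c), so the piece in slab j ends up in slab \<phi>
    j.\<close>
  define c :: "int \<Rightarrow> real \<times> real" where "c j = (d * of_int (j - \<phi> j), 0)" for j
  define U where "U j x = indicator {x. \<lfloor>fst x / d\<rfloor> \<in> {j}} x * u x" for j and x :: "real \<times> real"
  define V where "V j x = U j (x + c j)" for j x
  have sc: "snd (c j) = 0" for j by (simp add: c_def)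
  have U: "vort (U j)" for j unfolding U_def[abs_def] by (intro vort_indicator u measurable_slab)
  have V: "vort (V j)" and T: "ms (V j) = ms (U j)" "imp (V j) = imp (U j)" "sq (V j) = sq (U j)" for j
    unfolding V_def[abs_def] by (rule vort_translate[OF U sc])+
  have \<phi>_less: "1 \<le> \<phi> j - \<phi> i \<and> \<phi> j - \<phi> i \<le> j - i" if "i \<in> J" "i < j" for i j
  proof -
    have "{k \<in> J. k < j} = {k \<in> J. k < i} \<union> {k \<in> J. i \<le> k \<and> k < j}" using that by auto
    moreover have "card ({k \<in> J. k < i} \<union> {k \<in> J. i \<le> k \<and> k < j}) = card {k \<in> J. k < i} + card {k \<in> J. i \<le> k \<and> k < j}"
      using J by (intro card_Un_disjoint) auto
    moreover have "card {k \<in> J. i \<le> k \<and> k < j} \<le> card {i..<j}" by (intro card_mono) auto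
    moreover have "card {i} \<le> card {k \<in> J. i \<le> k \<and> k < j}" using that J by (intro card_mono) auto
    ultimately show ?thesis using that by (simp add: \<phi>_def)
  qed
  have \<phi>_card: "0 \<le> \<phi> j \<and> \<phi> j < int (card J)" if "j \<in> J" for j
    using psubset_card_mono[OF J, of "{i \<in> J. i < j}"] that by (auto simp: \<phi>_def)
  have \<phi>_inj: "\<phi> i \<noteq> \<phi> j" if "i \<in> J" "j \<in> J" "i \<noteq> j" for i j
    using \<phi>_less[of i j] \<phi>_less[of j i] that by (cases i j rule: linorder_cases) auto
  have V_slab: "\<lfloor>fst x / d\<rfloor> = \<phi> j" if "V j x \<noteq> 0" for x j
  proof -
    have "\<lfloor>fst (x + c j) / d\<rfloor> = j" using that by (auto simp: V_def U_def split: split_indicator_asm)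
    moreover have "fst (x + c j) / d = fst x / d + of_int (j - \<phi> j)"
      using \<open>0 < d\<close> by (simp add: c_def field_simps)
    ultimately have "\<lfloor>fst x / d + of_int (j - \<phi> j)\<rfloor> = j" by (simp only:)
    then show ?thesis unfolding floor_add_int[symmetric] by simp
  qed
  define v where "v x = (\<Sum>j\<in>J. V j x)" for x
  have u_sum: "u x = (\<Sum>j\<in>J. U j x)" for x
  proof -
    have "(\<Sum>j\<in>J. U j x) = (\<Sum>j\<in>J. if j = \<lfloor>fst x / d\<rfloor> then u x else 0)"
      unfolding U_def by (intro sum.cong) auto
    then show ?thesis using J supp[of x] by auto
  qed
  have v: "vort v" unfolding v_def[abs_def] by (intro vort_sum J V)
  have ms_sum: "ms (\<lambda>x. \<Sum>j\<in>J. f j x) = (\<Sum>j\<in>J. ms (f j))"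
    and imp_sum: "imp (\<lambda>x. \<Sum>j\<in>J. f j x) = (\<Sum>j\<in>J. imp (f j))" if "\<And>j. vort (f j)" for f
    unfolding ms_def imp_def sum_distrib_left using vortD(1)[OF that] imp_integrable[OF that]
    by (auto intro!: Bochner_Integration.integral_sum)
  have sq_sum: "sq (\<lambda>x. \<Sum>j\<in>J. f j x) = (\<Sum>j\<in>J. sq (f j))"
    if f: "\<And>j. vort (f j)" and orth: "\<And>i j x. \<lbrakk>i \<in> J; j \<in> J; i \<noteq> j\<rbrakk> \<Longrightarrow> f i x * f j x = 0" for f
    unfolding sq_def using vortD(2)[OF f] orth
    by (simp add: sum_power2_orthogonal[OF J] Bochner_Integration.integral_sum)
  have v_eq: "v = (\<lambda>x. \<Sum>j\<in>J. V j x)" and u_eq: "u = (\<lambda>x. \<Sum>j\<in>J. U j x)"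
    using u_sum by (auto simp: v_def)
  show ?thesis
  proof (intro exI[of _ v] conjI)
    show "vort v" by (rule v)
    show "ms v = ms u" unfolding v_eq by (subst u_eq) (simp add: ms_sum U V T)
    show "imp v = imp u" unfolding v_eq by (subst u_eq) (simp add: imp_sum U V T)
    have "V i x * V j x = 0" if "i \<in> J" "j \<in> J" "i \<noteq> j" for i j x
      using V_slab[of i x] V_slab[of j x] \<phi>_inj[OF that]
      by (cases "V i x = 0"; cases "V j x = 0") simp_all
    moreover have "U i x * U j x = 0" if "i \<in> J" "j \<in> J" "i \<noteq> j" for i j x
      using that by (auto simp: U_def split: split_indicator)
    ultimately show "sq v = sq u" unfolding v_eq by (subst u_eq) (simp add: sq_sum U V T)
    have "form (U i) (U j) \<le> form (V i) (V j)" if ij: "i \<in> J" "j \<in> J" for i j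
      unfolding V_def[abs_def]
    proof (rule form_translate_mono[OF U sc U sc])
      fix x y assume "U j x \<noteq> 0" "U i y \<noteq> 0"
      then have j: "\<lfloor>fst x / d\<rfloor> = j" and i: "\<lfloor>fst y / d\<rfloor> = i" by (auto simp: U_def split: split_indicator_asm)
      define \<alpha> where "\<alpha> = frac (fst x / d)"
      define \<beta> where "\<beta> = frac (fst y / d)"
      have \<alpha>: "0 \<le> \<alpha>" "\<alpha> < 1" and \<beta>: "0 \<le> \<beta>" "\<beta> < 1" by (auto simp: \<alpha>_def \<beta>_def frac_lt_1)
      have x: "fst x = d * (of_int j + \<alpha>)" and y: "fst y = d * (of_int i + \<beta>)"
        using \<open>0 < d\<close> by (auto simp: \<alpha>_def \<beta>_def frac_def i j)
      have diff: "fst x - fst y = d * (of_int (j - i) + (\<alpha> - \<beta>))"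
        "fst (x - c j) - fst (y - c i) = d * (of_int (\<phi> j - \<phi> i) + (\<alpha> - \<beta>))"
        by (simp_all add: x y c_def algebra_simps)
      \<comment> \<open>For i < j the rank difference lies between 1 and j - i, while \<alpha> -
        \<beta> lies in (-1, 1). The signed distance therefore keeps its sign and never reaches 0,
        as \<open>gk_mono\<close> requires; for i = j nothing changes.\<close>
      have cmp: "\<bar>of_int (\<phi> j - \<phi> i) + (\<alpha> - \<beta>)\<bar> \<le> \<bar>of_int (j - i) + (\<alpha> - \<beta>)\<bar> \<and>
        (of_int (\<phi> j - \<phi> i) + (\<alpha> - \<beta>) = 0 \<longrightarrow> of_int (j - i) + (\<alpha> - \<beta>) = 0)"
      proof (cases i j rule: linorder_cases)
        case less
        then have "1 \<le> real_of_int (\<phi> j - \<phi> i)" "real_of_int (\<phi> j - \<phi> i) \<le> real_of_int (j - i)"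
          using \<phi>_less[OF ij(1) less] by (simp_all only: of_int_le_iff of_int_1_le_iff)
        then show ?thesis using \<alpha> \<beta> by linarith
      next
        case greater
        then have "1 \<le> real_of_int (\<phi> i - \<phi> j)" "real_of_int (\<phi> i - \<phi> j) \<le> real_of_int (i - j)"
          using \<phi>_less[OF ij(2) greater] by (simp_all only: of_int_le_iff of_int_1_le_iff)
        then show ?thesis using \<alpha> \<beta> by (simp only: of_int_diff) linarith
      qed simp
      show "gk x y \<le> gk (x - c j) (y - c i)"
      proof (rule gk_mono)
        show "\<bar>fst (x - c j) - fst (y - c i)\<bar> \<le> \<bar>fst x - fst y\<bar>"
          unfolding diff abs_mult using cmp \<open>0 < d\<close> by (intro mult_left_mono) auto
        assume "fst (x - c j) = fst (y - c i)"
        then have "fst (x - c j) - fst (y - c i) = 0" by simp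
        then have "fst x - fst y = 0" unfolding diff using cmp \<open>0 < d\<close> by auto
        then show "fst x = fst y" by simp
      qed (simp_all add: sc)
    qed
    then have "(\<Sum>i\<in>J. \<Sum>j\<in>J. form (U i) (U j)) \<le> (\<Sum>i\<in>J. \<Sum>j\<in>J. form (V i) (V j))"
      by (intro sum_mono)
    then show "form u u \<le> form v v"
      unfolding v_eq by (subst (1 2) u_eq) (simp add: form_sum J U V)
    show "\<forall>x. v x \<noteq> 0 \<longrightarrow> 0 \<le> \<lfloor>fst x / d\<rfloor> \<and> \<lfloor>fst x / d\<rfloor> < int (card J)"
    proof (intro allI impI)
      fix x assume nz: "v x \<noteq> 0"
      have "\<exists>j\<in>J. V j x \<noteq> 0"
      proof (rule ccontr)
        assume "\<not> (\<exists>j\<in>J. V j x \<noteq> 0)"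
        then have "v x = 0" unfolding v_def by (intro sum.neutral) auto
        with nz show False by simp
      qed
      then obtain j where "j \<in> J" "V j x \<noteq> 0" by blast
      then show "0 \<le> \<lfloor>fst x / d\<rfloor> \<and> \<lfloor>fst x / d\<rfloor> < int (card J)" using V_slab \<phi>_card by metis
    qed
  qed
qed

end

section \<open>Existence of a maximizer\<close>

context strip_domain
begin

lemma ms_mono: "ms v \<le> ms u" and imp_mono: "imp v \<le> imp u"
  if "vort u" "vort v" "\<And>x. v x \<le> u x"
proof -
  show "ms v \<le> ms u" unfolding ms_def using vortD(1) that by (intro integral_mono) auto
  have "snd x * v x \<le> snd x * u x" for x
    using that(3)[of x] vortD(4)[OF that(1), of x] vortD(4)[OF that(2), of x]
    by (cases "x \<in> strip L") (auto simp: strip_iff intro!: mult_left_mono)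
  then show "imp v \<le> imp u" unfolding imp_def using imp_integrable that by (intro integral_mono) auto
qed

text \<open>The direct method. On a set of finite measure in the strip, the constants and the height
  are integrable test functions, so the constraints pass to the weak limit; the energy converges,
  and the L^2 term has the favourable semicontinuity.\<close>

lemma maximizer_in_bounded_region:
  assumes lam: "0 < lam" and B: "0 \<le> B" and "0 \<le> \<nu>" "0 \<le> \<mu>"
    and A: "A \<in> sets borel" "A \<subseteq> strip L" "emeasure lborel A < \<infinity>"
  defines "K \<equiv> {u. vort u \<and> (\<forall>x. u x \<le> B) \<and> (\<forall>x. x \<notin> A \<longrightarrow> u x = 0) \<and> ms u \<le> \<nu> \<and> imp u \<le> \<mu>}"
  shows "\<exists>v\<in>K. \<forall>u\<in>K. fnl lam u \<le> fnl lam v"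
proof -
  have KD: "vort u" "u x \<le> B" "x \<notin> A \<Longrightarrow> u x = 0" "ms u \<le> \<nu>" "imp u \<le> \<mu>" if "u \<in> K" for u x
    using that by (simp_all add: K_def del: split_paired_All)
  have "(\<lambda>_. 0) \<in> K" using assms vort_zero by (auto simp: K_def ms_def imp_def)
  have bdd: "fnl lam u \<le> (gk_bound + B * \<nu>) / 2 * \<nu> / 2" if u: "u \<in> K" for u
  proof -
    have "(u x)\<^sup>2 \<le> B * u x" for x
      unfolding power2_eq_square by (intro mult_right_mono KD(2)[OF u] vortD(3)[OF KD(1)[OF u]])
    then have "sq u \<le> (\<integral>x. B * u x \<partial>lborel)"
      unfolding sq_def using vortD(1,2)[OF KD(1)[OF u]] by (intro integral_mono) auto
    also have "\<dots> = B * ms u" by (simp add: ms_def)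
    also have "\<dots> \<le> B * \<nu>" using KD(4)[OF u] B by (intro mult_left_mono)
    finally have "sq u \<le> B * \<nu>" .
    then have P: "pot u x \<le> (gk_bound + B * \<nu>) / 2" for x
      using pot_le[OF KD(1)[OF u], of 1 x] by simp
    have "form u u \<le> (\<integral>x. (gk_bound + B * \<nu>) / 2 * u x \<partial>lborel)"
      unfolding form_def
    proof (rule integral_mono)
      show "pot u x * u x \<le> (gk_bound + B * \<nu>) / 2 * u x" for x
        by (intro mult_right_mono P vortD(3)[OF KD(1)[OF u]])
    qed (use vortD(1)[OF KD(1)[OF u]] form_integrable[OF KD(1)[OF u] KD(1)[OF u]] in auto)
    also have "\<dots> = (gk_bound + B * \<nu>) / 2 * ms u" by (simp add: ms_def)
    also have "\<dots> \<le> (gk_bound + B * \<nu>) / 2 * \<nu>"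
      using KD(4)[OF u] gk_bound_nonneg B assms by (intro mult_left_mono) auto
    finally have "form u u \<le> (gk_bound + B * \<nu>) / 2 * \<nu>" .
    moreover have "0 \<le> 1 / (2 * lam) * sq u" using sq_nonneg lam by simp
    ultimately show ?thesis unfolding fnl_def by linarith
  qed
  define s where "s = (SUP u\<in>K. fnl lam u)"
  have bddK: "bdd_above (fnl lam ` K)" by (rule bdd_aboveI2[OF bdd])
  have s_upper: "fnl lam u \<le> s" if "u \<in> K" for u
    unfolding s_def using that bddK by (rule cSUP_upper)
  have "\<exists>u\<in>K. s - 1 / Suc n < fnl lam u" for n
  proof -
    have "s - 1 / Suc n < s" by simp
    then show ?thesis
      unfolding s_def using \<open>(\<lambda>_. 0) \<in> K\<close> bddK by (subst (asm) less_cSUP_iff) auto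
  qed
  then obtain w where w: "w n \<in> K" and wn: "s - 1 / Suc n < fnl lam (w n)" for n by metis
  have "(\<lambda>n. fnl lam (w n)) \<longlonglongrightarrow> s"
  proof (rule tendsto_sandwich)
    have "(\<lambda>n. s - 1 / real (Suc n)) \<longlonglongrightarrow> s - 0"
      by (intro tendsto_diff tendsto_const LIMSEQ_Suc[OF lim_1_over_n])
    then show "(\<lambda>n. s - 1 / real (Suc n)) \<longlonglongrightarrow> s" by simp
    show "\<forall>\<^sub>F n in sequentially. s - 1 / real (Suc n) \<le> fnl lam (w n)"
      by (intro always_eventually allI less_imp_le wn)
  qed (use s_upper w in auto)
  define M where "M = restrict_space lborel A"
  have sM: "space M = A" by (simp add: M_def space_restrict_space)
  interpret finite_measure M
    by (rule finite_measureI) (use A in \<open>simp add: M_def space_restrict_space emeasure_restrict_space\<close>)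
  interpret MM: pair_sigma_finite M M by standard
  have meas: "u \<in> borel_measurable M" if "u \<in> borel_measurable borel" for u :: "real \<times> real \<Rightarrow> real"
    unfolding M_def using that by (intro measurable_restrict_space1) auto
  have wm: "w n \<in> borel_measurable M" for n using meas vort_measurable KD(1)[OF w] by blast
  have w0: "0 \<le> w n x" for n x by (rule vortD(3)[OF KD(1)[OF w]])
  obtain H f where H: "H \<noteq> bot" "H \<le> sequentially" and fm: "f \<in> borel_measurable M"
    and f_range: "\<forall>t. 0 \<le> f t \<and> f t \<le> B"
    and conv: "\<forall>\<phi>. integrable M \<phi> \<longrightarrow> ((\<lambda>n. \<integral>t. \<phi> t * w n t \<partial>M) \<longlongrightarrow> (\<integral>t. \<phi> t * f t \<partial>M)) H"
    using weak_star_cluster_point[where w = w, OF finite_measure_axioms wm w0 KD(2)[OF w]] by blast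
  have f: "f \<in> borel_measurable M" "0 \<le> f t" "f t \<le> B" for t using fm f_range by blast+
  define v where "v x = indicator A x * f x" for x
  have vm: "v \<in> borel_measurable borel"
    using f(1) A borel_measurable_restrict_space_iff[of A lborel f] by (simp add: M_def v_def[abs_def])
  have fM: "v \<in> borel_measurable M" by (rule meas[OF vm])
  have v01: "0 \<le> v x" "v x \<le> B" and v_off: "x \<notin> A \<Longrightarrow> v x = 0" for x
    using f(2,3)[of x] B by (auto simp: v_def split: split_indicator)
  have iA: "integrable lborel (\<lambda>x. c * indicator A x :: real)" for c
    using A by (intro integrable_mult_right integrable_real_indicator) auto
  have v: "vort v"
    unfolding vort_def
  proof (intro conjI allI impI)
    show "integrable lborel v"
      by (rule Bochner_Integration.integrable_bound[OF iA[of B]])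
        (use vm v01 v_off in \<open>auto split: split_indicator simp: B\<close>)
    have "(v x)\<^sup>2 \<le> B\<^sup>2 * indicator A x" for x
      using v01[of x] v_off[of x] by (auto split: split_indicator intro!: power_mono)
    then show "integrable lborel (\<lambda>x. (v x)\<^sup>2)"
      by (intro Bochner_Integration.integrable_bound[OF iA[of "B\<^sup>2"]]) (use vm in auto)
    show "v x = 0" if "x \<notin> strip L" for x using that A(2) by (intro v_off) blast
  qed (rule v01)
  have toM: "(\<integral>x. \<phi> x * u x \<partial>M) = (\<integral>x. \<phi> x * u x \<partial>lborel)" if "\<And>x. x \<notin> A \<Longrightarrow> u x = 0"
    for \<phi> u :: "real \<times> real \<Rightarrow> real"
  proof -
    have "indicator A x *\<^sub>R (\<phi> x * u x) = \<phi> x * u x" for x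
      using that[of x] by (cases "x \<in> A") auto
    moreover have "(\<integral>x. \<phi> x * u x \<partial>M) = (\<integral>x. indicator A x *\<^sub>R (\<phi> x * u x) \<partial>lborel)"
      unfolding M_def using A(1) by (intro integral_restrict_space) simp
    ultimately show ?thesis by (simp only:)
  qed
  have "(\<integral>x. \<phi> x * f x \<partial>M) = (\<integral>x. \<phi> x * v x \<partial>M)" for \<phi>
    by (intro Bochner_Integration.integral_cong) (auto simp: sM v_def)
  then have convM: "((\<lambda>n. \<integral>t. \<phi> t * w n t \<partial>M) \<longlongrightarrow> (\<integral>t. \<phi> t * v t \<partial>M)) H" if "integrable M \<phi>" for \<phi>
    using conv that by simp
  then have convL: "((\<lambda>n. \<integral>t. \<phi> t * w n t \<partial>lborel) \<longlongrightarrow> (\<integral>t. \<phi> t * v t \<partial>lborel)) H" if "integrable M \<phi>" for \<phi>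
    using that toM KD(3)[OF w] v_off by simp
  have "((\<lambda>n. ms (w n)) \<longlongrightarrow> ms v) H"
    using convL[of "\<lambda>_. 1"] by (simp add: ms_def)
  then have "ms v \<le> \<nu>" by (rule tendsto_upperbound) (use H KD(4)[OF w] in auto)
  have "integrable M snd"
  proof (rule integrable_const_bound[of _ L])
    show "AE x in M. norm (snd x) \<le> L" using A by (intro AE_I2) (auto simp: sM strip_iff)
  qed (rule meas, measurable)
  from convL[OF this] have "((\<lambda>n. imp (w n)) \<longlongrightarrow> imp v) H" by (simp add: imp_def)
  then have "imp v \<le> \<mu>" by (rule tendsto_upperbound) (use H KD(5)[OF w] in auto)
  have vK: "v \<in> K"
    using v v01 v_off \<open>ms v \<le> \<nu>\<close> \<open>imp v \<le> \<mu>\<close> by (simp add: K_def del: split_paired_All)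
  have "integrable M v" by (rule integrable_const_bound[of _ B]) (use fM v01 in auto)
  from convL[OF this] have conv_sq: "((\<lambda>n. \<integral>x. v x * w n x \<partial>lborel) \<longlongrightarrow> sq v) H"
    by (simp add: sq_def power2_eq_square)
  have proj [measurable]: "fst \<in> borel_measurable (M \<Otimes>\<^sub>M M)" "snd \<in> borel_measurable (M \<Otimes>\<^sub>M M)"
  proof -
    have "(\<lambda>x. x) \<in> borel_measurable M" unfolding M_def by (intro measurable_restrict_space1) auto
    from measurable_compose[OF measurable_fst this] measurable_compose[OF measurable_snd this]
    show "fst \<in> borel_measurable (M \<Otimes>\<^sub>M M)" "snd \<in> borel_measurable (M \<Otimes>\<^sub>M M)" by auto
  qed
  have gk_M: "integrable M (gk x)" "(\<integral>y. gk x y \<partial>M) \<le> gk_bound + measure M A" for x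
  proof -
    have sqi: "integrable M (\<lambda>y. (gk x y)\<^sup>2)"
      unfolding M_def using A(1) gk_square_integrable(1)[of x]
        integrable_mult_indicator[of A lborel "\<lambda>y. (gk x y)\<^sup>2"]
      by (subst integrable_restrict_space) simp_all
    \<comment> \<open>On a set of finite measure this turns the uniform L^2 bound on the rows of the
      kernel into a uniform L^1 bound, as needed for integrability on the product.\<close>
    have le: "gk x y \<le> (gk x y)\<^sup>2 + 1" for y
      using sum_squares_bound[of "gk x y" 1] gk_nonneg[of x y] by simp
    show i: "integrable M (gk x)"
    proof (rule Bochner_Integration.integrable_bound)
      show "integrable M (\<lambda>y. (gk x y)\<^sup>2 + 1)" using sqi by auto
      show "gk x \<in> borel_measurable M" by (rule meas) measurable
    qed (use le gk_nonneg in auto)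
    have "(\<integral>y. gk x y \<partial>M) \<le> (\<integral>y. (gk x y)\<^sup>2 + 1 \<partial>M)"
      using i sqi le by (intro integral_mono) auto
    also have "\<dots> = (\<integral>y. (gk x y)\<^sup>2 \<partial>M) + measure M A" using sqi by (simp add: sM)
    also have "(\<integral>y. (gk x y)\<^sup>2 \<partial>M) \<le> (\<integral>y. (gk x y)\<^sup>2 \<partial>lborel)"
    proof -
      have "(\<integral>y. (gk x y)\<^sup>2 \<partial>M) = (\<integral>y. indicator A y * (gk x y)\<^sup>2 \<partial>lborel)"
        unfolding M_def using A(1) by (subst integral_restrict_space) simp_all
      also have "\<dots> \<le> (\<integral>y. (gk x y)\<^sup>2 \<partial>lborel)"
      proof (rule integral_mono)
        show "integrable lborel (\<lambda>y. indicator A y * (gk x y)\<^sup>2)"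
          using A gk_square_integrable(1)[of x] integrable_mult_indicator[of A lborel "\<lambda>y. (gk x y)\<^sup>2"] by simp
      qed (use gk_square_integrable in \<open>auto split: split_indicator\<close>)
      finally show ?thesis .
    qed
    finally show "(\<integral>y. gk x y \<partial>M) \<le> gk_bound + measure M A" using gk_square_integrable(2)[of x] by simp
  qed
  have gkMM: "integrable (M \<Otimes>\<^sub>M M) (\<lambda>z. gk (fst z) (snd z))"
  proof (rule MM.Fubini_integrable)
    show "(\<lambda>z. gk (fst z) (snd z)) \<in> borel_measurable (M \<Otimes>\<^sub>M M)" by measurable
    show "integrable M (\<lambda>x. \<integral>y. norm (gk (fst (x, y)) (snd (x, y))) \<partial>M)"
    proof (rule integrable_const_bound[of _ "gk_bound + measure M A"])
      show "AE x in M. norm (\<integral>y. norm (gk (fst (x, y)) (snd (x, y))) \<partial>M) \<le> gk_bound + measure M A"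
        using gk_M(2) gk_nonneg by (auto simp: integral_nonneg_AE)
      show "(\<lambda>x. \<integral>y. norm (gk (fst (x, y)) (snd (x, y))) \<partial>M) \<in> borel_measurable M"
      proof (rule borel_measurable_lebesgue_integral)
        have "(\<lambda>z. norm (gk (fst z) (snd z))) \<in> borel_measurable (M \<Otimes>\<^sub>M M)" by measurable
        then show "(\<lambda>(x, y). norm (gk (fst (x, y)) (snd (x, y)))) \<in> borel_measurable (M \<Otimes>\<^sub>M M)"
          by (simp add: case_prod_unfold)
      qed
    qed
  qed (use gk_M in auto)
  have form_M: "form u u = (\<integral>z. gk (fst z) (snd z) * (u (fst z) * u (snd z)) \<partial>(M \<Otimes>\<^sub>M M))" if u: "u \<in> K" for u
  proof -
    have [measurable]: "u \<in> borel_measurable M" using meas vort_measurable KD(1)[OF u] by blast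
    have u0: "0 \<le> u x" for x by (rule vortD(3)[OF KD(1)[OF u]])
    have "integrable (M \<Otimes>\<^sub>M M) (\<lambda>z. gk (fst z) (snd z) * (u (fst z) * u (snd z)))"
    proof (rule integrable_mult_bounded_nonneg[OF gkMM])
      show "u (fst z) * u (snd z) \<le> B * B" for z using KD(2)[OF u] u0 B by (intro mult_mono) auto
    qed (use u0 in auto)
    from MM.integral_fst'[OF this]
    have "(\<integral>z. gk (fst z) (snd z) * (u (fst z) * u (snd z)) \<partial>(M \<Otimes>\<^sub>M M))
        = (\<integral>x. (\<integral>y. gk x y * (u x * u y) \<partial>M) \<partial>M)" by simp
    also have "\<dots> = (\<integral>x. (\<integral>y. gk x y * u y \<partial>M) * u x \<partial>M)"
      by (simp add: mult_ac flip: integral_mult_left_zero)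
    also have "\<dots> = form u u"
      using toM[of u, OF KD(3)[OF u]] by (simp add: form_def pot_def)
    finally show ?thesis by simp
  qed
  have conv_form: "((\<lambda>n. form (w n) (w n)) \<longlongrightarrow> form v v) H"
    unfolding form_M[OF w] form_M[OF vK]
    by (rule weak_convergence_tensor[OF finite_measure_axioms wm fM w0 KD(2)[OF w] v01 convM gkMM])
  have "s \<le> fnl lam v"
  proof (rule tendsto_le[OF H(1)])
    show "((\<lambda>n. fnl lam (w n)) \<longlongrightarrow> s) H"
      using \<open>(\<lambda>n. fnl lam (w n)) \<longlonglongrightarrow> s\<close> H(2) by (rule tendsto_mono[rotated])
    \<comment> \<open>The square of w_n is replaced by its tangent at v, using 2 v w \<le> v^2 +
      w^2. The result is linear in w_n, bounds F(w_n) from above and converges exactly to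
      F(v).\<close>
    have "((\<lambda>n. 1 / 2 * form (w n) (w n) - 1 / (2 * lam) * (2 * (\<integral>x. v x * w n x \<partial>lborel) - sq v))
        \<longlongrightarrow> 1 / 2 * form v v - 1 / (2 * lam) * (2 * sq v - sq v)) H"
      by (intro tendsto_intros conv_form conv_sq)
    then show "((\<lambda>n. 1 / 2 * form (w n) (w n) - 1 / (2 * lam) * (2 * (\<integral>x. v x * w n x \<partial>lborel) - sq v))
        \<longlongrightarrow> fnl lam v) H"
      by (simp add: fnl_def)
    show "eventually (\<lambda>n. fnl lam (w n) \<le> 1 / 2 * form (w n) (w n)
        - 1 / (2 * lam) * (2 * (\<integral>x. v x * w n x \<partial>lborel) - sq v)) H"
    proof (intro always_eventually allI)
      fix n
      have wn: "vort (w n)" by (rule KD(1)[OF w])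
      have "2 * (\<integral>x. v x * w n x \<partial>lborel) - sq v = (\<integral>x. 2 * (v x * w n x) - (v x)\<^sup>2 \<partial>lborel)"
        unfolding sq_def using vort_mult_integrable[OF v wn] vortD(2)[OF v] by simp
      also have "\<dots> \<le> sq (w n)"
        unfolding sq_def
      proof (rule integral_mono)
        show "2 * (v x * w n x) - (v x)\<^sup>2 \<le> (w n x)\<^sup>2" for x
          using sum_squares_bound[of "v x" "w n x"] by simp
      qed (use vort_mult_integrable[OF v wn] vortD(2)[OF v] vortD(2)[OF wn] in auto)
      finally show "fnl lam (w n) \<le> 1 / 2 * form (w n) (w n)
        - 1 / (2 * lam) * (2 * (\<integral>x. v x * w n x \<partial>lborel) - sq v)"
        unfolding fnl_def using lam by (intro diff_left_mono mult_left_mono) auto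
    qed
  qed
  with vK s_upper show ?thesis by (meson order_trans)
qed

text \<open>The height bound comes from \<open>pot_le_uniform\<close> and depends on u only through
  \<nu>. As v \<le> u pointwise, mass and impulse do not increase and the support does not
  grow.\<close>

lemma truncate_admissible:
  assumes u: "vort u" and "0 < lam" "0 < \<nu>" "ms u \<le> \<nu>" "imp u \<le> \<mu>" "0 \<le> fnl lam u"
  defines "v \<equiv> \<lambda>x. min (u x) (lam * pot u x)"
  shows "vort v" "v x \<le> lam * (lam * \<nu> * gk_bound)" "ms v \<le> \<nu>" "imp v \<le> \<mu>" "fnl lam u \<le> fnl lam v" "u x = 0 \<Longrightarrow> v x = 0"
proof -
  show v: "vort v" and "fnl lam u \<le> fnl lam v"
    unfolding v_def using fnl_truncate[OF u] assms by auto
  have "pot u x \<le> lam * \<nu> * gk_bound" by (rule pot_le_uniform) (use assms in auto)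
  then have "lam * pot u x \<le> lam * (lam * \<nu> * gk_bound)" using assms by (intro mult_left_mono) auto
  then show "v x \<le> lam * (lam * \<nu> * gk_bound)" by (simp add: v_def)
  show "ms v \<le> \<nu>" "imp v \<le> \<mu>"
    using ms_mono[OF u v] imp_mono[OF u v] assms by (auto simp: v_def)
  show "v x = 0" if "u x = 0" using that vortD(3)[OF v, of x] by (auto simp: v_def min_def split: if_splits)
qed

lemma maximizer_exists:
  assumes lam: "0 < lam" and \<nu>: "0 < \<nu>" and \<mu>: "0 < \<mu>"
    and u0: "vort u0" "ms u0 \<le> \<nu>" "imp u0 \<le> \<mu>" "0 < fnl lam u0"
  shows "\<exists>v R. vort v \<and> ms v \<le> \<nu> \<and> imp v \<le> \<mu> \<and> 0 < fnl lam v \<and> (\<forall>x. v x \<noteq> 0 \<longrightarrow> 0 \<le> fst x \<and> fst x \<le> R) \<and>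
    (\<forall>u. vort u \<longrightarrow> ms u \<le> \<nu> \<longrightarrow> imp u \<le> \<mu> \<longrightarrow> fnl lam u \<le> fnl lam v)"
proof -
  define B where "B = lam * (lam * \<nu> * gk_bound)"
  have "0 \<le> B" using lam \<nu> gk_bound_nonneg by (simp add: B_def)
  \<comment> \<open>A positive threshold for F, needed to fix the slab width and the number of
    slabs. Competitors below it are dominated anyway, since the maximizer found in the box satisfies
    F \<ge> e.\<close>
  define e where "e = fnl lam u0"
  obtain d N where "0 < d" and heavy: "\<forall>u. vort u \<longrightarrow> (\<forall>y. u y \<le> B) \<longrightarrow> ms u \<le> \<nu> \<longrightarrow> imp u \<le> \<mu> \<longrightarrow> e \<le> fnl lam u \<longrightarrow>
      (\<exists>v J. vort v \<and> ms v \<le> \<nu> \<and> imp v \<le> \<mu> \<and> fnl lam u \<le> fnl lam v \<and> finite J \<and> card J \<le> N \<and>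
        (\<forall>x. v x \<noteq> 0 \<longrightarrow> \<lfloor>fst x / d\<rfloor> \<in> J))"
    using keep_heavy_slabs[OF lam \<nu> \<mu> \<open>0 \<le> B\<close>, of e] u0(4) unfolding e_def by blast
  \<comment> \<open>At most N slabs survive, and compression numbers them from 0, so they fit into
    abscissae between 0 and d N.\<close>
  define R where "R = d * real N"
  define A where "A = {0..R} \<times> {0<..<L}"
  have A: "A \<in> sets borel" "A \<subseteq> strip L" by (auto simp: A_def strip_def borel_Times)
  have fA: "emeasure lborel A < \<infinity>"
  proof -
    have "emeasure lborel A = emeasure (lborel \<Otimes>\<^sub>M lborel) A" by (simp add: lborel_prod)
    also have "\<dots> = emeasure lborel {0..R} * emeasure lborel {0<..<L}"
      unfolding A_def by (rule lborel.emeasure_pair_measure_Times) auto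
    also have "\<dots> < \<infinity>" using L_pos \<open>0 < d\<close> by (simp add: R_def ennreal_mult_less_top)
    finally show ?thesis .
  qed
  define K where "K = {u. vort u \<and> (\<forall>x. u x \<le> B) \<and> (\<forall>x. x \<notin> A \<longrightarrow> u x = 0) \<and> ms u \<le> \<nu> \<and> imp u \<le> \<mu>}"
  obtain v where v: "v \<in> K" and max: "\<And>u. u \<in> K \<Longrightarrow> fnl lam u \<le> fnl lam v"
    using maximizer_in_bounded_region[OF lam \<open>0 \<le> B\<close> less_imp_le[OF \<nu>] less_imp_le[OF \<mu>] A fA] unfolding K_def by blast
  have step: "fnl lam u \<le> fnl lam v" if u: "vort u" "ms u \<le> \<nu>" "imp u \<le> \<mu>" and ge: "e \<le> fnl lam u" for u
  proof -
    have "0 < e" using u0 by (simp add: e_def)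
    define u1 where "u1 = (\<lambda>x. min (u x) (lam * pot u x))"
    have u1: "vort u1" "u1 x \<le> B" "ms u1 \<le> \<nu>" "imp u1 \<le> \<mu>" "fnl lam u \<le> fnl lam u1" for x
      unfolding u1_def B_def using truncate_admissible[OF u(1) lam \<nu> u(2,3)] ge \<open>0 < e\<close> by auto
    have "e \<le> fnl lam u1" using u1(5) ge by linarith
    then obtain u2 J where u2: "vort u2" "ms u2 \<le> \<nu>" "imp u2 \<le> \<mu>" "fnl lam u1 \<le> fnl lam u2"
      and J: "finite J" "card J \<le> N" and supp: "\<forall>x. u2 x \<noteq> 0 \<longrightarrow> \<lfloor>fst x / d\<rfloor> \<in> J"
      using heavy[rule_format, of u1] u1 by blast
    obtain u3 where u3: "vort u3" "ms u3 = ms u2" "imp u3 = imp u2" "sq u3 = sq u2" "form u2 u2 \<le> form u3 u3"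
      and s3: "\<forall>x. u3 x \<noteq> 0 \<longrightarrow> 0 \<le> \<lfloor>fst x / d\<rfloor> \<and> \<lfloor>fst x / d\<rfloor> < int (card J)"
      using compress_slabs[OF u2(1) J(1) \<open>0 < d\<close>] supp by blast
    have f3: "fnl lam u2 \<le> fnl lam u3" unfolding fnl_def using u3 by simp
    \<comment> \<open>The rescaling behind \<open>u2\<close> may have broken the bound B; truncating
      again restores it and keeps the support inside the compressed slabs.\<close>
    define u4 where "u4 = (\<lambda>x. min (u3 x) (lam * pot u3 x))"
    have u4: "vort u4" "u4 x \<le> B" "ms u4 \<le> \<nu>" "imp u4 \<le> \<mu>" "fnl lam u3 \<le> fnl lam u4" "u3 x = 0 \<Longrightarrow> u4 x = 0" for x
      unfolding u4_def B_def
      using truncate_admissible[OF u3(1) lam \<nu>, of \<mu>] u3 u2 f3 \<open>e \<le> fnl lam u1\<close> \<open>0 < e\<close> by auto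
    have "u4 x = 0" if "x \<notin> A" for x
    proof (cases "x \<in> strip L")
      case True
      have "u3 x = 0"
      proof (rule ccontr)
        assume "u3 x \<noteq> 0"
        from s3[rule_format, OF this] have "0 \<le> fst x / d" "\<lfloor>fst x / d\<rfloor> < int N" using J(2) by auto
        then have "0 \<le> fst x / d" "fst x / d < real N" by (auto simp: floor_less_iff)
        then have "0 \<le> fst x" "fst x \<le> R" using \<open>0 < d\<close> by (auto simp: R_def field_simps)
        then have "x \<in> A" using True by (cases x) (auto simp: A_def strip_iff)
        with that show False by simp
      qed
      then show ?thesis by (rule u4(6))
    qed (rule vortD(4)[OF u4(1)])
    then have "u4 \<in> K" using u4 by (simp add: K_def del: split_paired_All)
    from max[OF this] show ?thesis using u1(5) u2(4) f3 u4(5) by linarith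
  qed
  have "e \<le> fnl lam v" using step[OF u0(1-3)] by (simp add: e_def)
  have "fnl lam u \<le> fnl lam v" if u: "vort u" "ms u \<le> \<nu>" "imp u \<le> \<mu>" for u
    using step[OF u] \<open>e \<le> fnl lam v\<close> by linarith
  moreover have "0 \<le> fst x \<and> fst x \<le> R" if "v x \<noteq> 0" for x
  proof -
    have "x \<in> A" using v that unfolding K_def by blast
    then show ?thesis by (auto simp: A_def)
  qed
  moreover have "vort v" "ms v \<le> \<nu>" "imp v \<le> \<mu>" using v unfolding K_def by blast+
  moreover have "0 < fnl lam v" using \<open>e \<le> fnl lam v\<close> u0 by (simp add: e_def)
  ultimately show ?thesis by blast
qed

end

section \<open>Positivity of the maximum\<close>

text \<open>By cosh(6/5) = 1 + 2 sinh(3/5)^2 the claim is cosh(6/5) \<le> 2, that is (z - 2)^2 \<le>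
  3 for z = exp(6/5). Since 1.7^2 = 2.89, it suffices that z \<le> 3.7.\<close>

lemma sinh_square_le_half: "(sinh (3 / 5 :: real))\<^sup>2 \<le> 1 / 2"
proof -
  define z where "z = exp (6 / 5 :: real)"
  have "1 \<le> z" by (simp add: z_def)
  \<comment> \<open>The sixth root brings the argument to 1/5, where the quadratic bound on exp is
    sharp enough: 1.24^6 < 3.7.\<close>
  have "z = exp (1 / 5) ^ 6" unfolding z_def by (simp flip: exp_of_nat_mult)
  also have "\<dots> \<le> (1 + 1 / 5 + (1 / 5)\<^sup>2) ^ 6"
    using exp_bound[of "1 / 5"] by (intro power_mono) auto
  also have "\<dots> \<le> 3.7" by (simp add: power2_eq_square eval_nat_numeral)
  finally have "\<bar>z - 2\<bar> \<le> 1.7" using \<open>1 \<le> z\<close> by (intro abs_leI) simp_all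
  then have "(z - 2)\<^sup>2 \<le> 1.7\<^sup>2" by (metis abs_ge_zero power2_abs power_mono)
  then have "z + 1 / z \<le> 4" using \<open>1 \<le> z\<close> by (simp add: field_simps power2_eq_square)
  then have "cosh (6 / 5 :: real) \<le> 2"
    by (simp add: cosh_field_def z_def exp_minus inverse_eq_divide)
  moreover have "cosh (6 / 5 :: real) = 1 + 2 * (sinh (3 / 5))\<^sup>2"
    using cosh_double[of "3 / 5 :: real"] cosh_square_eq[of "3 / 5 :: real"] by simp
  ultimately show ?thesis by simp
qed

context strip_domain
begin

text \<open>
  On the box below the argument of the logarithm is at least \<open>2\<close>: the numerator is at least
  \<open>sin (\<pi>/3)\<^sup>2 = 3/4\<close>, the denominator at most \<open>sinh (3/5)\<^sup>2 + sin (\<pi>/6)\<^sup>2 \<le> 3/4\<close>.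
\<close>

definition test_box :: "(real \<times> real) set" where
  "test_box = {0..6 / 5 * L / pi} \<times> {L / 3..2 * L / 3}"

lemma gk_ge_on_test_box:
  assumes x: "x \<in> test_box" and y: "y \<in> test_box" and ne: "fst x \<noteq> fst y"
  shows "ln 2 / (4 * pi) \<le> gk x y"
proof -
  have strip: "x \<in> strip L" "y \<in> strip L"
    using x y L_pos by (auto simp: test_box_def strip_iff)
  have sin_ge: "sqrt 3 / 2 \<le> sin (pi / L * snd z)" if "z \<in> test_box" for z
  proof -
    have "pi / L * (L / 3) \<le> pi / L * snd z" "pi / L * snd z \<le> pi / L * (2 * L / 3)"
      using that L_pos by (intro mult_left_mono; auto simp: test_box_def)+
    moreover have "pi / L * (L / 3) = pi / 3" "pi / L * (2 * L / 3) = 2 * pi / 3" using L_pos by simp_all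
    ultimately have "\<bar>pi / 2 - pi / L * snd z\<bar> \<le> pi / 6" unfolding abs_le_iff by linarith
    then have "cos (pi / 6) \<le> cos \<bar>pi / 2 - pi / L * snd z\<bar>"
      by (intro cos_monotone_0_pi_le) auto
    then show ?thesis by (simp add: cos_30 sin_cos_eq)
  qed
  have "sqrt 3 / 2 * (sqrt 3 / 2) \<le> sin (pi / L * snd x) * sin (pi / L * snd y)"
    using sin_ge[OF x] sin_ge[OF y] sin_strip[OF strip(1)] by (intro mult_mono) auto
  then have num: "3 / 4 \<le> sin (pi / L * snd x) * sin (pi / L * snd y)" by simp
  have "\<bar>snd x - snd y\<bar> \<le> L / 3" using x y by (intro abs_leI) (auto simp: test_box_def)
  then have "pi / (2 * L) * \<bar>snd x - snd y\<bar> \<le> pi / (2 * L) * (L / 3)"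
    using L_pos by (intro mult_left_mono) auto
  also have "\<dots> = pi / 6" using L_pos by simp
  finally have "\<bar>pi / (2 * L) * (snd x - snd y)\<bar> \<le> pi / 6" using L_pos by (simp add: abs_mult)
  then have z: "- (pi / 6) \<le> pi / (2 * L) * (snd x - snd y)" "pi / (2 * L) * (snd x - snd y) \<le> pi / 6"
    by (simp_all only: abs_le_iff minus_le_iff)
  have "sin (- (pi / 6)) \<le> Sn (snd x - snd y)"
    unfolding Sn_def using z pi_gt_zero by (intro sin_monotone_2pi_le) linarith+
  moreover have "Sn (snd x - snd y) \<le> sin (pi / 6)"
    unfolding Sn_def using z pi_gt_zero by (intro sin_monotone_2pi_le) linarith+
  ultimately have "\<bar>Sn (snd x - snd y)\<bar> \<le> 1 / 2" by (simp add: sin_30 abs_le_iff)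
  then have "(Sn (snd x - snd y))\<^sup>2 \<le> (1 / 2)\<^sup>2" by (metis abs_ge_zero power2_abs power_mono)
  then have sn: "(Sn (snd x - snd y))\<^sup>2 \<le> 1 / 4" by (simp add: power2_eq_square)
  have "\<bar>fst x - fst y\<bar> \<le> 6 / 5 * L / pi" using x y by (intro abs_leI) (auto simp: test_box_def)
  then have "pi / (2 * L) * \<bar>fst x - fst y\<bar> \<le> pi / (2 * L) * (6 / 5 * L / pi)"
    using L_pos by (intro mult_left_mono) auto
  also have "\<dots> = 3 / 5" using L_pos by (simp add: field_simps)
  finally have "sinh (pi / (2 * L) * \<bar>fst x - fst y\<bar>) \<le> sinh (3 / 5)" by (subst sinh_real_le_iff)
  moreover have "\<bar>Sh (fst x - fst y)\<bar> = sinh (pi / (2 * L) * \<bar>fst x - fst y\<bar>)"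
    using L_pos by (simp add: Sh_def abs_mult flip: sinh_real_abs)
  ultimately have "(Sh (fst x - fst y))\<^sup>2 \<le> (sinh (3 / 5))\<^sup>2" by (metis abs_ge_zero power2_abs power_mono)
  then have den: "(Sh (fst x - fst y))\<^sup>2 + (Sn (snd x - snd y))\<^sup>2 \<le> 3 / 4"
    using sn sinh_square_le_half by linarith
  have "3 / 4 / (3 / 4) \<le> sin (pi / L * snd x) * sin (pi / L * snd y) /
      ((Sh (fst x - fst y))\<^sup>2 + (Sn (snd x - snd y))\<^sup>2)"
    using num den ne by (intro frac_le denom_pos) auto
  then have "ln 2 \<le> ln (1 + sin (pi / L * snd x) * sin (pi / L * snd y) /
      ((Sh (fst x - fst y))\<^sup>2 + (Sn (snd x - snd y))\<^sup>2))"
    by (subst ln_le_cancel_iff) auto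
  then have "1 / (4 * pi) * ln 2 \<le> 1 / (4 * pi) * ln (1 + sin (pi / L * snd x) * sin (pi / L * snd y) /
      ((Sh (fst x - fst y))\<^sup>2 + (Sn (snd x - snd y))\<^sup>2))"
    by (intro mult_left_mono) auto
  then show ?thesis using strip by (simp add: gk_def green_eq)
qed

text \<open>The indicator of \<open>test_box\<close>, of area a, has form at least k a^2 and squared
  L^2 norm a, so F is positive as soon as 1/\<lambda> < k a. Scaling then meets the constraints
  without changing the sign.\<close>

lemma positive_functional:
  assumes lam: "lam > pi ^ 5 / (2 * L\<^sup>2)" and "0 < \<nu>" "0 < \<mu>"
  shows "\<exists>u. vort u \<and> ms u \<le> \<nu> \<and> imp u \<le> \<mu> \<and> 0 < fnl lam u"
proof -
  define a where "a = 2 * L\<^sup>2 / (5 * pi)"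
  have "0 < a" using L_pos by (simp add: a_def)
  have "0 < pi ^ 5 / (2 * L\<^sup>2)" using L_pos by simp
  with lam have "0 < lam" by linarith
  define p where "p = (indicator {0..6 / 5 * L / pi} :: real \<Rightarrow> real)"
  define q where "q = (indicator {L / 3..2 * L / 3} :: real \<Rightarrow> real)"
  define u where "u = (indicator test_box :: real \<times> real \<Rightarrow> real)"
  have p: "integrable lborel p" "(\<integral>s. p s \<partial>lborel) = 6 / 5 * L / pi"
    and q: "integrable lborel q" "(\<integral>s. q s \<partial>lborel) = L / 3"
    unfolding p_def q_def using L_pos by (auto intro!: integrable_real_indicator)
  have u_eq: "u = (\<lambda>y. p (fst y) * q (snd y))"
    by (auto simp: u_def p_def q_def test_box_def split: split_indicator)
  have ui: "integrable lborel u" "(\<integral>y. u y \<partial>lborel) = a"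
    unfolding u_eq using integral_tensor[OF p(1) q(1)] p(2) q(2) by (auto simp: a_def power2_eq_square)
  have u2: "(u y)\<^sup>2 = u y" for y by (simp add: u_def split: split_indicator)
  have u: "vort u"
    unfolding vort_def u2 using ui L_pos by (auto simp: u_def test_box_def strip_iff split: split_indicator)
  have ms_u: "ms u = a" "sq u = a" using ui by (simp_all add: ms_def sq_def u2)
  define k where "k = ln 2 / (4 * pi)"
  have pot_ge: "k * a \<le> pot u x" if x: "x \<in> test_box" for x
  proof -
    have "AE y in (lborel :: (real \<times> real) measure). fst y \<noteq> fst x" by (rule AE_lborel_fst[OF AE_lborel_singleton])
    then have "AE y in lborel. k * u y \<le> gk x y * u y"
      by eventually_elim (use gk_ge_on_test_box[OF x] in \<open>auto simp: u_def k_def split: split_indicator\<close>)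
    then have "(\<integral>y. k * u y \<partial>lborel) \<le> pot u x"
      unfolding pot_def using ui gk_mult_integrable[OF u] by (intro integral_mono_AE) auto
    then show ?thesis using ui by simp
  qed
  have "(\<integral>x. k * a * u x \<partial>lborel) \<le> form u u"
    unfolding form_def
  proof (rule integral_mono)
    show "k * a * u x \<le> pot u x * u x" for x using pot_ge[of x] by (auto simp: u_def split: split_indicator)
  qed (use ui form_integrable[OF u u] in auto)
  then have "k * a * a \<le> form u u" using ui by simp
  moreover have "1 / lam < k * a"
  \<comment> \<open>With \<pi>^3 \<ge> 30 the hypothesis gives 1/\<lambda> < L^2/(15 \<pi>^2), and
    with ln 2 \<ge> 2/3 the product k a is at least exactly this value.\<close>
  proof -
    have "30 \<le> (3.14 :: real) ^ 3" by (simp add: eval_nat_numeral)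
    also have "3.14 ^ 3 \<le> pi ^ 3" using pi_approx by (intro power_mono) auto
    finally have pi3: "30 \<le> pi ^ 3" .
    have "1 / lam < 1 / (pi ^ 5 / (2 * L\<^sup>2))"
      using lam L_pos \<open>0 < lam\<close> by (intro divide_strict_left_mono) auto
    also have "\<dots> = 2 * L\<^sup>2 / (pi\<^sup>2 * pi ^ 3)" by (simp flip: power_add)
    also have "\<dots> \<le> 2 * L\<^sup>2 / (pi\<^sup>2 * 30)"
      using pi3 by (intro divide_left_mono mult_left_mono) auto
    also have "\<dots> = 2 / 3 / (4 * pi) * a" by (simp add: a_def power2_eq_square)
    also have "\<dots> \<le> k * a"
      unfolding k_def using ln2_ge_two_thirds \<open>0 < a\<close> by (intro mult_right_mono divide_right_mono) auto
    finally show ?thesis .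
  qed
  then have "1 / lam * a < k * a * a" using \<open>0 < a\<close> by (intro mult_strict_right_mono)
  moreover have "fnl lam u = 1 / 2 * (form u u - 1 / lam * a)"
    unfolding fnl_def ms_u by (simp add: algebra_simps)
  ultimately have pos: "0 < fnl lam u" by simp
  \<comment> \<open>The second entry uses that the impulse is at most L times the mass.\<close>
  define t where "t = min (\<nu> / a) (\<mu> / (L * a))"
  have "0 < t" using assms \<open>0 < a\<close> L_pos by (simp add: t_def)
  have "t * a \<le> \<nu> / a * a" "t * a \<le> \<mu> / (L * a) * a"
    unfolding t_def using \<open>0 < a\<close> by (intro mult_right_mono; simp)+
  then have ta: "t * a \<le> \<nu>" "L * (t * a) \<le> \<mu>" using \<open>0 < a\<close> L_pos by (auto simp: field_simps)
  have tu: "vort (\<lambda>x. t * u x)" using \<open>0 < t\<close> by (intro vort_cmult u) auto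
  have "ms (\<lambda>x. t * u x) \<le> \<nu>" using ta by (simp add: ms_cmult ms_u)
  moreover have "imp (\<lambda>x. t * u x) \<le> \<mu>"
    using imp_le_ms[OF tu] ta by (simp add: ms_cmult ms_u)
  moreover have "0 < fnl lam (\<lambda>x. t * u x)" using pos \<open>0 < t\<close> by (simp add: fnl_cmult)
  ultimately show ?thesis using tu by blast
qed

section \<open>Passage between almost-everywhere classes on the strip and normalized
  vorticities\<close>

lemma vort_of_AE_nonneg:
  assumes "\<eta> \<in> L2_strip L \<inter> L1_strip L" "AE x\<in>strip L in lborel. 0 \<le> \<eta> x"
  shows "\<exists>u. vort u \<and> ms u = mass L \<eta> \<and> imp u = impulse L \<eta> \<and> fnl lam u = energy2 L lam \<eta>"
proof -
  define h where "h x = indicator (strip L) x * \<eta> x" for x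
  \<comment> \<open>Restricting to the strip and taking the positive part changes the given function
    there on a null set only, so all integrals agree.\<close>
  define u where "u x = max 0 (h x)" for x
  have hi: "integrable lborel h"
    using assms(1) unfolding L1_strip_def set_integrable_def h_def[abs_def] by simp
  then have hm [measurable]: "h \<in> borel_measurable borel" by simp
  have h2: "integrable lborel (\<lambda>x. (h x)\<^sup>2)"
  proof -
    have "(h x)\<^sup>2 = indicator (strip L) x *\<^sub>R (\<eta> x)\<^sup>2" for x by (simp add: h_def split: split_indicator)
    then show ?thesis using assms(1) unfolding L2_strip_def set_integrable_def by simp
  qed
  have um [measurable]: "u \<in> borel_measurable borel" unfolding u_def[abs_def] by measurable
  have hu: "AE x in lborel. h x = u x"
    using assms(2) by eventually_elim (auto simp: h_def u_def split: split_indicator)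
  have u: "vort u"
    unfolding vort_def
  proof (intro conjI allI impI)
    show "integrable lborel u"
      using hi hu by (subst integrable_cong_AE[of u lborel h]) auto
    show "integrable lborel (\<lambda>x. (u x)\<^sup>2)"
      using h2 hu by (subst integrable_cong_AE[of "\<lambda>x. (u x)\<^sup>2" lborel "\<lambda>x. (h x)\<^sup>2"]) auto
  qed (auto simp: u_def h_def)
  have "ms u = (\<integral>x. h x \<partial>lborel)" unfolding ms_def by (rule integral_cong_AE) (use hu in auto)
  then have m: "ms u = mass L \<eta>" by (simp add: mass_def set_lebesgue_integral_def h_def)
  have "imp u = (\<integral>x. snd x * h x \<partial>lborel)" unfolding imp_def by (rule integral_cong_AE) (use hu in auto)
  then have i: "imp u = impulse L \<eta>" by (simp add: impulse_def set_lebesgue_integral_def h_def mult_ac)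
  have "sq u = (\<integral>x. (h x)\<^sup>2 \<partial>lborel)" unfolding sq_def by (rule integral_cong_AE) (use hu in auto)
  also have "\<dots> = (\<integral>x. indicator (strip L) x * (\<eta> x)\<^sup>2 \<partial>lborel)"
    by (intro Bochner_Integration.integral_cong) (auto simp: h_def split: split_indicator)
  finally have s: "sq u = (LINT x:strip L|lborel. (\<eta> x)\<^sup>2)" by (simp add: set_lebesgue_integral_def)
  have pot: "pot u x = (\<integral>y. gk x y * h y \<partial>lborel)" for x
    unfolding pot_def by (rule integral_cong_AE) (use hu in auto)
  have "form u u = (\<integral>x. pot u x * h x \<partial>lborel)"
    unfolding form_def by (rule integral_cong_AE) (use hu in auto)
  also have "\<dots> = (\<integral>x. indicator (strip L) x * (\<integral>y. indicator (strip L) y * (green L x y * \<eta> x * \<eta> y) \<partial>lborel) \<partial>lborel)"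
  proof (intro Bochner_Integration.integral_cong refl)
    fix x
    show "pot u x * h x = indicator (strip L) x * (\<integral>y. indicator (strip L) y * (green L x y * \<eta> x * \<eta> y) \<partial>lborel)"
    proof (cases "x \<in> strip L")
      case True
      have "pot u x * h x = (\<integral>y. gk x y * h y * h x \<partial>lborel)" by (simp add: pot)
      also have "\<dots> = (\<integral>y. indicator (strip L) y * (green L x y * \<eta> x * \<eta> y) \<partial>lborel)"
        using True by (intro Bochner_Integration.integral_cong) (auto simp: gk_def h_def split: split_indicator)
      finally show ?thesis using True by simp
    qed (simp add: h_def)
  qed
  finally have "form u u = 2 * energy L \<eta>" by (simp add: energy_def set_lebesgue_integral_def)
  then have "fnl lam u = energy2 L lam \<eta>" by (simp add: fnl_def energy2_def s)
  with u m i show ?thesis by blast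
qed

lemma vort_strip:
  assumes "vort u"
  shows "u \<in> L2_strip L \<inter> L1_strip L" "AE x\<in>strip L in lborel. 0 \<le> u x"
    "mass L u = ms u" "impulse L u = imp u" "energy2 L lam u = fnl lam u"
proof -
  have ind: "indicator (strip L) x * u x = u x" for x using vortD(4)[OF assms, of x] by (auto split: split_indicator)
  have ind2: "indicator (strip L) x * (u x)\<^sup>2 = (u x)\<^sup>2" and ind3: "indicator (strip L) x * (snd x * u x) = snd x * u x" for x
    using vortD(4)[OF assms, of x] by (auto split: split_indicator)
  show "u \<in> L2_strip L \<inter> L1_strip L"
    using vortD(1,2)[OF assms] by (simp add: L2_strip_def L1_strip_def set_integrable_def set_borel_measurable_def ind ind2)
  show "AE x\<in>strip L in lborel. 0 \<le> u x" using vortD(3)[OF assms] by simp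
  show "mass L u = ms u" by (simp add: mass_def set_lebesgue_integral_def ind ms_def)
  show "impulse L u = imp u" by (simp add: impulse_def set_lebesgue_integral_def ind3 imp_def)
  have "(\<integral>y. indicator (strip L) y * (green L x y * u x * u y) \<partial>lborel) * indicator (strip L) x = pot u x * u x" for x
  proof (cases "x \<in> strip L")
    case True
    have "(\<integral>y. indicator (strip L) y * (green L x y * u x * u y) \<partial>lborel) = (\<integral>y. gk x y * u y * u x \<partial>lborel)"
      using True by (intro Bochner_Integration.integral_cong) (auto simp: gk_def split: split_indicator)
    then show ?thesis using True by (simp add: pot_def)
  qed (simp add: vortD(4)[OF assms])
  then have "2 * energy L u = form u u"
    by (simp add: energy_def set_lebesgue_integral_def form_def mult.commute)
  then show "energy2 L lam u = fnl lam u"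
    by (simp add: energy2_def fnl_def set_lebesgue_integral_def ind2 sq_def)
qed

text \<open>The height is positive on the strip, so zero impulse forces u = 0 almost everywhere.
  Hence a maximizer with F > 0 has positive impulse, as the hypothesis on M1 and the final rescaling
  both require.\<close>

lemma fnl_nonpos_if_imp_0:
  assumes u: "vort u" and "imp u = 0" "0 < lam"
  shows "fnl lam u \<le> 0"
proof -
  have nn: "0 \<le> snd x * u x" for x
    using vortD(3,4)[OF u, of x] by (cases "x \<in> strip L") (auto simp: strip_iff)
  have "AE x in lborel. snd x * u x = 0"
    using integral_nonneg_eq_0_iff_AE[OF imp_integrable[OF u]] nn assms(2) by (simp add: imp_def)
  then have "AE x in lborel. pot u x * u x = 0"
  proof eventually_elim
    case (elim x)
    then have "u x = 0" using vortD(4)[OF u, of x] by (cases "x \<in> strip L") (auto simp: strip_iff)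
    then show ?case by simp
  qed
  then have "form u u = 0" unfolding form_def by (rule integral_eq_zero_AE)
  moreover have "0 \<le> 1 / (2 * lam) * sq u" using sq_nonneg assms by simp
  ultimately show ?thesis by (simp add: fnl_def)
qed

end

theorem proposition4p8:
  fixes L lam M1 \<mu> \<nu> :: real
  assumes "0 < L"
    and "lam > pi ^ 5 / (2 * L\<^sup>2)"
    and "small_impulse_const L lam M1"
    and "0 < \<nu>"
    and "0 < \<mu>" and "\<mu> < M1 * \<nu>"
  shows "\<exists>\<omega> \<in> K_relaxed L \<mu> \<nu>.
      ereal (- energy2 L lam \<omega>) = (INF \<eta> \<in> K_relaxed L \<mu> \<nu>. ereal (- energy2 L lam \<eta>)) \<and>
      impulse L \<omega> = \<mu> \<and>
      compact (closure {x \<in> strip L. \<omega> x \<noteq> 0}) \<and>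
      \<omega> \<in> S_set L \<mu> \<nu> lam"
proof -
  interpret strip_domain L by standard (rule assms(1))
  have "0 < pi ^ 5 / (2 * L\<^sup>2)" using assms(1) by simp
  with assms(2) have "0 < lam" by linarith
  obtain u0 where "vort u0" "ms u0 \<le> \<nu>" "imp u0 \<le> \<mu>" "0 < fnl lam u0"
    using positive_functional[OF assms(2,4,5)] by blast
  from maximizer_exists[OF \<open>0 < lam\<close> assms(4,5) this]
  obtain v R where v: "vort v" "ms v \<le> \<nu>" "imp v \<le> \<mu>" "0 < fnl lam v"
    and R: "\<forall>x. v x \<noteq> 0 \<longrightarrow> 0 \<le> fst x \<and> fst x \<le> R"
    and max: "\<forall>u. vort u \<longrightarrow> ms u \<le> \<nu> \<longrightarrow> imp u \<le> \<mu> \<longrightarrow> fnl lam u \<le> fnl lam v"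
    by blast
  have max_K: "energy2 L lam \<eta> \<le> fnl lam v" if \<eta>: "\<eta> \<in> K_relaxed L \<mu> \<nu>" for \<eta>
  proof -
    obtain u where "vort u" "ms u = mass L \<eta>" "imp u = impulse L \<eta>" "fnl lam u = energy2 L lam \<eta>"
      using vort_of_AE_nonneg[of \<eta> lam] \<eta> unfolding K_relaxed_def by blast
    then show ?thesis using max \<eta> by (auto simp: K_relaxed_def)
  qed
  have vK: "v \<in> K_relaxed L \<mu> \<nu>"
    using vort_strip[OF v(1)] v by (simp add: K_relaxed_def)
  have imp_pos: "0 < imp v"
    using imp_nonneg[OF v(1)] fnl_nonpos_if_imp_0[OF v(1) _ \<open>0 < lam\<close>] v(4) by force
  have "0 < L * ms v" using imp_pos imp_le_ms[OF v(1)] by (rule less_le_trans)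
  then have "0 < ms v" using L_pos by (simp add: zero_less_mult_iff)
  define w where "w = (\<lambda>x. 1 / \<nu> * v x)"
  have w: "vort w" unfolding w_def using assms by (intro vort_cmult v) auto
  have w_eq: "ms w = ms v / \<nu>" "imp w = imp v / \<nu>" "fnl lam w = fnl lam v / \<nu>\<^sup>2"
    unfolding w_def ms_cmult imp_cmult fnl_cmult by (simp_all add: power_divide)
  \<comment> \<open>The impulse of v is not yet known to be \<mu>, so the class uses the actual
    value. A competitor multiplied by \<nu> has this same impulse, at most \<mu>, and lies in the
    relaxed class, where v is maximal.\<close>
  have "w \<in> S_set L (imp v / \<nu>) 1 lam"
    unfolding S_set_def is_arg_min_def
  proof (intro CollectI conjI notI)
    show "w \<in> K_set L (imp v / \<nu>) 1"
      using vort_strip[OF w] w_eq v(2) assms by (simp add: K_set_def)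
    assume "\<exists>\<eta>. \<eta> \<in> K_set L (imp v / \<nu>) 1 \<and> - energy2 L lam \<eta> < - energy2 L lam w"
    then obtain \<eta> where \<eta>: "\<eta> \<in> K_set L (imp v / \<nu>) 1" "energy2 L lam w < energy2 L lam \<eta>" by auto
    obtain u where u: "vort u" "ms u = mass L \<eta>" "imp u = impulse L \<eta>" "fnl lam u = energy2 L lam \<eta>"
      using vort_of_AE_nonneg[of \<eta> lam] \<eta>(1) unfolding K_set_def by blast
    have "vort (\<lambda>x. \<nu> * u x)" using assms by (intro vort_cmult u) auto
    moreover have "ms (\<lambda>x. \<nu> * u x) \<le> \<nu>" "imp (\<lambda>x. \<nu> * u x) \<le> \<mu>"
      using u \<eta>(1) assms v(3) by (auto simp: ms_cmult imp_cmult K_set_def)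
    ultimately have "\<nu>\<^sup>2 * fnl lam u \<le> fnl lam v" using max fnl_cmult[of lam \<nu> u] by auto
    then have "fnl lam u \<le> fnl lam w" using assms by (simp add: w_eq field_simps)
    then show False using \<eta>(2) u(4) vort_strip(5)[OF w, of lam] by simp
  qed
  moreover have "0 < imp v / \<nu>" "imp v / \<nu> < M1"
    using imp_pos v(3) assms by (auto simp: field_simps intro: le_less_trans)
  \<comment> \<open>Supplies the side condition that the impulse is below L/2.\<close>
  moreover have "M1 \<le> L / 2" using assms(3) by (simp add: small_impulse_const_def)
  ultimately have "mass L w < 1"
    using assms(3) unfolding small_impulse_const_def by fastforce
  then have ms_v: "ms v < \<nu>" using vort_strip(3)[OF w] w_eq assms by simp
  have imp_v: "imp v = \<mu>"
  proof (rule ccontr)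
    assume "imp v \<noteq> \<mu>"
    with v(3) have "imp v < \<mu>" by simp
    \<comment> \<open>The largest factor allowed by both constraints; it exceeds 1 exactly because
      mass and impulse are both slack.\<close>
    define t where "t = min (\<nu> / ms v) (\<mu> / imp v)"
    have "1 < t" using ms_v \<open>imp v < \<mu>\<close> \<open>0 < ms v\<close> imp_pos by (simp add: t_def)
    have "t * ms v \<le> \<nu> / ms v * ms v" "t * imp v \<le> \<mu> / imp v * imp v"
      unfolding t_def using \<open>0 < ms v\<close> imp_pos by (intro mult_right_mono; simp)+
    then have "t * ms v \<le> \<nu>" "t * imp v \<le> \<mu>" using \<open>0 < ms v\<close> imp_pos by auto
    moreover have "vort (\<lambda>x. t * v x)" using \<open>1 < t\<close> by (intro vort_cmult v) auto
    ultimately have "t\<^sup>2 * fnl lam v \<le> fnl lam v"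
      using max[rule_format, of "\<lambda>x. t * v x"] by (simp add: ms_cmult imp_cmult fnl_cmult)
    then have "t\<^sup>2 \<le> 1" using v(4) by simp
    moreover have "1 < t\<^sup>2" using \<open>1 < t\<close> by (simp add: power2_eq_square less_1_mult)
    ultimately show False by simp
  qed
  have "ereal (- energy2 L lam v) = (INF \<eta> \<in> K_relaxed L \<mu> \<nu>. ereal (- energy2 L lam \<eta>))"
    using max_K vK vort_strip(5)[OF v(1), of lam]
    by (intro antisym INF_greatest INF_lower) auto
  moreover have "bounded {x \<in> strip L. v x \<noteq> 0}"
  proof (rule bounded_subset[OF bounded_Times])
    show "{x \<in> strip L. v x \<noteq> 0} \<subseteq> {0..R} \<times> {0..L}"
      using R by (auto simp: strip_def)
  qed auto
  moreover have "v \<in> S_set L \<mu> \<nu> lam"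
    unfolding S_set_def is_arg_min_def
  proof (intro CollectI conjI notI)
    show "v \<in> K_set L \<mu> \<nu>"
      using vort_strip[OF v(1)] v(2) imp_v by (simp add: K_set_def)
    assume "\<exists>\<eta>. \<eta> \<in> K_set L \<mu> \<nu> \<and> - energy2 L lam \<eta> < - energy2 L lam v"
    then obtain \<eta> where "\<eta> \<in> K_set L \<mu> \<nu>" "energy2 L lam v < energy2 L lam \<eta>" by auto
    then show False
      using max_K[of \<eta>] vort_strip(5)[OF v(1), of lam] by (auto simp: K_set_def K_relaxed_def)
  qed
  ultimately show ?thesis
    using vK imp_v vort_strip(4)[OF v(1)] by (auto simp: compact_closure)
qed

end
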